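(* Let $n \ge 2$ and $m \ge 1$ be integers and let $f:\mathbb{F}_2^n \to \mathbb{F}_2^m$ be an arbitrary $n$-input $m$-output Boolean function. Then there is a Clifford+T quantum circuit (with measurement-based uncomputation allowed) that implements the unitary $U_f:\lvert \mathbf{x}\rangle\lvert \mathbf{y}\rangle \mapsto \lvert \mathbf{x}\rangle\lvert \mathbf{y}\oplus f(\mathbf{x})\rangle$ for all $\mathbf{x}\in\mathbb{F}_2^n$, $\mathbf{y}\in\mathbb{F}_2^m$, and that has T depth $\lceil \log_2 n\rceil$ (the paper describes this T depth as optimal). This circuit uses (i) at most $2^{n-1}(3n-2) - 3n + m + 1$ reusable ancilla qubits, (ii) at most $2^{n+1}(n-2) + 4$ T gates, (iii) at most $2^{n-1}(11n + 2m - 18) - 4n - m + 9$ CNOT gates, (iv) a CNOT depth of at most $2^n + 2n + 9\lceil \log_2 n\rceil - 3$.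
   Context: $\mathbb{F}_2=\{0,1\}$ and $\oplus$ denotes bitwise addition mod 2. Every $f:\mathbb{F}_2^n\to\mathbb{F}_2^m$ consists of $m$ coordinate functions $f_j:\mathbb{F}_2^n\to\mathbb{F}_2$. Each coordinate function has a unique algebraic normal form (ANF) $f_j(x_1,\dots,x_n)=\bigoplus_{I\subseteq\{1,\dots,n\}} a_I\prod_{i\in I}x_i$ with $a_I\in\mathbb{F}_2$, where the empty product equals $1$. A Clifford+T circuit is a quantum circuit built from the Hadamard gate $H$, the phase gate $S$, the CNOT gate, the $T=\mathrm{diag}(1,e^{i\pi/4})$ gate and its inverse $T^\dagger$. Measurement-based uncomputation means the circuit may additionally perform computational-basis measurements of qubits together with classically controlled Clifford corrections. Ancilla qubits are qubits beyond the $n$ input qubits $\lvert\mathbf{x}\rangle$ and the $m$ output qubits $\lvert\mathbf{y}\rangle$. Each ancilla starts in $\lvert 0\rangle$. An ancilla is reusable if it is returned to $\lvert 0\rangle$ by the end of the computation. Circuit depth is the number of layers of gates, where gates acting on disjoint sets of qubits may be executed in the same layer. The T depth is the number of layers that contain at least one $T$ or $T^\dagger$ gate. The CNOT depth is defined in the same way, counting layers that contain CNOT gates. *)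

theory Defs
  imports Complex_Main
begin

text \<open>Qubits are indexed by natural numbers; a computational basis state is a
  function nat => bool (bit of each qubit). A (pure, possibly unnormalized) state
  is a complex amplitude function on basis states.\<close>

type_synonym basis = "nat \<Rightarrow> bool"
type_synonym qstate = "basis \<Rightarrow> complex"

datatype gate = GH nat | GS nat | GT nat | GTdg nat | GCNOT nat nat

text \<open>Operations: an unconditional gate, a computational-basis measurement of a
  qubit whose outcome is stored in a classical bit, or a gate classically
  controlled by a classical bit (only Clifford gates H, S, CNOT are allowed there).\<close>
datatype op = Gate gate | Meas nat nat | CGate nat gate

definition ket :: "basis \<Rightarrow> qstate" where
  "ket b = (\<lambda>b'. if b' = b then 1 else 0)"

fun apply_gate :: "gate \<Rightarrow> qstate \<Rightarrow> qstate" where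
  "apply_gate (GH q) \<psi> =
     (\<lambda>b. (\<psi> (b(q := False)) + (if b q then -1 else 1) * \<psi> (b(q := True)))
            / complex_of_real (sqrt 2))"
| "apply_gate (GS q) \<psi> = (\<lambda>b. (if b q then \<i> else 1) * \<psi> b)"
| "apply_gate (GT q) \<psi> = (\<lambda>b. (if b q then cis (pi / 4) else 1) * \<psi> b)"
| "apply_gate (GTdg q) \<psi> = (\<lambda>b. (if b q then cis (- pi / 4) else 1) * \<psi> b)"
| "apply_gate (GCNOT c t) \<psi> = (\<lambda>b. \<psi> (b(t := (b t \<noteq> b c))))"

text \<open>Semantics of one branch: the function o fixes the outcome of every
  classical bit; a measurement projects onto the corresponding outcome
  (unnormalized), a conditional gate is applied iff its classical bit is 1.\<close>
fun apply_op :: "(nat \<Rightarrow> bool) \<Rightarrow> op \<Rightarrow> qstate \<Rightarrow> qstate" where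
  "apply_op o' (Gate g) \<psi> = apply_gate g \<psi>"
| "apply_op o' (Meas q c) \<psi> = (\<lambda>b. if b q = o' c then \<psi> b else 0)"
| "apply_op o' (CGate c g) \<psi> = (if o' c then apply_gate g \<psi> else \<psi>)"

type_synonym circuit = "op list list"

definition exec_layer :: "(nat \<Rightarrow> bool) \<Rightarrow> op list \<Rightarrow> qstate \<Rightarrow> qstate" where
  "exec_layer o' L \<psi> = fold (apply_op o') L \<psi>"

definition exec :: "(nat \<Rightarrow> bool) \<Rightarrow> circuit \<Rightarrow> qstate \<Rightarrow> qstate" where
  "exec o' C \<psi> = fold (exec_layer o') C \<psi>"

fun gate_qubits :: "gate \<Rightarrow> nat set" where
  "gate_qubits (GH q) = {q}"
| "gate_qubits (GS q) = {q}"
| "gate_qubits (GT q) = {q}"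
| "gate_qubits (GTdg q) = {q}"
| "gate_qubits (GCNOT c t) = {c, t}"

fun op_qubits :: "op \<Rightarrow> nat set" where
  "op_qubits (Gate g) = gate_qubits g"
| "op_qubits (Meas q c) = {q}"
| "op_qubits (CGate c g) = gate_qubits g"

fun gate_ok :: "gate \<Rightarrow> bool" where
  "gate_ok (GCNOT c t) = (c \<noteq> t)"
| "gate_ok _ = True"

fun is_clifford_gate :: "gate \<Rightarrow> bool" where
  "is_clifford_gate (GT q) = False"
| "is_clifford_gate (GTdg q) = False"
| "is_clifford_gate _ = True"

fun op_ok :: "op \<Rightarrow> bool" where
  "op_ok (Gate g) = gate_ok g"
| "op_ok (Meas q c) = True"
| "op_ok (CGate c g) = (gate_ok g \<and> is_clifford_gate g)"

fun meas_bit :: "op \<Rightarrow> nat option" where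
  "meas_bit (Meas q c) = Some c"
| "meas_bit _ = None"

definition wf_circuit :: "nat \<Rightarrow> circuit \<Rightarrow> bool" where
  "wf_circuit N C \<longleftrightarrow>
     (\<forall>L\<in>set C. \<forall>p\<in>set L. op_ok p \<and> op_qubits p \<subseteq> {..<N}) \<and>
     (\<forall>L\<in>set C. \<forall>i<length L. \<forall>j<length L. i \<noteq> j \<longrightarrow>
          op_qubits (L ! i) \<inter> op_qubits (L ! j) = {}) \<and>
     distinct (List.map_filter meas_bit (concat C)) \<and>
     (\<forall>k<length C. \<forall>c g. CGate c g \<in> set (C ! k) \<longrightarrow>
          (\<exists>k'<k. \<exists>q. Meas q c \<in> set (C ! k')))"

fun is_T_op :: "op \<Rightarrow> bool" where
  "is_T_op (Gate (GT q)) = True"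
| "is_T_op (Gate (GTdg q)) = True"
| "is_T_op (CGate c (GT q)) = True"
| "is_T_op (CGate c (GTdg q)) = True"
| "is_T_op _ = False"

fun is_CNOT_op :: "op \<Rightarrow> bool" where
  "is_CNOT_op (Gate (GCNOT c t)) = True"
| "is_CNOT_op (CGate c' (GCNOT c t)) = True"
| "is_CNOT_op _ = False"

definition T_count :: "circuit \<Rightarrow> nat" where
  "T_count C = length (filter is_T_op (concat C))"

definition CNOT_count :: "circuit \<Rightarrow> nat" where
  "CNOT_count C = length (filter is_CNOT_op (concat C))"

definition T_depth :: "circuit \<Rightarrow> nat" where
  "T_depth C = length (filter (\<lambda>L. \<exists>p\<in>set L. is_T_op p) C)"

definition CNOT_depth :: "circuit \<Rightarrow> nat" where
  "CNOT_depth C = length (filter (\<lambda>L. \<exists>p\<in>set L. is_CNOT_op p) C)"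

definition enc :: "bool list \<Rightarrow> bool list \<Rightarrow> basis" where
  "enc xs ys = (\<lambda>i. if i < length xs then xs ! i
                   else if i < length xs + length ys then ys ! (i - length xs)
                   else False)"

text \<open>The circuit implements U_f with reusable ancillas: in every measurement
  branch o, the (linear) branch map sends |x>|y>|0...0> to
  lambda_o |x>|y xor f(x)>|0...0>, with a scalar lambda_o independent of x, y
  (a branch-dependent global phase/amplitude).\<close>
definition implements :: "nat \<Rightarrow> nat \<Rightarrow> (bool list \<Rightarrow> bool list) \<Rightarrow> circuit \<Rightarrow> bool" where
  "implements n m f C \<longleftrightarrow>
     (\<forall>o'. \<exists>\<kappa>::complex. \<forall>xs ys. length xs = n \<longrightarrow> length ys = m \<longrightarrow>
        exec o' C (ket (enc xs ys)) =
          (\<lambda>b. \<kappa> * ket (enc xs (map2 (\<noteq>) ys (f xs))) b))"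

end

theory Submission
  imports Defs "HOL-Library.Countable" "HOL-Library.Multiset"
begin

text \<open>
  Every nonempty set of inputs gets a private binary tree of conjunctions, so all
  \<open>2^n - 1\<close> nonconstant monomials of the algebraic normal form are available after \<open>\<lceil>log n\<rceil>\<close> levels.
  A conjunction uses four T gates in one layer and six CNOTs; measuring its result in the X basis
  removes it again, with one classically controlled CZ as correction. Copies of a bit are made in
  constant CNOT depth: a chain of Bell pairs is merged with the bit by parity measurements whose
  outcomes fix all copies up to known Pauli corrections. In every measurement branch each gadget
  maps basis states to basis states with one fixed amplitude.

  The outputs are treated in pairs. A monomial contributes to the first output, to the second one,
  or to both; in the last case it is added to an auxiliary qubit that is finally added to both
  outputs. So a pair costs one CNOT per monomial plus two, and the CNOTs saved pay for the copies
  of the monomials. The pairs are grouped into blocks of size \<open>K \<ge> 2^n - 1\<close>, each with its own copies of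
  the monomials, and a cyclic schedule serves a block in \<open>K\<close> CNOT layers, whatever the number of
  outputs. Here \<open>K = 2^n - 1\<close>, except that the CNOT count forces \<open>K = 6\<close> for \<open>n = 2\<close>.
\<close>

section \<open>Timed lists of operations\<close>

text \<open>The bounds leave no slack in \<open>m\<close>. The CNOT count grows by
  \<open>2 ^ n - 1\<close> per output, exactly one CNOT per monomial, while the CNOT depth is
  independent of \<open>m\<close>. A qubit controls at most one CNOT per layer, so many outputs are
  served in that depth from copies of the monomials, and a copy costs two CNOTs. Pairing two outputs
  lowers their price from \<open>2 * B\<close> to \<open>B + 2\<close>, where
  \<open>B = 2 ^ n - 1\<close>, and a block of \<open>K\<close> pairs may spend the gain on the
  \<open>2 * B\<close> CNOTs for its copies. This balances iff
  \<open>2 * K + 2 * B \<le> B * K\<close>: \<open>K = B\<close> works for \<open>B \<ge> 4\<close>,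
  whereas \<open>B = 3\<close> needs \<open>K \<ge> 6\<close>; with \<open>K = 6\<close> the CNOT
  depth for \<open>n = 2\<close> meets its bound 14 exactly.

  The ancillas are as tight: beyond the trees one per output is allowed. Half of them are the
  auxiliary qubits of the pairs, the other half the copies, so the partners in Bell pairs must be
  borrowed from qubits that are idle at that moment.

  The T bound is that of trees without any sharing: a product of \<open>length l\<close> factors
  takes \<open>length l - 1\<close> conjunctions, which sums to
  \<open>n * 2 ^ (n - 1) - 2 ^ n + 1\<close>, and four T gates each give the stated number.\<close>

abbreviation run :: "(nat \<Rightarrow> bool) \<Rightarrow> op list \<Rightarrow> qstate \<Rightarrow> qstate" where
  "run o' ops \<psi> \<equiv> fold (apply_op o') ops \<psi>"

lemma apply_gate_commute:
  "gate_qubits g \<inter> gate_qubits g' = {} \<Longrightarrow>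
     apply_gate g (apply_gate g' \<psi>) = apply_gate g' (apply_gate g \<psi>)"
  by (cases g; cases g')
    (simp_all add: fun_eq_iff fun_upd_twist add_divide_distrib diff_divide_distrib ring_distribs)

lemma apply_gate_project:
  "q \<notin> gate_qubits g \<Longrightarrow> apply_gate g (\<lambda>b. if b q = v then \<psi> b else 0) =
     (\<lambda>b. if b q = v then apply_gate g \<psi> b else 0)"
  by (cases g) (auto simp: fun_eq_iff)

text \<open>In a branch the outcomes are fixed in advance, so a measurement is a projection and a
  classically controlled gate is a gate or the identity. Shared classical bits therefore never
  obstruct commutation; that an outcome is known in time is tracked separately by
  \<open>causal\<close>.\<close>

lemma apply_op_commute:
  "op_qubits p \<inter> op_qubits p' = {} \<Longrightarrow>
     apply_op o' p (apply_op o' p' \<psi>) = apply_op o' p' (apply_op o' p \<psi>)"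
  by (cases p; cases p')
    (auto simp: apply_gate_project simp del: apply_gate.simps intro: apply_gate_commute)

text \<open>A circuit is given as a list of operations with time stamps. The list order is used for the
  semantics and the stamps are the layers; both give the same map if operations that share a
  qubit are stamped in list order.\<close>

definition sched :: "(nat \<times> op) list \<Rightarrow> bool" where
  "sched = sorted_wrt (\<lambda>a b. op_qubits (snd a) \<inter> op_qubits (snd b) \<noteq> {} \<longrightarrow> fst a < fst b)"

definition layers :: "nat \<Rightarrow> (nat \<times> op) list \<Rightarrow> circuit" where
  "layers D P = map (\<lambda>t. map snd (filter (\<lambda>a. fst a = t) P)) [0..<D]"

lemma sched_append:
  "sched (P @ Q) \<longleftrightarrow> sched P \<and> sched Q \<and>
     (\<forall>a\<in>set P. \<forall>b\<in>set Q. op_qubits (snd a) \<inter> op_qubits (snd b) \<noteq> {} \<longrightarrow> fst a < fst b)"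
  by (auto simp: sched_def sorted_wrt_append)

lemma sched_filter: "sched P \<Longrightarrow> sched (filter Q P)"
  by (auto simp: sched_def sorted_wrt_filter)

lemma run_move:
  assumes "\<forall>p\<in>set ops. op_qubits a \<inter> op_qubits p = {}"
  shows "run o' ops (apply_op o' a \<psi>) = apply_op o' a (run o' ops \<psi>)"
  using assms
proof (induction ops arbitrary: \<psi>)
  case (Cons p ops)
  then have "run o' (p # ops) (apply_op o' a \<psi>) = run o' ops (apply_op o' a (apply_op o' p \<psi>))"
    using apply_op_commute[of a p] by simp
  with Cons show ?case by simp
qed simp

text \<open>An operation of layer \<open>D\<close> can be moved behind all later list entries with a
  smaller stamp: if they shared a qubit, \<open>sched\<close> would force their stamp above
  \<open>D\<close>.\<close>

lemma run_split_last:
  assumes "sched P" "\<forall>a\<in>set P. fst a < Suc D"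
  shows "run o' (map snd P) \<psi> = run o' (map snd (filter (\<lambda>a. fst a = D) P))
           (run o' (map snd (filter (\<lambda>a. fst a < D) P)) \<psi>)"
  using assms
proof (induction P arbitrary: \<psi>)
  case (Cons a P)
  have IH: "\<And>\<psi>. run o' (map snd P) \<psi> = run o' (map snd (filter (\<lambda>a. fst a = D) P))
           (run o' (map snd (filter (\<lambda>a. fst a < D) P)) \<psi>)"
    using Cons by (simp add: sched_def)
  show ?case
  proof (cases "fst a < D")
    case True
    then show ?thesis using IH by simp
  next
    case False
    then have eq: "fst a = D" using Cons.prems by auto
    have "\<forall>p\<in>set (map snd (filter (\<lambda>a. fst a < D) P)). op_qubits (snd a) \<inter> op_qubits p = {}"
      using Cons.prems(1) eq by (fastforce simp: sched_def)
    from run_move[OF this] show ?thesis using IH eq by simp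
  qed
qed simp

lemma layers_filter: "layers D (filter (\<lambda>a. fst a < D) P) = layers D P"
proof -
  have "filter (\<lambda>a. fst a = t) (filter (\<lambda>a. fst a < D) P) = filter (\<lambda>a. fst a = t) P" if "t < D" for t
    using that by (simp add: filter_filter) (metis (mono_tags, lifting) filter_cong)
  then show ?thesis by (simp add: layers_def)
qed

lemma length_layers [simp]: "length (layers D P) = D"
  by (simp add: layers_def)

lemma exec_layers:
  assumes "sched P" "\<forall>a\<in>set P. fst a < D"
  shows "exec o' (layers D P) \<psi> = run o' (map snd P) \<psi>"
  using assms
proof (induction D arbitrary: P \<psi>)
  case 0
  then have "P = []" by (cases P) auto
  then show ?case by (simp add: exec_def layers_def)
next
  case (Suc D)
  let ?P = "filter (\<lambda>a. fst a < D) P"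
  have *: "layers D ?P = layers D P"
    by (rule layers_filter)
  have "exec o' (layers D ?P) \<psi> = run o' (map snd ?P) \<psi>"
    by (rule Suc.IH) (use Suc.prems(1) in \<open>auto intro: sched_filter\<close>)
  then have "exec o' (layers D P) \<psi> = run o' (map snd ?P) \<psi>"
    unfolding * .
  moreover have "exec o' (layers (Suc D) P) \<psi> =
      run o' (map snd (filter (\<lambda>a. fst a = D) P)) (exec o' (layers D P) \<psi>)"
    by (simp add: layers_def exec_def exec_layer_def)
  ultimately show ?case
    using run_split_last[OF Suc.prems] by metis
qed

text \<open>Cutting into layers only permutes the operations, so gate counts and the distinctness of
  classical bits can be read off the timed list.\<close>

lemma mset_layers:
  assumes "\<forall>a\<in>set P. fst a < D"
  shows "mset (concat (layers D P)) = mset (map snd P)"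
  using assms
proof (induction D arbitrary: P)
  case 0
  then have "P = []" by (cases P) auto
  then show ?case by (simp add: layers_def)
next
  case (Suc D)
  let ?P = "filter (\<lambda>a. fst a < D) P"
  have *: "layers D ?P = layers D P"
    by (rule layers_filter)
  have eq: "filter (\<lambda>a. \<not> fst a < D) P = filter (\<lambda>a. fst a = D) P"
    using Suc.prems by (intro filter_cong) auto
  have "mset (concat (layers (Suc D) P)) = mset (concat (layers D P)) + mset (map snd (filter (\<lambda>a. fst a = D) P))"
    by (simp add: layers_def)
  also have "mset (concat (layers D P)) = mset (map snd ?P)"
    using Suc.IH[of ?P] unfolding * by force
  also have "mset (map snd ?P) + mset (map snd (filter (\<lambda>a. fst a = D) P)) = image_mset snd (mset P)"
    unfolding eq[symmetric] by (simp flip: image_mset_union multiset_partition)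
  finally show ?case by simp
qed

definition count_ops :: "(op \<Rightarrow> bool) \<Rightarrow> (nat \<times> op) list \<Rightarrow> nat" where
  "count_ops Q P = length (filter Q (map snd P))"

definition op_times :: "(op \<Rightarrow> bool) \<Rightarrow> (nat \<times> op) list \<Rightarrow> nat set" where
  "op_times Q P = {t. \<exists>p. (t, p) \<in> set P \<and> Q p}"

lemma length_filter_layers:
  assumes "\<forall>a\<in>set P. fst a < D"
  shows "length (filter Q (concat (layers D P))) = count_ops Q P"
proof -
  have "mset (filter Q (concat (layers D P))) = mset (filter Q (map snd P))"
    using mset_layers[OF assms] by simp
  then show ?thesis unfolding count_ops_def by (metis size_mset)
qed

lemma T_count_layers: "\<forall>a\<in>set P. fst a < D \<Longrightarrow> T_count (layers D P) = count_ops is_T_op P"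
  and CNOT_count_layers: "\<forall>a\<in>set P. fst a < D \<Longrightarrow> CNOT_count (layers D P) = count_ops is_CNOT_op P"
  by (simp_all add: T_count_def CNOT_count_def length_filter_layers)

text \<open>Turns a depth into the cardinality of a set of stamps, so that stages which share a
  layer are charged for it only once.\<close>

lemma layers_depth:
  assumes "\<forall>a\<in>set P. fst a < D"
  shows "length (filter (\<lambda>L. \<exists>p\<in>set L. Q p) (layers D P)) = card (op_times Q P)"
proof -
  have "op_times Q P = {i. i < D \<and> (\<exists>p\<in>set (layers D P ! i). Q p)}"
    using assms by (force simp: op_times_def layers_def)
  then show ?thesis
    by (simp add: length_filter_conv_card)
qed

lemma T_depth_layers: "\<forall>a\<in>set P. fst a < D \<Longrightarrow> T_depth (layers D P) = card (op_times is_T_op P)"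
  and CNOT_depth_layers: "\<forall>a\<in>set P. fst a < D \<Longrightarrow> CNOT_depth (layers D P) = card (op_times is_CNOT_op P)"
  by (simp_all add: T_depth_def CNOT_depth_def layers_depth)

definition meas_bits :: "(nat \<times> op) list \<Rightarrow> nat list" where
  "meas_bits P = List.map_filter meas_bit (map snd P)"

definition causal :: "(nat \<times> op) list \<Rightarrow> bool" where
  "causal P \<longleftrightarrow> (\<forall>t c g. (t, CGate c g) \<in> set P \<longrightarrow> (\<exists>t'<t. \<exists>q. (t', Meas q c) \<in> set P))"

definition wf_ops :: "nat set \<Rightarrow> (nat \<times> op) list \<Rightarrow> bool" where
  "wf_ops A P \<longleftrightarrow> (\<forall>(t, p)\<in>set P. op_ok p \<and> op_qubits p \<subseteq> A)"

lemma sched_nth_disjoint: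
  assumes "sched P" "i < length (map snd (filter (\<lambda>a. fst a = t) P))"
    "j < length (map snd (filter (\<lambda>a. fst a = t) P))" "i \<noteq> j"
  shows "op_qubits (map snd (filter (\<lambda>a. fst a = t) P) ! i) \<inter> op_qubits (map snd (filter (\<lambda>a. fst a = t) P) ! j) = {}"
proof -
  let ?F = "filter (\<lambda>a. fst a = t) P"
  have s: "sched ?F" using assms(1) by (rule sched_filter)
  have t: "fst (?F ! k) = t" if "k < length ?F" for k
    using nth_mem[OF that] by auto
  have "op_qubits (snd (?F ! i)) \<inter> op_qubits (snd (?F ! j)) = {}" if "i < j" "j < length ?F" for i j
    using s that t[of i] t[of j] unfolding sched_def sorted_wrt_iff_nth_less by fastforce
  from this[of i j] this[of j i] assms show ?thesis
    by (cases "i < j") (simp_all add: Int_commute)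
qed

lemma wf_circuit_layers:
  assumes "sched P" "wf_ops {..<N} P" "causal P" "distinct (meas_bits P)" and D: "\<forall>a\<in>set P. fst a < D"
  shows "wf_circuit N (layers D P)"
proof -
  have mf: "mset (List.map_filter meas_bit xs) = mset (List.map_filter meas_bit ys)"
    if "mset xs = mset ys" for xs ys
    using that by (simp add: map_filter_def)
  have "distinct (List.map_filter meas_bit (concat (layers D P)))"
    using mf[OF mset_layers[OF D]] assms(4) unfolding meas_bits_def by (metis mset_eq_imp_distinct_iff)
  moreover have "\<exists>k'<k. \<exists>q. Meas q c \<in> set (layers D P ! k')"
    if "k < length (layers D P)" "CGate c g \<in> set (layers D P ! k)" for k c g
  proof -
    have "(k, CGate c g) \<in> set P" "k < D" using that by (auto simp: layers_def)
    then obtain t' q where "t' < k" "(t', Meas q c) \<in> set P"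
      using assms(3) unfolding causal_def by blast
    then show ?thesis using \<open>k < D\<close> by (force simp: layers_def)
  qed
  moreover have "\<forall>L\<in>set (layers D P). \<forall>p\<in>set L. op_ok p \<and> op_qubits p \<subseteq> {..<N}"
    using assms(2) by (fastforce simp: layers_def wf_ops_def)
  moreover have "\<forall>L\<in>set (layers D P). \<forall>i<length L. \<forall>j<length L. i \<noteq> j \<longrightarrow>
          op_qubits (L ! i) \<inter> op_qubits (L ! j) = {}"
    using sched_nth_disjoint[OF assms(1)] unfolding layers_def by (auto simp del: nth_map)
  ultimately show ?thesis unfolding wf_circuit_def by blast
qed

section \<open>Costs and side conditions of concatenated timed lists\<close>

lemma count_ops_simps [simp]:
  "count_ops Q [] = 0" "count_ops Q (P @ P') = count_ops Q P + count_ops Q P'"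
  "count_ops Q (a # P) = (if Q (snd a) then 1 else 0) + count_ops Q P"
  by (auto simp: count_ops_def)

lemma op_times_simps [simp]:
  "op_times Q [] = {}" "op_times Q (P @ P') = op_times Q P \<union> op_times Q P'"
  "op_times Q (a # P) = (if Q (snd a) then {fst a} else {}) \<union> op_times Q P"
  by (cases a; auto simp: op_times_def)+

lemma op_times_concat: "op_times Q (concat (map G xs)) = (\<Union>x\<in>set xs. op_times Q (G x))"
  by (induction xs) auto

lemma meas_bits_simps [simp]:
  "meas_bits [] = []" "meas_bits (P @ P') = meas_bits P @ meas_bits P'"
  "meas_bits (a # P) = (case meas_bit (snd a) of None \<Rightarrow> meas_bits P | Some c \<Rightarrow> c # meas_bits P)"
  by (auto simp: meas_bits_def map_filter_def split: option.splits)

lemma wf_ops_simps [simp]: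
  "wf_ops A []" "wf_ops A (P @ P') \<longleftrightarrow> wf_ops A P \<and> wf_ops A P'"
  "wf_ops A (a # P) \<longleftrightarrow> op_ok (snd a) \<and> op_qubits (snd a) \<subseteq> A \<and> wf_ops A P"
  by (auto simp: wf_ops_def)

lemma wf_ops_concat: "wf_ops A (concat (map G xs)) \<longleftrightarrow> (\<forall>x\<in>set xs. wf_ops A (G x))"
  by (induction xs) auto

lemma causal_append: "causal P \<Longrightarrow> causal P' \<Longrightarrow> causal (P @ P')"
  unfolding causal_def by (metis UnE UnI1 UnI2 set_append)

lemma causal_concat: "(\<And>x. x \<in> set xs \<Longrightarrow> causal (G x)) \<Longrightarrow> causal (concat (map G xs))"
  by (induction xs) (auto intro!: causal_append simp: causal_def[of "[]"])

definition qubits :: "(nat \<times> op) list \<Rightarrow> nat set" where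
  "qubits P = (\<Union>a\<in>set P. op_qubits (snd a))"

lemma qubits_simps [simp]:
  "qubits [] = {}" "qubits (P @ P') = qubits P \<union> qubits P'"
  "qubits (a # P) = op_qubits (snd a) \<union> qubits P"
  by (auto simp: qubits_def)

lemma qubits_concat: "qubits (concat (map G xs)) = (\<Union>x\<in>set xs. qubits (G x))"
  by (induction xs) auto

lemma sched_append_times:
  assumes "sched P" "sched Q" "\<And>t t' p p'. (t, p) \<in> set P \<Longrightarrow> (t', p') \<in> set Q \<Longrightarrow> t < t'"
  shows "sched (P @ Q)"
  using assms unfolding sched_append by (metis prod.collapse)

lemma sched_append_disjoint:
  assumes "sched P" "sched Q" "qubits P \<inter> qubits Q = {}"
  shows "sched (P @ Q)"
  using assms unfolding sched_append qubits_def by blast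

section \<open>Operations executed one per layer\<close>

definition seqt :: "nat \<Rightarrow> op list \<Rightarrow> (nat \<times> op) list" where
  "seqt t ops = zip [t..<t + length ops] ops"

lemma map_snd_seqt [simp]: "map snd (seqt t ops) = ops"
  by (simp add: seqt_def)

lemma sched_seqt: "sched (seqt t ops)"
  unfolding sched_def sorted_wrt_iff_nth_less seqt_def by auto

lemma set_seqt: "(t', p) \<in> set (seqt t ops) \<Longrightarrow> t \<le> t' \<and> t' < t + length ops \<and> p \<in> set ops"
  unfolding seqt_def by (auto dest: set_zip_leftD set_zip_rightD)

lemma seqt_set: "p \<in> set ops \<Longrightarrow> \<exists>t'. (t', p) \<in> set (seqt t ops)"
  using map_snd_seqt[of t ops] by (metis (no_types, lifting) imageE list.set_map prod.collapse)

lemma qubits_seqt: "qubits (seqt t ops) = (\<Union>p\<in>set ops. op_qubits p)"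
  unfolding qubits_def by (metis (no_types) image_image list.set_map map_snd_seqt)

lemma wf_ops_seqt: "wf_ops A (seqt t ops) \<longleftrightarrow> (\<forall>p\<in>set ops. op_ok p \<and> op_qubits p \<subseteq> A)"
  unfolding wf_ops_def using set_seqt seqt_set by fast

lemma count_ops_seqt: "count_ops Q (seqt t ops) = length (filter Q ops)"
  by (simp add: count_ops_def)

lemma meas_bits_seqt: "meas_bits (seqt t ops) = List.map_filter meas_bit ops"
  by (simp add: meas_bits_def)

lemma op_times_seqt_empty: "\<forall>p\<in>set ops. \<not> Q p \<Longrightarrow> op_times Q (seqt t ops) = {}"
  by (auto simp: op_times_def dest: set_seqt)

section \<open>Gadgets on basis states\<close>

definition psends :: "(nat \<Rightarrow> bool) \<Rightarrow> op list \<Rightarrow> complex \<Rightarrow> basis \<Rightarrow> basis \<Rightarrow> bool" where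
  "psends o' ops a b b' \<longleftrightarrow> run o' ops (ket b) = (\<lambda>x. a * ket b' x)"

definition rt :: complex where "rt = 1 / complex_of_real (sqrt 2)"

text \<open>Each measurement contributes the factor \<open>1 / \<surd>2\<close>, so the amplitude does not depend on the
  input state.\<close>

definition sends :: "(nat \<Rightarrow> bool) \<Rightarrow> op list \<Rightarrow> basis \<Rightarrow> basis \<Rightarrow> bool" where
  "sends o' ops b b' \<longleftrightarrow> psends o' ops (rt ^ length (filter (\<lambda>p. meas_bit p \<noteq> None) ops)) b b'"

lemma rt_mult: "rt * rt = 1 / 2"
  unfolding rt_def by (simp flip: of_real_mult)

lemma apply_gate_scale: "apply_gate g (\<lambda>x. a * \<psi> x) = (\<lambda>x. a * apply_gate g \<psi> x)"
  by (cases g) (auto simp: fun_eq_iff ring_distribs)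

lemma apply_gate_plus: "apply_gate g (\<lambda>x. \<psi> x + \<phi> x) = (\<lambda>x. apply_gate g \<psi> x + apply_gate g \<phi> x)"
  by (cases g) (auto simp: fun_eq_iff ring_distribs add_divide_distrib diff_divide_distrib)

lemma apply_gate_minus: "apply_gate g (\<lambda>x. \<psi> x - \<phi> x) = (\<lambda>x. apply_gate g \<psi> x - apply_gate g \<phi> x)"
  by (cases g) (auto simp: fun_eq_iff ring_distribs add_divide_distrib diff_divide_distrib)

lemma apply_op_scale: "apply_op o' p (\<lambda>x. a * \<psi> x) = (\<lambda>x. a * apply_op o' p \<psi> x)"
  by (cases p) (simp_all add: apply_gate_scale fun_eq_iff)

lemma apply_op_plus: "apply_op o' p (\<lambda>x. \<psi> x + \<phi> x) = (\<lambda>x. apply_op o' p \<psi> x + apply_op o' p \<phi> x)"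
  by (cases p) (simp_all add: apply_gate_plus fun_eq_iff)

lemma run_scale: "run o' ops (\<lambda>x. a * \<psi> x) = (\<lambda>x. a * run o' ops \<psi> x)"
  by (induction ops arbitrary: \<psi>) (simp_all add: apply_op_scale)

lemma run_plus: "run o' ops (\<lambda>x. \<psi> x + \<phi> x) = (\<lambda>x. run o' ops \<psi> x + run o' ops \<phi> x)"
  by (induction ops arbitrary: \<psi> \<phi>) (simp_all add: apply_op_plus)

lemma psends_Nil: "psends o' [] 1 b b"
  by (simp add: psends_def)

lemma psends_append:
  "psends o' p a b b' \<Longrightarrow> psends o' q a' b' b'' \<Longrightarrow> psends o' (p @ q) (a * a') b b''"
  unfolding psends_def by (simp add: run_scale mult.assoc)

lemma psends_Cons:
  "psends o' [p] a b b' \<Longrightarrow> psends o' q a' b' b'' \<Longrightarrow> psends o' (p # q) (a * a') b b''"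
  using psends_append[of o' "[p]"] by simp

lemma sends_Nil: "sends o' [] b b"
  by (simp add: sends_def psends_Nil)

lemma sends_append: "sends o' p b b' \<Longrightarrow> sends o' q b' b'' \<Longrightarrow> sends o' (p @ q) b b''"
  unfolding sends_def by (simp add: psends_append power_add)

lemma sends_Cons: "sends o' [p] b b' \<Longrightarrow> sends o' q b' b'' \<Longrightarrow> sends o' (p # q) b b''"
  using sends_append[of o' "[p]"] by simp

lemma H_ket:
  "apply_gate (GH q) (ket b) =
     (\<lambda>x. rt * ket (b(q := False)) x + (if b q then -rt else rt) * ket (b(q := True)) x)"
proof (rule ext)
  fix x
  have "x(q := v) = b \<longleftrightarrow> b q = v \<and> (\<forall>i. i \<noteq> q \<longrightarrow> x i = b i)" for v
    unfolding fun_eq_iff by (metis fun_upd_apply)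
  then have 1: "ket b (x(q := v)) = (if b q = v \<and> (\<forall>i. i \<noteq> q \<longrightarrow> x i = b i) then 1 else 0)" for v
    unfolding ket_def by simp
  have "x = b(q := v) \<longleftrightarrow> x q = v \<and> (\<forall>i. i \<noteq> q \<longrightarrow> x i = b i)" for v
    unfolding fun_eq_iff by (metis fun_upd_apply)
  then have 2: "ket (b(q := v)) x = (if x q = v \<and> (\<forall>i. i \<noteq> q \<longrightarrow> x i = b i) then 1 else 0)" for v
    unfolding ket_def by simp
  show "apply_gate (GH q) (ket b) x =
     rt * ket (b(q := False)) x + (if b q then -rt else rt) * ket (b(q := True)) x"
    unfolding apply_gate.simps 1 2 by (simp add: rt_def) blast
qed

lemma psends_CNOT: "c \<noteq> t \<Longrightarrow> psends o' [Gate (GCNOT c t)] 1 b (b(t := (b t \<noteq> b c)))"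
  unfolding psends_def ket_def by (auto simp: fun_eq_iff)

lemma psends_CNOT': "c \<noteq> t \<Longrightarrow> b' = b(t := (b t \<noteq> b c)) \<Longrightarrow> psends o' [Gate (GCNOT c t)] 1 b b'"
  using psends_CNOT by simp

lemma sends_CNOT: "c \<noteq> t \<Longrightarrow> sends o' [Gate (GCNOT c t)] b (b(t := (b t \<noteq> b c)))"
  unfolding sends_def using psends_CNOT by simp

lemma psends_T: "psends o' [Gate (GT q)] (if b q then cis (pi / 4) else 1) b b"
  and psends_Tdg: "psends o' [Gate (GTdg q)] (if b q then cis (- pi / 4) else 1) b b"
  unfolding psends_def ket_def by (auto simp: fun_eq_iff)

text \<open>The gate set has no X; since two \<open>GS\<close> make a Z, this is X written as H Z
  H.\<close>

definition Xg :: "nat \<Rightarrow> gate list" where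
  "Xg q = [GH q, GS q, GS q, GH q]"

lemma S_ket: "apply_gate (GS q) (ket b) = (\<lambda>x. (if b q then \<i> else 1) * ket b x)"
  by (auto simp: fun_eq_iff ket_def)

lemma Xg_ket: "fold apply_gate (Xg q) (ket b) = ket (b(q := \<not> b q))"
proof -
  have "fold apply_gate (Xg q) (ket b) =
      (\<lambda>x. (rt * rt + rt * rt) * ket (b(q := \<not> b q)) x)"
    unfolding Xg_def
    by (cases "b q") (simp_all del: apply_gate.simps
      add: H_ket S_ket apply_gate_plus apply_gate_minus apply_gate_scale fun_eq_iff algebra_simps)
  then show ?thesis by (simp only: rt_mult) (simp add: fun_eq_iff)
qed

lemma run_gates: "run o' (map Gate gs) \<psi> = fold apply_gate gs \<psi>"
  by (induction gs arbitrary: \<psi>) auto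

lemma run_cgates: "run o' (map (CGate c) gs) \<psi> = (if o' c then fold apply_gate gs \<psi> else \<psi>)"
  by (induction gs arbitrary: \<psi>) auto

lemma psends_X: "psends o' (map Gate (Xg q)) 1 b (b(q := \<not> b q))"
  by (simp add: psends_def run_gates Xg_ket)

lemma psends_CX: "psends o' (map (CGate c) (Xg q)) 1 b (b(q := (b q \<noteq> o' c)))"
  by (simp add: psends_def run_cgates Xg_ket)

lemma filter_meas_gates [simp]:
  "filter (\<lambda>p. \<exists>y. meas_bit p = Some y) (map Gate gs) = []"
  "filter (\<lambda>p. \<exists>y. meas_bit p = Some y) (map (CGate c) gs) = []"
  by (induction gs) auto

lemma sends_X: "sends o' (map Gate (Xg q)) b (b(q := \<not> b q))"
  and sends_CX: "sends o' (map (CGate c) (Xg q)) b (b(q := (b q \<noteq> o' c)))"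
  unfolding sends_def using psends_X psends_CX by simp_all

text \<open>An X-basis measurement clears a qubit but leaves a sign, which is repaired
  whenever the cleared bit is a parity of bits that are still available.\<close>

definition xclear :: "nat \<Rightarrow> nat list \<Rightarrow> op list" where
  "xclear q fs = [Gate (GH q), Meas q (2 * q + 1)] @ map (CGate (2 * q + 1)) (Xg q)
     @ concat (map (\<lambda>t. [CGate (2 * q + 1) (GS t), CGate (2 * q + 1) (GS t)]) fs)"

text \<open>Once the outcome is fixed, the old value of \<open>q\<close> survives only as a sign of
  the amplitude, negative iff both the old bit and the outcome are 1.\<close>

lemma psends_H_Meas:
  "psends o' [Gate (GH q), Meas q c] (if o' c \<and> b q then -rt else rt) b (b(q := o' c))"
  unfolding psends_def by (auto simp: H_ket fun_eq_iff simp del: apply_gate.simps) (auto simp: ket_def split: if_splits)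

lemma psends_Zs:
  "psends o' (concat (map (\<lambda>t. [CGate c (GS t), CGate c (GS t)]) fs))
     (if o' c \<and> odd (length (filter b fs)) then -1 else 1) b b"
proof (induction fs)
  case Nil
  then show ?case using psends_Nil by simp
next
  case (Cons t fs)
  have "psends o' [CGate c (GS t), CGate c (GS t)] (if o' c \<and> b t then -1 else 1) b b"
    unfolding psends_def ket_def by (auto simp: fun_eq_iff)
  from psends_append[OF this Cons.IH] show ?case
    by (auto split: if_splits)
qed

lemma nmeas_Zs [simp]:
  "filter (\<lambda>p. \<exists>y. meas_bit p = Some y) (concat (map (\<lambda>t. [CGate c (GS t), CGate c (GS t)]) fs)) = []"
  by (induction fs) auto

lemma filter_fun_upd_notin: "q \<notin> set fs \<Longrightarrow> filter (b(q := v)) fs = filter b fs"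
  by (rule filter_cong) auto

text \<open>For outcome 1 the measurement leaves the sign \<open>(-1)^(b q)\<close>, and the Z
  corrections on \<open>fs\<close> leave the sign of their parity. As the cleared bit is that
  parity, the two cancel and the amplitude is \<open>rt\<close> on every input.\<close>

lemma sends_xclear:
  assumes "q \<notin> set fs" "b q = odd (length (filter b fs))"
  shows "sends o' (xclear q fs) b (b(q := False))"
proof -
  let ?c = "2 * q + 1" and ?b = "b(q := False)"
  have "psends o' (xclear q fs)
      ((if o' ?c \<and> b q then -rt else rt) * (1 * (if o' ?c \<and> odd (length (filter ?b fs)) then -1 else 1))) b ?b"
    unfolding xclear_def
    using psends_append[OF psends_H_Meas[of o' q ?c b] psends_append[OF psends_CX[of o' ?c q "b(q := o' ?c)"] psends_Zs]]
    by simp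
  moreover have "(if o' ?c \<and> b q then -rt else rt) * (1 * (if o' ?c \<and> odd (length (filter ?b fs)) then -1 else 1)) = rt"
    using assms by (simp add: filter_fun_upd_notin)
  ultimately show ?thesis by (simp add: sends_def) (simp add: xclear_def)
qed

text \<open>A Bell pair on \<open>q\<close>, \<open>p\<close> is merged with \<open>s\<close> by measuring \<open>p\<close>; the outcome forces \<open>q\<close> to
  hold \<open>s\<close> up to a known sign.\<close>

definition link :: "nat \<Rightarrow> nat \<Rightarrow> nat \<Rightarrow> nat \<Rightarrow> nat \<Rightarrow> nat \<Rightarrow> (nat \<times> op) list" where
  "link tH tB tL s q p = [(tH, Gate (GH q)), (tB, Gate (GCNOT q p)), (tL, Gate (GCNOT s p)), (Suc tL, Meas p (2 * p))]
     @ seqt (tL + 2) (map (CGate (2 * p)) (Xg p))"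

lemma sends_link:
  assumes "distinct [s, q, p]" "\<not> b q" "\<not> b p"
  shows "sends o' (map snd (link tH tB tL s q p)) b (b(q := (b s \<noteq> o' (2 * p))))"
proof -
  let ?v = "o' (2 * p)"
  let ?M = "[Gate (GCNOT q p), Gate (GCNOT s p)]"
  have CN: "run o' ?M (ket (b(q := v))) = ket (b(q := v, p := (b s \<noteq> v)))" for v
  proof -
    have "psends o' ?M (1 * 1) (b(q := v)) (b(q := v, p := (b s \<noteq> v)))"
      by (rule psends_Cons[OF psends_CNOT'[OF _ refl] psends_CNOT'])
        (use assms in \<open>auto simp: fun_eq_iff\<close>)
    then show ?thesis by (simp add: psends_def)
  qed
  have "run o' (Gate (GH q) # ?M @ [Meas p (2 * p)]) (ket b) =
      apply_op o' (Meas p (2 * p)) (run o' ?M (\<lambda>x. rt * ket (b(q := False)) x + rt * ket (b(q := True)) x))"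
    using assms by (simp add: H_ket del: apply_gate.simps)
  also have "\<dots> = apply_op o' (Meas p (2 * p))
      (\<lambda>x. rt * ket (b(q := False, p := b s)) x + rt * ket (b(q := True, p := (\<not> b s))) x)"
    by (subst run_plus) (simp only: run_scale CN, simp)
  \<comment> \<open>The projection on \<open>p\<close> keeps exactly one of the two summands, the
    one in which \<open>q\<close> equals \<open>b s\<close> xor the outcome.\<close>
  also have "\<dots> = (\<lambda>x. rt * ket (b(q := (b s \<noteq> ?v), p := ?v)) x)"
    using assms by (cases "b s"; cases ?v) (auto simp: fun_eq_iff ket_def)
  finally have "psends o' (Gate (GH q) # ?M @ [Meas p (2 * p)]) rt b (b(q := (b s \<noteq> ?v), p := ?v))"
    by (simp add: psends_def)
  from psends_append[OF this psends_CX[of o' "2 * p" p]]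
  have "psends o' (map snd (link tH tB tL s q p)) rt b (b(q := (b s \<noteq> ?v)))"
    using assms by (simp add: link_def fun_upd_idem fun_upd_twist)
  then show ?thesis by (simp add: sends_def link_def)
qed

section \<open>Logical conjunction with one T layer\<close>

text \<open>With \<open>z\<close> in the state \<open>|+>\<close>, the four parities below are put on separate qubits; the four
  T-type gates then give the phase \<open>(-1)^(xyz) (-i)^(xy)\<close>.\<close>

definition and_gate :: "nat \<Rightarrow> nat \<times> nat \<times> nat \<times> nat \<Rightarrow> (nat \<times> op) list" where
  "and_gate \<tau> = (\<lambda>(x, y, z, h). [(\<tau>, Gate (GH z)),
     (\<tau> + 1, Gate (GCNOT y h)), (\<tau> + 1, Gate (GCNOT z x)),
     (\<tau> + 2, Gate (GCNOT x h)), (\<tau> + 2, Gate (GCNOT z y)),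
     (\<tau> + 3, Gate (GT z)), (\<tau> + 3, Gate (GTdg x)), (\<tau> + 3, Gate (GTdg y)), (\<tau> + 3, Gate (GT h))]
     @ seqt (\<tau> + 4) (xclear h [x, y, z])
     @ [(\<tau> + 16, Gate (GCNOT z x)), (\<tau> + 17, Gate (GCNOT z y)), (\<tau> + 18, Gate (GH z)), (\<tau> + 19, Gate (GS z))])"

lemma cis_quarter: "cis (pi / 4) * cis (pi / 4) = \<i>" "cis (- pi / 4) * cis (- pi / 4) = -\<i>"
  "cis (pi / 4) * cis (- pi / 4) = 1"
  by (simp_all add: cis_mult)

text \<open>In units of pi/4 the four T-type gates contribute z - (x xor z) - (y xor z) + (x xor y
  xor z) = 4xyz - 2xy. The final H on \<open>z\<close> turns the sign \<open>(-1)^(xyz)\<close> into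
  the bit \<open>x and y\<close>, and the final S cancels the factor
  \<open>(-i)^(xy)\<close>.\<close>

lemma sends_and_gate:
  assumes d: "distinct [x, y, z, h]" and "\<not> b z" "\<not> b h"
  shows "sends o' (map snd (and_gate \<tau> (x, y, z, h))) b (b(z := (b x \<and> b y)))"
proof -
  define M where "M = [Gate (GCNOT y h), Gate (GCNOT z x), Gate (GCNOT x h), Gate (GCNOT z y)]"
  define Ts where "Ts = [Gate (GT z), Gate (GTdg x), Gate (GTdg y), Gate (GT h)]"
  define E where "E = xclear h [x, y, z] @ [Gate (GCNOT z x), Gate (GCNOT z y)]"
  define ph where "ph v = (if b x \<and> b y then if v then \<i> else -\<i> else 1)" for v
  have main: "run o' (M @ Ts @ E) (ket (b(z := v))) = (\<lambda>w. rt * ph v * ket (b(z := v)) w)" for v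
  proof -
    let ?b = "b(z := v, x := (b x \<noteq> v), y := (b y \<noteq> v), h := ((b x \<noteq> b y) \<noteq> v))"
    have "psends o' M (1 * (1 * (1 * 1))) (b(z := v)) ?b"
      unfolding M_def
      by (rule psends_Cons[OF psends_CNOT'[OF _ refl] psends_Cons[OF psends_CNOT'[OF _ refl]
            psends_Cons[OF psends_CNOT'[OF _ refl] psends_CNOT']]])
        (use assms in \<open>auto simp: fun_eq_iff\<close>)
    moreover have "psends o' Ts ((if ?b z then cis (pi / 4) else 1) * ((if ?b x then cis (- pi / 4) else 1) *
        ((if ?b y then cis (- pi / 4) else 1) * (if ?b h then cis (pi / 4) else 1)))) ?b ?b"
      unfolding Ts_def
      by (rule psends_Cons[OF psends_T psends_Cons[OF psends_Tdg psends_Cons[OF psends_Tdg psends_T]]])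
    moreover have "(if ?b z then cis (pi / 4) else 1) * ((if ?b x then cis (- pi / 4) else 1) *
        ((if ?b y then cis (- pi / 4) else 1) * (if ?b h then cis (pi / 4) else 1))) = ph v"
      using d cis_quarter unfolding ph_def
      by (cases "b x"; cases "b y"; cases v) (auto simp: algebra_simps)
    moreover have "psends o' E (rt * (1 * 1)) ?b (b(z := v))"
    proof -
      \<comment> \<open>At this point \<open>x\<close> and \<open>y\<close> carry an additional
        \<open>v\<close>, so \<open>h\<close> is the parity of the current values of
        \<open>x\<close>, \<open>y\<close> and \<open>z\<close>, as \<open>xclear\<close>
        requires.\<close>
      have "psends o' (xclear h [x, y, z]) rt ?b (?b(h := False))"
        using sends_xclear[of h "[x, y, z]" ?b o'] d by (auto simp: sends_def xclear_def)
      moreover have "psends o' [Gate (GCNOT z x), Gate (GCNOT z y)] (1 * 1) (?b(h := False)) (b(z := v))"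
        by (rule psends_Cons[OF psends_CNOT'[OF _ refl] psends_CNOT'])
          (use assms in \<open>auto simp: fun_eq_iff\<close>)
      ultimately show ?thesis unfolding E_def by (rule psends_append)
    qed
    ultimately have "psends o' (M @ Ts @ E) (1 * (1 * (1 * 1)) * (ph v * (rt * (1 * 1)))) (b(z := v)) (b(z := v))"
      by (metis psends_append)
    then show ?thesis by (simp add: psends_def mult.commute)
  qed
  let ?e = "if b x \<and> b y then -\<i> else 1"
  let ?b0 = "b(z := False)" and ?b1 = "b(z := True)"
  have "map snd (and_gate \<tau> (x, y, z, h)) = Gate (GH z) # (M @ Ts @ E) @ [Gate (GH z), Gate (GS z)]"
    by (simp add: and_gate_def M_def Ts_def E_def)
  then have "run o' (map snd (and_gate \<tau> (x, y, z, h))) (ket b) =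
     run o' [Gate (GH z), Gate (GS z)] (run o' (M @ Ts @ E) (\<lambda>w. rt * ket ?b0 w + rt * ket ?b1 w))"
    using assms(2) by (simp add: H_ket del: apply_gate.simps)
  also have "run o' (M @ Ts @ E) (\<lambda>w. rt * ket ?b0 w + rt * ket ?b1 w) =
      (\<lambda>w. rt * rt * ph False * ket ?b0 w + rt * rt * ph True * ket ?b1 w)"
    by (subst run_plus) (simp only: run_scale main mult.assoc)
  also have "run o' [Gate (GH z), Gate (GS z)] \<dots> = (\<lambda>w. rt * ket (b(z := (b x \<and> b y))) w)"
  proof -
    have "run o' [Gate (GH z), Gate (GS z)] (\<lambda>w. rt * rt * ph False * ket ?b0 w + rt * rt * ph True * ket ?b1 w) =
      (\<lambda>w. rt * rt * rt * (ph False + ph True) * ket ?b0 w + rt * rt * rt * (ph False - ph True) * \<i> * ket ?b1 w)"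
      by (simp add: H_ket S_ket apply_gate_plus apply_gate_scale del: apply_gate.simps)
        (auto simp: fun_eq_iff algebra_simps ket_def)
    \<comment> \<open>If both inputs are 1, the sum of the phases vanishes and their difference
      times \<open>\<i>\<close> is \<open>-2 * \<i> * \<i> = 2\<close>; otherwise the difference
      vanishes and the sum is 2. Either way \<open>rt * rt = 1 / 2\<close> absorbs the 2.\<close>
    then show ?thesis
      unfolding rt_mult ph_def by (auto simp: fun_eq_iff)
  qed
  finally have "psends o' (map snd (and_gate \<tau> (x, y, z, h))) rt b (b(z := (b x \<and> b y)))"
    by (simp add: psends_def)
  then show ?thesis by (simp add: sends_def and_gate_def xclear_def)
qed

text \<open>Here the sign left by the X-basis measurement is \<open>(-1)^(x and y)\<close>, a
  quadratic phase, so the correction is a CZ, written as a CNOT between two Hadamards on its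
  target.\<close>

definition unand_gate :: "nat \<Rightarrow> nat \<times> nat \<times> nat \<times> nat \<Rightarrow> (nat \<times> op) list" where
  "unand_gate \<tau> = (\<lambda>(x, y, z, h). [(\<tau>, Gate (GH z)), (\<tau> + 1, Meas z (2 * z + 1))]
     @ seqt (\<tau> + 2) (map (CGate (2 * z + 1)) (Xg z))
     @ [(\<tau> + 6, CGate (2 * z + 1) (GH y)), (\<tau> + 7, CGate (2 * z + 1) (GCNOT x y)), (\<tau> + 8, CGate (2 * z + 1) (GH y))])"

lemma CZ_ket:
  assumes "x \<noteq> y"
  shows "fold apply_gate [GH y, GCNOT x y, GH y] (ket b) = (\<lambda>w. (if b x \<and> b y then -1 else 1) * ket b w)"
proof -
  have C: "apply_gate (GCNOT x y) (ket b') = ket (b'(y := (b' y \<noteq> b' x)))" for b'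
    using psends_CNOT[OF assms, of undefined b'] by (simp add: psends_def)
  have "fold apply_gate [GH y, GCNOT x y, GH y] (ket b) =
     (\<lambda>w. (rt * rt + rt * rt) * ((if b x \<and> b y then -1 else 1) * ket b w))"
    using assms
    by (cases "b x"; cases "b y")
      (simp_all del: apply_gate.simps add: C H_ket apply_gate_plus apply_gate_minus apply_gate_scale fun_eq_iff algebra_simps fun_upd_idem)
  then show ?thesis by (simp only: rt_mult) (simp add: fun_eq_iff)
qed

lemma sends_unand_gate:
  assumes d: "distinct [x, y, z]" and "b z = (b x \<and> b y)"
  shows "sends o' (map snd (unand_gate \<tau> (x, y, z, h))) b (b(z := False))"
proof -
  let ?c = "2 * z + 1" and ?b = "b(z := False)"
  have "psends o' (map (CGate ?c) [GH y, GCNOT x y, GH y]) (if o' ?c \<and> b x \<and> b y then -1 else 1) ?b ?b"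
    unfolding psends_def run_cgates using d by (subst CZ_ket) auto
  then have "psends o' (map snd (unand_gate \<tau> (x, y, z, h)))
      ((if o' ?c \<and> b z then -rt else rt) * (1 * (if o' ?c \<and> b x \<and> b y then -1 else 1))) b ?b"
    using psends_append[OF psends_H_Meas[of o' z ?c b] psends_append[OF psends_CX[of o' ?c z "b(z := o' ?c)"]]]
    by (simp add: unand_gate_def)
  moreover have "(if o' ?c \<and> b z then -rt else rt) * (1 * (if o' ?c \<and> b x \<and> b y then -1 else 1)) = rt"
    using assms by simp
  moreover have "map snd (unand_gate \<tau> (x, y, z, h)) = Gate (GH z) # Meas z ?c # map (CGate ?c) (Xg z) @
     [CGate ?c (GH y), CGate ?c (GCNOT x y), CGate ?c (GH y)]"
    by (simp add: unand_gate_def)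
  ultimately show ?thesis unfolding sends_def by simp
qed

section \<open>Side conditions of the corrections and of X-basis clearing\<close>

lemma length_Xg [simp]: "length (Xg q) = 4"
  by (simp add: Xg_def)

lemma seqt_append: "seqt t (p @ q) = seqt t p @ seqt (t + length p) q"
proof -
  have "[t..<t + length (p @ q)] = [t..<t + length p] @ [t + length p..<t + length p + length q]"
    using upt_add_eq_append[of t "t + length p" "length q"] by (simp add: add.assoc)
  then show ?thesis unfolding seqt_def by simp
qed

lemma qubits_Xg [simp]: "(\<Union>g\<in>set (Xg q). gate_qubits g) = {q}"
  by (auto simp: Xg_def)

lemma set_Xg: "g \<in> set (Xg q) \<Longrightarrow> gate_ok g \<and> is_clifford_gate g \<and> gate_qubits g = {q} \<and>
    \<not> is_T_op (Gate g) \<and> \<not> is_CNOT_op (Gate g) \<and> (\<forall>c. \<not> is_T_op (CGate c g) \<and> \<not> is_CNOT_op (CGate c g))"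
  by (auto simp: Xg_def)

lemma set_xclear:
  assumes "p \<in> set (xclear q fs)"
  shows "op_ok p \<and> op_qubits p \<subseteq> {q} \<union> set fs \<and> \<not> is_T_op p \<and> \<not> is_CNOT_op p"
  using assms unfolding xclear_def Xg_def by auto

lemma qubits_xclear: "(\<Union>p\<in>set (xclear q fs). op_qubits p) = {q} \<union> set fs"
  unfolding xclear_def Xg_def by auto

lemma filter_Xg [simp]:
  "filter is_T_op (map Gate (Xg q)) = []" "filter is_T_op (map (CGate c) (Xg q)) = []"
  "filter is_CNOT_op (map Gate (Xg q)) = []" "filter is_CNOT_op (map (CGate c) (Xg q)) = []"
  by (auto simp: filter_empty_conv dest: set_Xg)

lemma map_filter_gates [simp]:
  "List.map_filter meas_bit (map Gate gs) = []" "List.map_filter meas_bit (map (CGate c) gs) = []"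
  by (auto simp: map_filter_def)

lemma map_filter_simp [simp]:
  "List.map_filter f (xs @ ys) = List.map_filter f xs @ List.map_filter f ys"
  by (simp add: map_filter_def)

lemma map_filter_xclear: "List.map_filter meas_bit (xclear q fs) = [2 * q + 1]"
proof -
  have "List.map_filter meas_bit (concat (map (\<lambda>t. [CGate c (GS t), CGate c (GS t)]) fs)) = []" for c
    by (induction fs) (auto simp: map_filter_simps)
  then show ?thesis by (simp add: xclear_def map_filter_simps)
qed

lemma filter_xclear [simp]: "filter is_T_op (xclear q fs) = []" "filter is_CNOT_op (xclear q fs) = []"
  by (auto simp: filter_empty_conv dest: set_xclear)

lemma causal_appendI:
  assumes "causal P" "\<And>t c g. (t, CGate c g) \<in> set Q \<Longrightarrow> \<exists>t'<t. \<exists>q. (t', Meas q c) \<in> set (P @ Q)"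
  shows "causal (P @ Q)"
  using assms unfolding causal_def by (metis Un_iff set_append)

lemma causal_no_cgate: "(\<And>t c g. (t, CGate c g) \<notin> set P) \<Longrightarrow> causal P"
  by (auto simp: causal_def)

lemma causal_xclear: "causal (seqt t (xclear q fs))"
proof -
  have eq: "seqt t (xclear q fs) = [(t, Gate (GH q)), (t + 1, Meas q (2 * q + 1))] @
     seqt (t + 2) (map (CGate (2 * q + 1)) (Xg q) @
       concat (map (\<lambda>u. [CGate (2 * q + 1) (GS u), CGate (2 * q + 1) (GS u)]) fs))"
  proof -
    have "seqt t [Gate (GH q), Meas q (2 * q + 1)] = [(t, Gate (GH q)), (t + 1, Meas q (2 * q + 1))]"
      by (simp add: seqt_def upt_rec)
    then show ?thesis unfolding xclear_def by (subst seqt_append) simp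
  qed
  show ?thesis
    unfolding eq
  proof (rule causal_appendI)
    fix t' c g assume "(t', CGate c g) \<in> set (seqt (t + 2) (map (CGate (2 * q + 1)) (Xg q) @
       concat (map (\<lambda>u. [CGate (2 * q + 1) (GS u), CGate (2 * q + 1) (GS u)]) fs)))"
    then have "t + 2 \<le> t'" "c = 2 * q + 1" using set_seqt by fastforce+
    then show "\<exists>t''<t'. \<exists>q'. (t'', Meas q' c) \<in> set ([(t, Gate (GH q)), (t + 1, Meas q (2 * q + 1))] @
     seqt (t + 2) (map (CGate (2 * q + 1)) (Xg q) @
       concat (map (\<lambda>u. [CGate (2 * q + 1) (GS u), CGate (2 * q + 1) (GS u)]) fs)))"
      by (intro exI[of _ "t + 1"]) auto
  qed (auto intro: causal_no_cgate)
qed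

lemma causal_seqt_concat:
  assumes "\<And>x t. x \<in> set xs \<Longrightarrow> causal (seqt t (G x))"
  shows "causal (seqt t (concat (map G xs)))"
  using assms
proof (induction xs arbitrary: t)
  case Nil
  then show ?case by (simp add: seqt_def causal_def)
next
  case (Cons x xs)
  then show ?case by (auto simp: seqt_append intro!: causal_append)
qed

lemma causal_seqt_no_cgate: "(\<And>c g. CGate c g \<notin> set ops) \<Longrightarrow> causal (seqt t ops)"
  by (rule causal_no_cgate) (use set_seqt in blast)

section \<open>Resources of the conjunction gadgets\<close>

text \<open>Two operations for H and the measurement, four for the conditional X and six for the
  three conditional Z: the clearing fills the layers \<open>\<tau> + 4\<close> to
  \<open>\<tau> + 15\<close>, which is why the CNOTs of \<open>and_gate\<close> resume at
  \<open>\<tau> + 16\<close>.\<close>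

lemma length_xclear3: "length (xclear h [x, y, z]) = 12"
  by (simp add: xclear_def)

lemma and_gate_times: "(t, p) \<in> set (and_gate \<tau> a) \<Longrightarrow> \<tau> \<le> t \<and> t < \<tau> + 20"
  by (cases a) (auto simp: and_gate_def length_xclear3 dest!: set_seqt)

lemma qubits_and_gate: "qubits (and_gate \<tau> (x, y, z, h)) = {x, y, z, h}"
  by (auto simp: and_gate_def qubits_seqt qubits_xclear)

lemma sched_and_gate:
  assumes "distinct [x, y, z, h]"
  shows "sched (and_gate \<tau> (x, y, z, h))"
  unfolding and_gate_def prod.case
proof (intro sched_append_times)
  show "sched [(\<tau>, Gate (GH z)),
     (\<tau> + 1, Gate (GCNOT y h)), (\<tau> + 1, Gate (GCNOT z x)),
     (\<tau> + 2, Gate (GCNOT x h)), (\<tau> + 2, Gate (GCNOT z y)),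
     (\<tau> + 3, Gate (GT z)), (\<tau> + 3, Gate (GTdg x)), (\<tau> + 3, Gate (GTdg y)), (\<tau> + 3, Gate (GT h))]"
    using assms by (auto simp: sched_def)
  show "sched (seqt (\<tau> + 4) (xclear h [x, y, z]))" by (rule sched_seqt)
  show "sched [(\<tau> + 16, Gate (GCNOT z x)), (\<tau> + 17, Gate (GCNOT z y)), (\<tau> + 18, Gate (GH z)), (\<tau> + 19, Gate (GS z))]"
    by (auto simp: sched_def)
qed (auto dest!: set_seqt simp: length_xclear3)

lemma count_and_gate:
  "count_ops is_T_op (and_gate \<tau> a) = 4" "count_ops is_CNOT_op (and_gate \<tau> a) = 6"
  by (cases a; simp add: and_gate_def count_ops_seqt)+

lemma op_times_and_gate:
  "op_times is_T_op (and_gate \<tau> a) = {\<tau> + 3}"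
  "op_times is_CNOT_op (and_gate \<tau> a) = {\<tau> + 1, \<tau> + 2, \<tau> + 16, \<tau> + 17}"
proof -
  have "op_times is_T_op (seqt t (xclear h fs)) = {}" "op_times is_CNOT_op (seqt t (xclear h fs)) = {}" for t h fs
    by (auto intro!: op_times_seqt_empty dest: set_xclear)
  then show "op_times is_T_op (and_gate \<tau> a) = {\<tau> + 3}"
    "op_times is_CNOT_op (and_gate \<tau> a) = {\<tau> + 1, \<tau> + 2, \<tau> + 16, \<tau> + 17}"
    by (cases a; auto simp: and_gate_def)+
qed

lemma meas_bits_and_gate: "meas_bits (and_gate \<tau> (x, y, z, h)) = [2 * h + 1]"
  by (simp add: and_gate_def meas_bits_seqt map_filter_xclear)

lemma wf_and_gate: "distinct [x, y, z, h] \<Longrightarrow> {x, y, z, h} \<subseteq> A \<Longrightarrow> wf_ops A (and_gate \<tau> (x, y, z, h))"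
  using set_xclear[of _ h "[x, y, z]"] by (fastforce simp: and_gate_def wf_ops_seqt)

lemma causal_and_gate: "causal (and_gate \<tau> a)"
proof (cases a)
  case (fields x y z h)
  show ?thesis
    unfolding fields and_gate_def prod.case
    by (intro causal_append[OF _ causal_append[OF causal_xclear]] causal_no_cgate) auto
qed

lemma op_times_CX [simp]:
  "op_times is_T_op (seqt t (map (CGate c) (Xg z))) = {}"
  "op_times is_CNOT_op (seqt t (map (CGate c) (Xg z))) = {}"
  by (auto intro!: op_times_seqt_empty simp: Xg_def)

lemma unand_gate_times: "(t, p) \<in> set (unand_gate \<tau> a) \<Longrightarrow> \<tau> \<le> t \<and> t < \<tau> + 9"
  by (cases a) (auto simp: unand_gate_def dest!: set_seqt)

lemma qubits_unand_gate: "qubits (unand_gate \<tau> (x, y, z, h)) = {x, y, z}"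
  by (auto simp: unand_gate_def qubits_seqt)

lemma sched_unand_gate: "sched (unand_gate \<tau> a)"
proof (cases a)
  case (fields x y z h)
  show ?thesis
    unfolding fields unand_gate_def prod.case
  proof (intro sched_append_times)
    show "sched (seqt (\<tau> + 2) (map (CGate (2 * z + 1)) (Xg z)))" by (rule sched_seqt)
  qed (auto simp: sched_def dest!: set_seqt)
qed

lemma count_unand_gate:
  "count_ops is_T_op (unand_gate \<tau> a) = 0" "count_ops is_CNOT_op (unand_gate \<tau> a) = 1"
  by (cases a; simp add: unand_gate_def count_ops_seqt)+

lemma op_times_unand_gate:
  "op_times is_T_op (unand_gate \<tau> a) = {}"
  "op_times is_CNOT_op (unand_gate \<tau> a) = {\<tau> + 7}"
  by (cases a; auto simp: unand_gate_def)+

lemma meas_bits_unand_gate: "meas_bits (unand_gate \<tau> (x, y, z, h)) = [2 * z + 1]"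
  by (simp add: unand_gate_def meas_bits_seqt)

lemma wf_unand_gate: "distinct [x, y, z] \<Longrightarrow> {x, y, z} \<subseteq> A \<Longrightarrow> wf_ops A (unand_gate \<tau> (x, y, z, h))"
  by (auto simp: unand_gate_def wf_ops_seqt dest: set_Xg)

lemma causal_unand_gate: "causal (unand_gate \<tau> a)"
proof (cases a)
  case (fields x y z h)
  have "\<tau> + 1 < t \<and> c = 2 * z + 1" if "(t, CGate c g) \<in> set (unand_gate \<tau> (x, y, z, h))" for t c g
    using that by (auto simp: unand_gate_def dest!: set_seqt)
  moreover have "(\<tau> + 1, Meas z (2 * z + 1)) \<in> set (unand_gate \<tau> (x, y, z, h))"
    by (simp add: unand_gate_def)
  ultimately show ?thesis unfolding fields causal_def by blast
qed

lemma map_snd_unand_gate: "map snd (unand_gate \<tau> a) = map snd (unand_gate 0 a)"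
  and map_snd_and_gate: "map snd (and_gate \<tau> a) = map snd (and_gate 0 a)"
  by (cases a; simp add: unand_gate_def and_gate_def)+

section \<open>Fan-out of constant CNOT depth\<close>

text \<open>Each copy is the source of the next link, and all links use the same stamps. A copy is a
  control with its own partner in layer \<open>tB\<close> and with the next partner in layer
  \<open>tL\<close>, so a chain of any length occupies two CNOT layers.\<close>

fun links :: "nat \<Rightarrow> nat \<Rightarrow> nat \<Rightarrow> nat \<Rightarrow> (nat \<times> nat) list \<Rightarrow> (nat \<times> op) list" where
  "links tH tB tL s [] = []"
| "links tH tB tL s ((q, p) # l) = link tH tB tL s q p @ links tH tB tL q l"

text \<open>The links pass on uncorrected values, so the error of a copy is the parity of all
  outcomes up to its own link; \<open>acc\<close> collects their classical bits.\<close>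

fun link_fixes :: "nat list \<Rightarrow> (nat \<times> nat) list \<Rightarrow> op list" where
  "link_fixes acc [] = []"
| "link_fixes acc ((q, p) # l) =
     concat (map (\<lambda>c. map (CGate c) (Xg q)) (acc @ [2 * p])) @ link_fixes (acc @ [2 * p]) l"

definition chain :: "nat \<Rightarrow> nat \<Rightarrow> nat \<Rightarrow> nat \<times> (nat \<times> nat) list \<Rightarrow> (nat \<times> op) list" where
  "chain tH tB tL = (\<lambda>(s, l). links tH tB tL s l @ seqt (tL + 6) (link_fixes [] l))"

abbreviation chain_qubits :: "'a \<times> ('a \<times> 'a) list \<Rightarrow> 'a list" where
  "chain_qubits \<equiv> (\<lambda>(s, l). s # map fst l @ map snd l)"

text \<open>The state before the corrections; \<open>v\<close> is the value which the current source
  actually holds, errors included.\<close>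

fun linked :: "(nat \<Rightarrow> bool) \<Rightarrow> bool \<Rightarrow> (nat \<times> nat) list \<Rightarrow> basis \<Rightarrow> basis" where
  "linked o' v [] b = b"
| "linked o' v ((q, p) # l) b = linked o' (v \<noteq> o' (2 * p)) l (b(q := (v \<noteq> o' (2 * p))))"

lemma sends_links:
  assumes "distinct (s # map fst l @ map snd l)" "\<forall>x\<in>set (map fst l @ map snd l). \<not> b x"
  shows "sends o' (map snd (links tH tB tL s l)) b (linked o' (b s) l b)"
  using assms
proof (induction l arbitrary: s b)
  case Nil
  then show ?case by (simp add: sends_Nil)
next
  case (Cons a l)
  obtain q p where a: "a = (q, p)" by (cases a)
  let ?b = "b(q := (b s \<noteq> o' (2 * p)))"
  have "sends o' (map snd (links tH tB tL q l)) ?b (linked o' (?b q) l ?b)"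
    using Cons.prems by (intro Cons.IH) (auto simp: a)
  with sends_link[of s q p b o' tH tB tL] Cons.prems show ?case
    by (auto simp: a intro: sends_append)
qed

fun unlink :: "(nat \<Rightarrow> bool) \<Rightarrow> nat list \<Rightarrow> (nat \<times> nat) list \<Rightarrow> basis \<Rightarrow> basis" where
  "unlink o' acc [] b = b"
| "unlink o' acc ((q, p) # l) b =
     unlink o' (acc @ [2 * p]) l (b(q := (b q \<noteq> odd (length (filter o' (acc @ [2 * p]))))))"

lemma sends_CXs:
  "sends o' (concat (map (\<lambda>c. map (CGate c) (Xg q)) cs)) b (b(q := (b q \<noteq> odd (length (filter o' cs)))))"
proof (induction cs arbitrary: b)
  case Nil
  then show ?case using sends_Nil by simp
next
  case (Cons c cs)
  let ?b = "b(q := (b q \<noteq> o' c))"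
  have "sends o' (map (CGate c) (Xg q) @ concat (map (\<lambda>c. map (CGate c) (Xg q)) cs)) b
     (?b(q := (?b q \<noteq> odd (length (filter o' cs)))))"
    by (rule sends_append[OF sends_CX Cons.IH])
  moreover have "(?b q \<noteq> odd (length (filter o' cs))) = (b q \<noteq> odd (length (filter o' (c # cs))))"
    by auto
  then have "?b(q := (?b q \<noteq> odd (length (filter o' cs)))) = b(q := (b q \<noteq> odd (length (filter o' (c # cs)))))"
    by simp
  ultimately show ?case by (simp only: list.map concat.simps)
qed

lemma sends_link_fixes: "sends o' (link_fixes acc l) b (unlink o' acc l b)"
proof (induction l arbitrary: acc b)
  case Nil
  then show ?case by (simp add: sends_Nil)
next
  case (Cons a l)
  show ?case
    by (cases a) (simp only: link_fixes.simps unlink.simps sends_append[OF sends_CXs Cons.IH])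
qed

lemma linked_upd: "q \<notin> set (map fst l) \<Longrightarrow> (linked o' v l b)(q := w) = linked o' v l (b(q := w))"
  by (induction l arbitrary: v b) (auto simp: fun_upd_twist)

lemma linked_outside: "x \<notin> set (map fst l) \<Longrightarrow> linked o' v l b x = b x"
  by (induction l arbitrary: v b) auto

text \<open>The value carried along the chain differs from the true bit \<open>v\<close> by the
  parity of the outcomes in \<open>acc\<close>, and this parity is what the corrections add. An
  arbitrary \<open>acc\<close> is needed for the induction along the chain.\<close>

lemma unlink_linked:
  assumes "distinct (map fst l)"
  shows "unlink o' acc l (linked o' (v \<noteq> odd (length (filter o' acc))) l b) =
     (\<lambda>x. if x \<in> set (map fst l) then v else b x)"
  using assms
proof (induction l arbitrary: acc b)
  case Nil
  then show ?case by simp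
next
  case (Cons a l)
  obtain q p where a: "a = (q, p)" by (cases a)
  let ?acc = "acc @ [2 * p]"
  define w where "w = (v \<noteq> odd (length (filter o' ?acc)))"
  have q: "q \<notin> set (map fst l)" using Cons.prems a by auto
  have w: "((v \<noteq> odd (length (filter o' acc))) \<noteq> o' (2 * p)) = w" by (auto simp: w_def)
  have v: "(w \<noteq> odd (length (filter o' ?acc))) = v" by (auto simp: w_def)
  have "unlink o' acc (a # l) (linked o' (v \<noteq> odd (length (filter o' acc))) (a # l) b) =
      unlink o' ?acc l ((linked o' w l (b(q := w)))(q := (linked o' w l (b(q := w)) q \<noteq> odd (length (filter o' ?acc)))))"
    unfolding a linked.simps unlink.simps w ..
  also have "linked o' w l (b(q := w)) q = w"
    using q by (simp add: linked_outside)
  also have "(linked o' w l (b(q := w)))(q := (w \<noteq> odd (length (filter o' ?acc)))) = linked o' w l (b(q := v))"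
    unfolding v using q by (simp add: linked_upd)
  also have "unlink o' ?acc l (linked o' w l (b(q := v))) = (\<lambda>x. if x \<in> set (map fst l) then v else (b(q := v)) x)"
    unfolding w_def using Cons.prems by (intro Cons.IH) simp
  finally show ?case using a by (auto simp: fun_eq_iff)
qed

lemma sends_chain:
  assumes "distinct (s # map fst l @ map snd l)" "\<forall>x\<in>set (map fst l @ map snd l). \<not> b x"
  shows "sends o' (map snd (chain tH tB tL (s, l))) b (\<lambda>x. if x \<in> set (map fst l) then b s else b x)"
proof -
  have "sends o' (map snd (chain tH tB tL (s, l))) b (unlink o' [] l (linked o' (b s) l b))"
    unfolding chain_def by (simp add: sends_append[OF sends_links[OF assms] sends_link_fixes])
  then show ?thesis
    using unlink_linked[of l o' "[]" "b s" b] assms(1) by simp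
qed

text \<open>The final state \<open>b'\<close> is characterised pointwise, so a caller can supply its
  own closed form instead of an iterated update. The chains do not interfere because their qubits
  are disjoint.\<close>

lemma sends_chains:
  assumes "distinct (concat (map chain_qubits chs))"
    "\<And>s l x. (s, l) \<in> set chs \<Longrightarrow> x \<in> set (map fst l @ map snd l) \<Longrightarrow> \<not> b x"
    "\<And>s l q. (s, l) \<in> set chs \<Longrightarrow> q \<in> set (map fst l) \<Longrightarrow> b' q = b s"
    "\<And>q. (\<And>s l. (s, l) \<in> set chs \<Longrightarrow> q \<notin> set (map fst l)) \<Longrightarrow> b' q = b q"
  shows "sends o' (map snd (concat (map (chain tH tB tL) chs))) b b'"
  using assms
proof (induction chs arbitrary: b)
  case Nil
  have "b' q = b q" for q by (rule Nil(4)) simp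
  then have "b' = b" by auto
  then show ?case by (simp add: sends_Nil)
next
  case (Cons a chs)
  obtain s l where a: "a = (s, l)" by (cases a)
  let ?b = "\<lambda>x. if x \<in> set (map fst l) then b s else b x"
  have d: "distinct (s # map fst l @ map snd l)" "distinct (concat (map chain_qubits chs))"
    "set (s # map fst l @ map snd l) \<inter> (\<Union>c\<in>set chs. set (chain_qubits c)) = {}"
    using Cons.prems(1) unfolding a list.map concat.simps distinct_append set_concat set_map image_image prod.case
    by blast+
  have dis: "x \<notin> set (map fst l)"
    if "(s', l') \<in> set chs" "x \<in> set (s' # map fst l' @ map snd l')" for s' l' x
  proof
    assume "x \<in> set (map fst l)"
    then have "x \<in> set (s # map fst l @ map snd l)" by simp
    moreover have "x \<in> (\<Union>c\<in>set chs. set (chain_qubits c))"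
      by (rule UN_I[OF that(1)]) (use that(2) in simp)
    ultimately show False using d(3) by blast
  qed
  have 1: "sends o' (map snd (concat (map (chain tH tB tL) chs))) ?b b'"
  proof (rule Cons.IH[OF d(2)])
    fix s' l' x assume *: "(s', l') \<in> set chs" "x \<in> set (map fst l' @ map snd l')"
    have "x \<notin> set (map fst l)" by (rule dis[OF *(1)]) (use *(2) in simp)
    moreover have "\<not> b x" by (rule Cons.prems(2)[of s' l', OF _ *(2)]) (use *(1) in simp)
    ultimately show "\<not> ?b x" by simp
  next
    fix s' l' q assume *: "(s', l') \<in> set chs" "q \<in> set (map fst l')"
    have "b' q = b s'" by (rule Cons.prems(3)[of s' l', OF _ *(2)]) (use *(1) in simp)
    moreover have "s' \<notin> set (map fst l)" by (rule dis[OF *(1)]) simp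
    ultimately show "b' q = ?b s'" by simp
  next
    fix q assume *: "\<And>s l. (s, l) \<in> set chs \<Longrightarrow> q \<notin> set (map fst l)"
    show "b' q = ?b q"
    proof (cases "q \<in> set (map fst l)")
      case True
      have "b' q = b s" by (rule Cons.prems(3)[of s l, OF _ True]) (simp add: a)
      then show ?thesis using True by simp
    next
      case False
      have "b' q = b q"
      proof (rule Cons.prems(4))
        fix s' l' assume "(s', l') \<in> set (a # chs)"
        then show "q \<notin> set (map fst l')" using False *[of s' l'] unfolding a by (cases "(s', l') \<in> set chs") simp_all
      qed
      then show ?thesis using False by simp
    qed
  qed
  have "sends o' (map snd (chain tH tB tL (s, l))) b ?b"
    by (rule sends_chain[OF d(1)]) (use Cons.prems(2)[of s l] in \<open>simp add: a\<close>)
  from sends_append[OF this 1] show ?case by (simp add: a)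
qed

section \<open>Scheduling and cost of the fan-out\<close>

lemma qubits_link: "qubits (link tH tB tL s q p) = {s, q, p}"
  by (auto simp: link_def qubits_seqt)

lemma qubits_links: "qubits (links tH tB tL s l) \<subseteq> set (s # map fst l @ map snd l)"
proof (induction l arbitrary: s)
  case (Cons a l)
  show ?case using Cons[of "fst a"] by (cases a) (auto simp: qubits_link)
qed simp

lemma set_link_fixes:
  "p' \<in> set (link_fixes acc l) \<Longrightarrow>
     \<exists>c g q. p' = CGate c g \<and> g \<in> set (Xg q) \<and> q \<in> fst ` set l \<and> (c \<in> set acc \<or> c \<in> (\<lambda>a. 2 * snd a) ` set l)"
proof (induction l arbitrary: acc)
  case (Cons a l)
  obtain q p where a: "a = (q, p)" by (cases a)
  let ?acc = "acc @ [2 * p]"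
  consider c g where "c \<in> set ?acc" "g \<in> set (Xg q)" "p' = CGate c g" | "p' \<in> set (link_fixes ?acc l)"
    using Cons.prems unfolding a by auto
  then show ?case
  proof cases
    case 1
    then show ?thesis unfolding a by auto
  next
    case 2
    from Cons.IH[OF this] show ?thesis unfolding a by auto
  qed
qed simp

lemma link_fixes_op:
  assumes "p' \<in> set (link_fixes acc l)"
  shows "op_ok p' \<and> op_qubits p' \<subseteq> fst ` set l \<and> \<not> is_T_op p' \<and> \<not> is_CNOT_op p' \<and> meas_bit p' = None"
proof -
  obtain c g q where *: "p' = CGate c g" "g \<in> set (Xg q)" "q \<in> fst ` set l"
    using set_link_fixes[OF assms] by blast
  then show ?thesis using set_Xg[OF *(2)] by simp
qed

lemma qubits_chain: "qubits (chain tH tB tL a) \<subseteq> set (chain_qubits a)"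
proof (cases a)
  case (Pair s l)
  have "qubits (seqt t (link_fixes [] l)) \<subseteq> fst ` set l" for t
    unfolding qubits_seqt using link_fixes_op by blast
  then show ?thesis using qubits_links[of tH tB tL s l]
    unfolding Pair chain_def by fastforce
qed

lemma link_times:
  assumes "(t, p') \<in> set (link tH tB tL s q p)"
  shows "(t = tH \<or> t = tB) \<and> op_qubits p' \<subseteq> {q, p} \<or> t = tL \<and> op_qubits p' = {s, p} \<or>
    tL < t \<and> t < tL + 6 \<and> op_qubits p' = {p}"
  using assms unfolding link_def Xg_def by (auto dest!: set_seqt)

lemma links_times:
  "(t, p') \<in> set (links tH tB tL s l) \<Longrightarrow>
    (t = tH \<or> t = tB) \<and> op_qubits p' \<subseteq> set (map fst l @ map snd l) \<or> tL \<le> t \<and> t < tL + 6"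
proof (induction l arbitrary: s)
  case (Cons a l)
  obtain q p where a: "a = (q, p)" by (cases a)
  consider "(t, p') \<in> set (link tH tB tL s q p)" | "(t, p') \<in> set (links tH tB tL q l)"
    using Cons.prems a by auto
  then show ?case
  proof cases
    case 1
    from link_times[OF this] show ?thesis unfolding a by auto
  next
    case 2
    from Cons.IH[OF this] show ?thesis unfolding a by auto
  qed
qed simp

text \<open>Before \<open>tL\<close> only copies and partners are touched, never the source. This
  permits Bell pairs to be prepared while the source is still being computed.\<close>

lemma chain_times:
  assumes "(t, p') \<in> set (chain tH tB tL (s, l))"
  shows "(t = tH \<or> t = tB) \<and> op_qubits p' \<subseteq> set (map fst l @ map snd l) \<or> tL \<le> t"
proof -
  consider "(t, p') \<in> set (links tH tB tL s l)" | "(t, p') \<in> set (seqt (tL + 6) (link_fixes [] l))"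
    using assms unfolding chain_def by auto
  then show ?thesis
  proof cases
    case 1
    from links_times[OF this] show ?thesis by blast
  next
    case 2
    from set_seqt[OF this] show ?thesis by linarith
  qed
qed

lemma links_source_time:
  assumes "(t, p') \<in> set (links tH tB tL s l)" "s \<notin> set (map fst l @ map snd l)" "s \<in> op_qubits p'"
  shows "t = tL"
proof (cases l)
  case Nil
  then show ?thesis using assms by simp
next
  case (Cons a l')
  obtain q p where a: "a = (q, p)" by (cases a)
  have "s \<notin> qubits (links tH tB tL q l')"
    using assms(2) qubits_links[of tH tB tL q l'] unfolding Cons a by auto
  then have "(t, p') \<in> set (link tH tB tL s q p)"
    using assms(1,3) unfolding Cons a qubits_def by auto
  from link_times[OF this] show ?thesis using assms(2,3) unfolding Cons a by auto
qed

lemma sched_link: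
  assumes "distinct [s, q, p]" "tH < tB" "tB < tL"
  shows "sched (link tH tB tL s q p)"
  unfolding link_def
proof (rule sched_append_times)
  show "sched [(tH, Gate (GH q)), (tB, Gate (GCNOT q p)), (tL, Gate (GCNOT s p)), (Suc tL, Meas p (2 * p))]"
    using assms by (auto simp: sched_def)
qed (use assms in \<open>auto simp: sched_seqt dest!: set_seqt\<close>)

lemma sched_links:
  assumes "distinct (s # map fst l @ map snd l)" "tH < tB" "tB < tL"
  shows "sched (links tH tB tL s l)"
  using assms
proof (induction l arbitrary: s)
  case Nil
  then show ?case by (simp add: sched_def)
next
  case (Cons a l)
  obtain q p where a: "a = (q, p)" by (cases a)
  have "sched (link tH tB tL s q p @ links tH tB tL q l)"
    unfolding sched_append
  proof (intro conjI ballI impI)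
    show "sched (link tH tB tL s q p)" using Cons.prems a by (intro sched_link) auto
    show "sched (links tH tB tL q l)" using Cons.prems a by (intro Cons.IH) auto
  next
    fix u w assume uw: "u \<in> set (link tH tB tL s q p)" "w \<in> set (links tH tB tL q l)"
      "op_qubits (snd u) \<inter> op_qubits (snd w) \<noteq> {}"
    have q1: "op_qubits (snd u) \<subseteq> {s, q, p}"
      using uw(1) qubits_link[of tH tB tL s q p] unfolding qubits_def by blast
    have q2: "op_qubits (snd w) \<subseteq> set (q # map fst l @ map snd l)"
      using uw(2) qubits_links[of tH tB tL q l] unfolding qubits_def by blast
    \<comment> \<open>The first link and the rest of the chain can meet only in the copy
      \<open>q\<close>, which the former touches at \<open>tH\<close> and \<open>tB\<close> and the
      latter at \<open>tL\<close>.\<close>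
    have q: "q \<in> op_qubits (snd u)" "q \<in> op_qubits (snd w)"
      using q1 q2 uw(3) Cons.prems(1) a by auto
    have "fst w = tL"
      using links_source_time[of "fst w" "snd w" tH tB tL q l] uw(2) q(2) Cons.prems(1) a by auto
    moreover have "fst u = tH \<or> fst u = tB"
      using link_times[of "fst u" "snd u" tH tB tL s q p] uw(1) q(1) Cons.prems(1) a by auto
    ultimately show "fst u < fst w" using Cons.prems by auto
  qed
  then show ?case by (simp add: a)
qed

lemma sched_chain:
  assumes "distinct (chain_qubits a)" "tH < tB" "tB < tL"
  shows "sched (chain tH tB tL a)"
proof (cases a)
  case (Pair s l)
  show ?thesis
    unfolding Pair chain_def prod.case
    by (rule sched_append_times[OF sched_links sched_seqt])
      (use assms Pair in \<open>auto dest!: set_seqt links_times\<close>)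
qed

lemma filter_link_fixes [simp]:
  "filter is_T_op (link_fixes acc l) = []" "filter is_CNOT_op (link_fixes acc l) = []"
  "List.map_filter meas_bit (link_fixes acc l) = []"
  by (auto simp: filter_empty_conv map_filter_def dest: link_fixes_op)

lemma count_chain:
  "count_ops is_T_op (chain tH tB tL (s, l)) = 0" "count_ops is_CNOT_op (chain tH tB tL (s, l)) = 2 * length l"
proof -
  have "count_ops is_T_op (links tH tB tL s l) = 0" "count_ops is_CNOT_op (links tH tB tL s l) = 2 * length l"
    by (induction l arbitrary: s) (auto simp: link_def count_ops_seqt)
  then show "count_ops is_T_op (chain tH tB tL (s, l)) = 0" "count_ops is_CNOT_op (chain tH tB tL (s, l)) = 2 * length l"
    by (simp_all add: chain_def count_ops_seqt)
qed

lemma op_times_chain: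
  "op_times is_T_op (chain tH tB tL (s, l)) = {}"
  "op_times is_CNOT_op (chain tH tB tL (s, l)) = (if l = [] then {} else {tB, tL})"
proof -
  have f: "op_times is_T_op (seqt t (link_fixes [] l)) = {}" "op_times is_CNOT_op (seqt t (link_fixes [] l)) = {}" for t
    by (auto intro!: op_times_seqt_empty dest: link_fixes_op)
  have "op_times is_T_op (links tH tB tL s l) = {}" "op_times is_CNOT_op (links tH tB tL s l) = (if l = [] then {} else {tB, tL})"
    by (induction l arbitrary: s) (auto simp: link_def split: if_splits)
  then show "op_times is_T_op (chain tH tB tL (s, l)) = {}"
    "op_times is_CNOT_op (chain tH tB tL (s, l)) = (if l = [] then {} else {tB, tL})"
    by (simp_all add: chain_def f)
qed

lemma meas_bits_chain: "meas_bits (chain tH tB tL (s, l)) = map (\<lambda>(q, p). 2 * p) l"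
proof -
  have "meas_bits (links tH tB tL s l) = map (\<lambda>(q, p). 2 * p) l"
    by (induction l arbitrary: s) (auto simp: link_def meas_bits_seqt)
  then show ?thesis by (simp add: chain_def meas_bits_seqt)
qed

lemma wf_links:
  "distinct (s # map fst l @ map snd l) \<Longrightarrow> set (s # map fst l @ map snd l) \<subseteq> A \<Longrightarrow> wf_ops A (links tH tB tL s l)"
proof (induction l arbitrary: s)
  case (Cons a l)
  obtain q p where a: "a = (q, p)" by (cases a)
  have "wf_ops A (links tH tB tL q l)"
    by (rule Cons.IH) (use Cons.prems a in auto)
  moreover have "wf_ops A (link tH tB tL s q p)"
    using Cons.prems unfolding a link_def Xg_def by (auto simp: wf_ops_seqt)
  ultimately show ?case by (simp add: a)
qed simp

lemma wf_chain:
  assumes "distinct (chain_qubits a)" "set (chain_qubits a) \<subseteq> A"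
  shows "wf_ops A (chain tH tB tL a)"
proof (cases a)
  case (Pair s l)
  have "wf_ops A (links tH tB tL s l)"
    by (rule wf_links) (use assms Pair in auto)
  moreover have "wf_ops A (seqt t (link_fixes [] l))" for t
    unfolding wf_ops_seqt
  proof
    fix p assume "p \<in> set (link_fixes [] l)"
    from link_fixes_op[OF this] show "op_ok p \<and> op_qubits p \<subseteq> A" using assms(2) Pair by auto
  qed
  ultimately show ?thesis unfolding Pair chain_def by simp
qed

lemma links_Meas: "p \<in> set (map snd l) \<Longrightarrow> (Suc tL, Meas p (2 * p)) \<in> set (links tH tB tL s l)"
proof (induction l arbitrary: s)
  case (Cons a l)
  then show ?case using Cons.IH[of "fst a"] by (cases a) (auto simp: link_def)
qed simp

lemma links_cgate:
  "(t, CGate c g) \<in> set (links tH tB tL s l) \<Longrightarrow> Suc tL < t \<and> (\<exists>p\<in>set (map snd l). c = 2 * p)"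
proof (induction l arbitrary: s)
  case (Cons a l)
  obtain q p where a: "a = (q, p)" by (cases a)
  consider "(t, CGate c g) \<in> set (link tH tB tL s q p)" | "(t, CGate c g) \<in> set (links tH tB tL q l)"
    using Cons.prems a by auto
  then show ?case
  proof cases
    case 1
    then show ?thesis unfolding a link_def by (auto dest!: set_seqt)
  next
    case 2
    from Cons.IH[OF this] show ?thesis by simp
  qed
qed simp

lemma causal_chain: "causal (chain tH tB tL a)"
proof (cases a)
  case (Pair s l)
  have *: "Suc tL < t \<and> (\<exists>p\<in>set (map snd l). c = 2 * p)" if "(t, CGate c g) \<in> set (chain tH tB tL (s, l))" for t c g
  proof -
    consider "(t, CGate c g) \<in> set (links tH tB tL s l)" | "(t, CGate c g) \<in> set (seqt (tL + 6) (link_fixes [] l))"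
      using \<open>(t, CGate c g) \<in> set (chain tH tB tL (s, l))\<close> unfolding chain_def by auto
    then show ?thesis
    proof cases
      case 1
      from links_cgate[OF this] show ?thesis .
    next
      case 2
      then have "tL + 6 \<le> t" "CGate c g \<in> set (link_fixes [] l)" using set_seqt by blast+
      then show ?thesis using set_link_fixes by fastforce
    qed
  qed
  show ?thesis
    unfolding Pair causal_def
  proof (intro allI impI)
    fix t c g assume "(t, CGate c g) \<in> set (chain tH tB tL (s, l))"
    from *[OF this] obtain p where p: "Suc tL < t" "p \<in> set (map snd l)" "c = 2 * p" by blast
    have "(Suc tL, Meas p c) \<in> set (chain tH tB tL (s, l))"
      using links_Meas[OF p(2)] p(3) by (simp add: chain_def)
    with p(1) show "\<exists>t'<t. \<exists>q. (t', Meas q c) \<in> set (chain tH tB tL (s, l))" by blast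
  qed
qed

section \<open>Sequences of gadgets\<close>

text \<open>No target is a control, so all controls keep their values and the order of the CNOTs is
  immaterial.\<close>

lemma sends_CNOTs:
  assumes "fst ` set cs \<inter> snd ` set cs = {}"
  shows "sends o' (map (\<lambda>(c, t). Gate (GCNOT c t)) cs) b
           (\<lambda>q. b q \<noteq> odd (length (filter (\<lambda>(c, t). t = q \<and> b c) cs)))"
  using assms
proof (induction cs arbitrary: b)
  case Nil
  then show ?case using sends_Nil by simp
next
  case (Cons a cs)
  obtain c t where a: "a = (c, t)" by (cases a)
  let ?b = "b(t := (b t \<noteq> b c))"
  have "sends o' (map (\<lambda>(c, t). Gate (GCNOT c t)) cs) ?b
           (\<lambda>q. ?b q \<noteq> odd (length (filter (\<lambda>(c, t). t = q \<and> ?b c) cs)))"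
    by (rule Cons.IH) (use Cons.prems in auto)
  moreover have "(?b q \<noteq> odd (length (filter (\<lambda>(c, t). t = q \<and> ?b c) cs))) =
     (b q \<noteq> odd (length (filter (\<lambda>(c, t). t = q \<and> b c) (a # cs))))" for q
  proof -
    have "filter (\<lambda>(c, t). t = q \<and> ?b c) cs = filter (\<lambda>(c, t). t = q \<and> b c) cs"
      using Cons.prems a by (intro filter_cong) force+
    then show ?thesis by (auto simp only: a prod.case filter.simps fun_upd_apply length_Cons even_Suc split: if_splits)
  qed
  ultimately have "sends o' (map (\<lambda>(c, t). Gate (GCNOT c t)) cs) ?b
     (\<lambda>q. b q \<noteq> odd (length (filter (\<lambda>(c, t). t = q \<and> b c) (a # cs))))"
    by (simp only:)
  then show ?case
    using sends_Cons[OF sends_CNOT[of c t o' b]] Cons.prems a by auto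
qed

lemma sends_xclears:
  assumes "distinct (map fst l)" "\<forall>(q, fs)\<in>set l. set fs \<inter> fst ` set l = {}"
    "\<forall>(q, fs)\<in>set l. b q = odd (length (filter b fs))"
    "\<And>x. b' x = (if x \<in> fst ` set l then False else b x)"
  shows "sends o' (concat (map (\<lambda>(q, fs). xclear q fs) l)) b b'"
  using assms
proof (induction l arbitrary: b)
  case Nil
  then have "b' = b" by auto
  then show ?case by (simp add: sends_Nil)
next
  case (Cons a l)
  obtain q fs where a: "a = (q, fs)" by (cases a)
  let ?b = "b(q := False)"
  have "sends o' (concat (map (\<lambda>(q, fs). xclear q fs) l)) ?b b'"
  proof (rule Cons.IH)
    show "\<forall>(q', fs)\<in>set l. ?b q' = odd (length (filter ?b fs))"
    proof (clarify)
      fix q' fs' assume *: "(q', fs') \<in> set l"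
      then have "q' \<in> set (map fst l)" by force
      then have "q' \<noteq> q" using Cons.prems(1) a by auto
      then have "?b q' = b q'" by simp
      also have "b q' = odd (length (filter b fs'))" using Cons.prems(3) * by auto
      also have "filter b fs' = filter ?b fs'"
        by (rule filter_fun_upd_notin[symmetric]) (use Cons.prems(2) * a in auto)
      finally show "?b q' = odd (length (filter ?b fs'))" .
    qed
    show "\<forall>(q, fs)\<in>set l. set fs \<inter> fst ` set l = {}"
      using Cons.prems(2) by fastforce
  qed (use Cons.prems a in auto)
  moreover have "sends o' (xclear q fs) b ?b"
    by (rule sends_xclear) (use Cons.prems a in auto)
  ultimately show ?case by (simp add: a sends_append)
qed

definition and_val :: "nat \<times> nat \<times> nat \<times> nat \<Rightarrow> basis \<Rightarrow> basis" where
  "and_val = (\<lambda>(x, y, z, h) b. b(z := (b x \<and> b y)))"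

abbreviation res :: "'a \<times> 'a \<times> 'a \<times> 'a \<Rightarrow> 'a" where
  "res \<equiv> (\<lambda>(x, y, z, h). z)"

text \<open>Every result is written to a qubit that no earlier tuple reads or writes. Hence the
  equation of a tuple, once established, stays true to the end, and the tuples can be undone in
  reverse order.\<close>

definition fed_forward :: "('a \<times> 'a \<times> 'a \<times> 'a) list \<Rightarrow> bool" where
  "fed_forward ts \<longleftrightarrow> (\<forall>(x, y, z, h)\<in>set ts. distinct [x, y, z, h]) \<and>
     sorted_wrt (\<lambda>(x, y, z, h) (x', y', z', h'). z' \<notin> {x, y, z}) ts"

lemma sends_ands:
  assumes "fed_forward ts" "\<forall>(x, y, z, h)\<in>set ts. \<not> b z \<and> \<not> b h \<and> h \<notin> res ` set ts"
  shows "sends o' (concat (map (\<lambda>a. map snd (and_gate 0 a)) ts)) b (fold and_val ts b)"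
  using assms
proof (induction ts arbitrary: b)
  case Nil
  then show ?case by (simp add: sends_Nil)
next
  case (Cons a ts)
  obtain x y z h where a: "a = (x, y, z, h)" by (cases a)
  have "sends o' (concat (map (\<lambda>a. map snd (and_gate 0 a)) ts)) (and_val a b) (fold and_val ts (and_val a b))"
  proof (rule Cons.IH)
    show "fed_forward ts" using Cons.prems(1) by (auto simp: fed_forward_def)
    show "\<forall>(x, y, z, h)\<in>set ts. \<not> and_val a b z \<and> \<not> and_val a b h \<and> h \<notin> res ` set ts"
    proof (clarify)
      fix x' y' z' h' assume *: "(x', y', z', h') \<in> set ts"
      then have "\<not> b z' \<and> \<not> b h' \<and> h' \<notin> res ` set (a # ts)"
        using bspec[OF Cons.prems(2), of "(x', y', z', h')"] by simp
      moreover from this have "h' \<noteq> z" "h' \<notin> res ` set ts" by (simp_all add: a)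
      moreover have "z' \<noteq> z" using Cons.prems(1) * by (auto simp: fed_forward_def a)
      ultimately show "\<not> and_val a b z' \<and> \<not> and_val a b h' \<and> h' \<notin> res ` set ts"
        by (auto simp: a and_val_def)
    qed
  qed
  moreover have "sends o' (map snd (and_gate 0 a)) b (and_val a b)"
    unfolding a and_val_def prod.case
    by (rule sends_and_gate) (use Cons.prems a in \<open>auto simp: fed_forward_def\<close>)
  ultimately show ?case by (simp add: sends_append)
qed

lemma and_vals_outside: "q \<notin> res ` set ts \<Longrightarrow> fold and_val ts b q = b q"
  by (induction ts arbitrary: b) (auto simp: and_val_def)

lemma and_vals:
  assumes "fed_forward ts" "(x, y, z, h) \<in> set ts"
  shows "fold and_val ts b z = (fold and_val ts b x \<and> fold and_val ts b y)"
  using assms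
proof (induction ts arbitrary: b)
  case (Cons a ts)
  show ?case
  proof (cases "(x, y, z, h) = a")
    case True
    then have "x \<notin> res ` set ts" "y \<notin> res ` set ts" "z \<notin> res ` set ts" "x \<noteq> z" "y \<noteq> z"
      using Cons.prems(1) by (auto simp: fed_forward_def)
    with True show ?thesis by (simp add: and_vals_outside flip: True) (simp add: and_val_def)
  next
    case False
    then show ?thesis using Cons by (auto simp: fed_forward_def)
  qed
qed simp

text \<open>The last result is not an input of any remaining tuple, so clearing it leaves their
  equations intact; this is why the list is reversed.\<close>

lemma sends_unands:
  assumes "fed_forward ts" "\<And>x y z h. (x, y, z, h) \<in> set ts \<Longrightarrow> b z = (b x \<and> b y)"
    "\<And>x. b' x = (if x \<in> res ` set ts then False else b x)"
  shows "sends o' (concat (map (\<lambda>a. map snd (unand_gate 0 a)) (rev ts))) b b'"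
  using assms
proof (induction ts arbitrary: b rule: rev_induct)
  case Nil
  then have "b' = b" by auto
  then show ?case by (simp add: sends_Nil)
next
  case (snoc a ts)
  obtain x y z h where a: "a = (x, y, z, h)" by (cases a)
  have ff: "z \<notin> {x', y', z'}" if "(x', y', z', h') \<in> set ts" for x' y' z' h'
    using snoc.prems(1) that unfolding a fed_forward_def sorted_wrt_append by auto
  have "sends o' (concat (map (\<lambda>a. map snd (unand_gate 0 a)) (rev ts))) (b(z := False)) b'"
  proof (rule snoc.IH)
    show "fed_forward ts" using snoc.prems(1) by (auto simp: fed_forward_def sorted_wrt_append)
    show "(b(z := False)) z' = ((b(z := False)) x' \<and> (b(z := False)) y')" if "(x', y', z', h') \<in> set ts" for x' y' z' h'
      using ff[OF that] snoc.prems(2)[of x' y' z' h'] that by auto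
  qed (use snoc.prems(3) a in auto)
  moreover have "sends o' (map snd (unand_gate 0 a)) b (b(z := False))"
    unfolding a by (rule sends_unand_gate) (use snoc.prems(1,2) a in \<open>auto simp: fed_forward_def\<close>)
  ultimately show ?case by (simp add: sends_append)
qed

section \<open>Trees of conjunctions\<close>

lemma sorted_wrt_concat_map:
  assumes "\<And>x. x \<in> set xs \<Longrightarrow> sorted_wrt R (G x)"
    "sorted_wrt (\<lambda>x y. \<forall>a\<in>set (G x). \<forall>b\<in>set (G y). R a b) xs"
  shows "sorted_wrt R (concat (map G xs))"
  using assms by (induction xs) (auto simp: sorted_wrt_append)

lemma concat_map_concat: "concat (map F (concat (map G xs))) = concat (map (\<lambda>x. concat (map F (G x))) xs)"
  by (induction xs) auto

lemma distinct_concat_map: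
  "distinct (concat (map G xs)) \<longleftrightarrow>
     (\<forall>x\<in>set xs. distinct (G x)) \<and> sorted_wrt (\<lambda>x y. set (G x) \<inter> set (G y) = {}) xs"
  by (induction xs) auto

lemma sched_concat:
  assumes "\<And>x. x \<in> set xs \<Longrightarrow> sched (G x)"
    "sorted_wrt (\<lambda>x y. qubits (G x) \<inter> qubits (G y) = {}) xs"
  shows "sched (concat (map G xs))"
  using assms
proof (induction xs)
  case (Cons x xs)
  have "qubits (G x) \<inter> qubits (concat (map G xs)) = {}"
    using Cons.prems(2) by (auto simp: qubits_concat)
  then show ?case
    using Cons by (simp add: sched_append_disjoint)
qed (simp add: sched_def)

lemma sorted_wrt_distinct:
  assumes "distinct xs" "\<And>x y. x \<in> set xs \<Longrightarrow> y \<in> set xs \<Longrightarrow> x \<noteq> y \<Longrightarrow> R x y"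
  shows "sorted_wrt R xs"
  using assms by (induction xs) auto

text \<open>Qubit names. \<open>Copy l i\<close> is a copy of input \<open>i\<close> reserved for the monomial with variable list
  \<open>l\<close>; \<open>Node l i\<close> holds a partial product and \<open>Help l i\<close> is scratch space; \<open>Duo p\<close> collects
  what the outputs \<open>2 p\<close> and \<open>2 p + 1\<close> have in common; \<open>Fan r k\<close> is the copy of monomial \<open>k\<close>
  for the \<open>r\<close>-th block of outputs.\<close>

datatype lab = In nat | Out nat | Copy "nat list" nat | Help "nat list" nat | Node "nat list" nat
  | Duo nat | Fan nat nat

section \<open>Pairing up the factors of one monomial\<close>

instance lab :: countable
  by countable_datatype

text \<open>An entry is an index together with the qubit of a partial product. A product keeps the
  left index \<open>a\<close> but is named after the right index \<open>b\<close>, which thereby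
  leaves the list for good. So every name \<open>Node l b\<close> is created at most once.\<close>

fun nxt :: "nat list \<Rightarrow> (nat \<times> lab) list \<Rightarrow> (nat \<times> lab) list" where
  "nxt l ((a, q) # (b, r) # xs) = (a, Node l b) # nxt l xs"
| "nxt l xs = xs"

fun tup :: "nat list \<Rightarrow> (nat \<times> lab) list \<Rightarrow> (lab \<times> lab \<times> lab \<times> lab) list" where
  "tup l ((a, q) # (b, r) # xs) = (q, r, Node l b, Help l b) # tup l xs"
| "tup l xs = []"

lemma length_nxt: "length (nxt l xs) = (length xs + 1) div 2"
  by (induction l xs rule: nxt.induct) auto

lemma length_tup_nxt: "length (tup l xs) + length (nxt l xs) = length xs"
  by (induction l xs rule: nxt.induct) auto

lemma fst_nxt: "fst ` set (nxt l xs) \<subseteq> fst ` set xs"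
  by (induction l xs rule: nxt.induct) auto

lemma distinct_fst_nxt: "distinct (map fst xs) \<Longrightarrow> distinct (map fst (nxt l xs))"
proof (induction l xs rule: nxt.induct)
  case (1 l a q b r xs)
  then show ?case using fst_nxt[of l xs] by auto
qed auto

lemma snd_nxt:
  "distinct (map fst xs) \<Longrightarrow> q \<in> snd ` set (nxt l xs) \<Longrightarrow>
     q \<in> snd ` set xs \<or> (\<exists>b\<in>fst ` set xs. q = Node l b \<and> b \<notin> fst ` set (nxt l xs))"
proof (induction l xs rule: nxt.induct)
  case (1 l a q' b r xs)
  have "b \<notin> fst ` set (nxt l xs)" using 1(2) fst_nxt[of l xs] by auto
  have ab: "a \<notin> fst ` set xs" "a \<noteq> b" "distinct (map fst xs)" using 1(2) by auto
  consider "q = Node l b" | "q \<in> snd ` set (nxt l xs)" using 1(3) by auto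
  then show ?case
  proof cases
    case 1
    then show ?thesis using \<open>b \<notin> fst ` set (nxt l xs)\<close> ab(2) by auto
  next
    case 2
    from 1(1)[OF ab(3) 2] show ?thesis using ab(1) by auto
  qed
qed auto

text \<open>An absorbed index sits on the right of its pair and is thus never the first of the list,
  hence \<open>tl xs\<close>. In the end this limits the nodes of a tree to the indices in
  \<open>tl l\<close>.\<close>

lemma tup_props:
  "distinct (map fst xs) \<Longrightarrow> (x, y, z, h) \<in> set (tup l xs) \<Longrightarrow>
     x \<in> snd ` set xs \<and> y \<in> snd ` set xs \<and>
     (\<exists>b\<in>fst ` set (tl xs). z = Node l b \<and> h = Help l b \<and> b \<notin> fst ` set (nxt l xs))"
proof (induction l xs rule: tup.induct)
  case (1 l a q' b r xs)
  have *: "b \<notin> fst ` set (nxt l xs)" "a \<notin> fst ` set xs" "b \<notin> fst ` set xs" "a \<noteq> b"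
    using 1(2) fst_nxt[of l xs] by auto
  show ?case
  proof (cases "(x, y, z, h) \<in> set (tup l xs)")
    case True
    with 1 obtain c where c: "c \<in> fst ` set (tl xs)" "z = Node l c" "h = Help l c" "c \<notin> fst ` set (nxt l xs)"
      and xy: "x \<in> snd ` set xs" "y \<in> snd ` set xs" by auto
    have "c \<in> fst ` set xs" using c(1) by (cases xs) auto
    with * c xy show ?thesis by auto
  next
    case False
    with 1(3) * show ?thesis by auto
  qed
qed auto

text \<open>Freshness: the node named after an index still in the list has not been created yet, and
  scratch qubits never carry a factor. So the next level cannot collide with the qubits in
  use.\<close>

definition tree_inv :: "nat list \<Rightarrow> (nat \<times> lab) list \<Rightarrow> bool" where
  "tree_inv l xs \<longleftrightarrow> distinct (map fst xs) \<and> distinct (map snd xs) \<and>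
     (\<forall>b\<in>fst ` set xs. Node l b \<notin> snd ` set xs) \<and> (\<forall>b. Help l b \<notin> snd ` set xs)"

lemma tree_inv_nxt_distinct:
  "distinct (map fst xs) \<Longrightarrow> distinct (map snd xs) \<Longrightarrow> (\<forall>b\<in>fst ` set xs. Node l b \<notin> snd ` set xs) \<Longrightarrow>
     distinct (map snd (nxt l xs))"
proof (induction l xs rule: nxt.induct)
  case (1 l a q b r xs)
  have "Node l b \<notin> snd ` set (nxt l xs)"
  proof
    assume "Node l b \<in> snd ` set (nxt l xs)"
    moreover have "Node l b \<notin> snd ` set xs" "b \<notin> fst ` set xs" using 1 by auto
    ultimately show False using snd_nxt[of xs "Node l b" l] 1 by auto
  qed
  with 1 show ?case by auto
qed auto

lemma tree_inv_nxt:
  assumes "tree_inv l xs"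
  shows "tree_inv l (nxt l xs)"
proof -
  have d: "distinct (map fst xs)" "distinct (map snd xs)" "\<forall>b\<in>fst ` set xs. Node l b \<notin> snd ` set xs"
    "\<forall>b. Help l b \<notin> snd ` set xs"
    using assms by (auto simp: tree_inv_def)
  have "Node l b \<notin> snd ` set (nxt l xs)" if "b \<in> fst ` set (nxt l xs)" for b
  proof
    assume "Node l b \<in> snd ` set (nxt l xs)"
    moreover have "Node l b \<notin> snd ` set xs" using d(3) that fst_nxt[of l xs] by blast
    ultimately show False using snd_nxt[OF d(1), of "Node l b" l] that by blast
  qed
  moreover have "Help l b \<notin> snd ` set (nxt l xs)" for b
    using snd_nxt[OF d(1), of "Help l b" l] d(4) by auto
  ultimately show ?thesis
    using distinct_fst_nxt[OF d(1)] tree_inv_nxt_distinct[OF d(1-3)] by (simp add: tree_inv_def)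
qed

lemma tree_inv_step:
  assumes "tree_inv l ((a, q) # (b, r) # xs)" "(x, y, z, h) \<in> set (tup l xs)"
  shows "{q, r, Node l b, Help l b} \<inter> {x, y, z, h} = {}"
proof -
  have 1: "distinct (map fst xs)" "b \<notin> fst ` set xs"
    "q \<notin> snd ` set xs" "r \<notin> snd ` set xs" "Node l b \<notin> snd ` set xs" "\<And>c. Help l c \<notin> snd ` set xs"
    "\<And>c. Help l c \<noteq> q \<and> Help l c \<noteq> r" "\<And>c. c \<in> fst ` set xs \<Longrightarrow> Node l c \<noteq> q \<and> Node l c \<noteq> r"
    using assms(1) by (auto simp: tree_inv_def)
  obtain c where c: "x \<in> snd ` set xs" "y \<in> snd ` set xs" "c \<in> fst ` set (tl xs)" "z = Node l c" "h = Help l c"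
    using tup_props[OF 1(1) assms(2)] by blast
  have c': "c \<in> fst ` set xs" using c(3) by (cases xs) auto
  then have "b \<noteq> c" using 1(2) by blast
  moreover have "x \<noteq> q" "x \<noteq> r" "x \<noteq> Node l b" "x \<noteq> Help l b" "y \<noteq> q" "y \<noteq> r" "y \<noteq> Node l b" "y \<noteq> Help l b"
    using c(1,2) 1(3-6) by blast+
  ultimately show ?thesis unfolding c(4,5) using 1(7,8) c' by auto
qed

lemma distinct_tup:
  "tree_inv l xs \<Longrightarrow> distinct (concat (map (\<lambda>(x, y, z, h). [x, y, z, h]) (tup l xs)))"
proof (induction l xs rule: tup.induct)
  case (1 l a q b r xs)
  have inv: "tree_inv l xs" using 1(2) by (auto simp: tree_inv_def)
  have "set [q, r, Node l b, Help l b] \<inter> set (concat (map (\<lambda>(x, y, z, h). [x, y, z, h]) (tup l xs))) = {}"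
  proof -
    have "set [q, r, Node l b, Help l b] \<inter> set ((\<lambda>(x, y, z, h). [x, y, z, h]) t) = {}" if "t \<in> set (tup l xs)" for t
    proof (cases t)
      case (fields x y z h)
      show ?thesis using tree_inv_step[OF 1(2) that[unfolded fields]] unfolding fields by simp
    qed
    then show ?thesis unfolding set_concat set_map by blast
  qed
  moreover have "distinct [q, r, Node l b, Help l b]" using 1(2) by (auto simp: tree_inv_def)
  ultimately show ?case using 1(1)[OF inv]
    unfolding tup.simps list.map concat.simps prod.case distinct_append by blast
qed auto

lemma fed_forward_tup: "tree_inv l xs \<Longrightarrow> fed_forward (tup l xs)"
proof (induction l xs rule: tup.induct)
  case (1 l a q b r xs)
  have inv: "tree_inv l xs" using 1(2) by (auto simp: tree_inv_def)
  have "z' \<notin> {q, r, Node l b}" if "(x', y', z', h') \<in> set (tup l xs)" for x' y' z' h'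
    using tree_inv_step[OF 1(2) that] by blast
  moreover have "distinct [q, r, Node l b, Help l b]" using 1(2) by (auto simp: tree_inv_def)
  ultimately show ?case using 1(1)[OF inv] by (auto simp: fed_forward_def)
qed (auto simp: fed_forward_def)

lemma all_nxt:
  "(\<And>x y z h. (x, y, z, h) \<in> set (tup l xs) \<Longrightarrow> v z = (v x \<and> v y)) \<Longrightarrow>
     (\<forall>q\<in>snd ` set (nxt l xs). v q) = (\<forall>q\<in>snd ` set xs. v q)"
proof (induction l xs rule: tup.induct)
  case (1 l a q b r xs)
  have "v (Node l b) = (v q \<and> v r)" by (rule 1(2)[of q r _ "Help l b"]) simp
  moreover have "(\<forall>q\<in>snd ` set (nxt l xs). v q) = (\<forall>q\<in>snd ` set xs. v q)"
    by (rule 1(1), rule 1(2)) auto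
  ultimately show ?case by auto
qed auto

section \<open>The trees of all monomials, level by level\<close>

definition monomials :: "nat \<Rightarrow> nat list list" where
  "monomials n = filter (\<lambda>l. l \<noteq> []) (subseqs [0..<n])"

text \<open>Trees run in parallel, so only one proper product may work on the inputs themselves; the
  full monomial is chosen. A single variable needs no conjunction at all. All other monomials use
  private copies.\<close>

definition leaf :: "nat \<Rightarrow> nat list \<Rightarrow> nat \<Rightarrow> lab" where
  "leaf n l i = (if l = [0..<n] \<or> length l = 1 then In i else Copy l i)"

lemma leaf_simps [simp]:
  "leaf n l i = leaf n l j \<longleftrightarrow> i = j" "leaf n l i \<noteq> Node l' b" "leaf n l i \<noteq> Help l' b"
  "Node l' b \<noteq> leaf n l i" "Help l' b \<noteq> leaf n l i"
  unfolding leaf_def by (cases "l = [0..<n] \<or> length l = 1"; simp)+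

definition init :: "nat \<Rightarrow> nat list \<Rightarrow> (nat \<times> lab) list" where
  "init n l = map (\<lambda>i. (i, leaf n l i)) l"

definition stage :: "nat \<Rightarrow> nat list \<Rightarrow> nat \<Rightarrow> (nat \<times> lab) list" where
  "stage n l j = (nxt l ^^ j) (init n l)"

lemma stage_0: "stage n l 0 = init n l"
  and stage_Suc: "stage n l (Suc j) = nxt l (stage n l j)"
  by (simp_all add: stage_def)

lemma set_monomials: "l \<in> set (monomials n) \<Longrightarrow> set l \<subseteq> {..<n} \<and> distinct l \<and> l \<noteq> []"
proof -
  assume "l \<in> set (monomials n)"
  then have "l \<in> set (subseqs [0..<n])" "l \<noteq> []" by (auto simp: monomials_def)
  moreover from this have "set l \<in> set ` set (subseqs [0..<n])" by blast
  ultimately show ?thesis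
    using subseqs_distinctD[of l "[0..<n]"] unfolding subseqs_powset by auto
qed

lemma tree_inv_stage: "distinct l \<Longrightarrow> tree_inv l (stage n l j)"
proof (induction j)
  case 0
  then show ?case
    by (auto simp: stage_0 init_def tree_inv_def distinct_map inj_on_def)
next
  case (Suc j)
  then show ?case by (simp add: stage_Suc tree_inv_nxt)
qed

lemma fst_stage_mono: "j \<le> j' \<Longrightarrow> fst ` set (stage n l j') \<subseteq> fst ` set (stage n l j)"
proof (induction j' rule: dec_induct)
  case (step j')
  then show ?case using fst_nxt[of l "stage n l j'"] by (auto simp: stage_Suc)
qed simp

definition own :: "nat \<Rightarrow> nat list \<Rightarrow> lab set" where
  "own n l = range (Copy l) \<union> range (Node l) \<union> (if l = [0..<n] \<or> length l = 1 then In ` set l else {})"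

lemma own_subset: "own n l \<subseteq> range (Copy l) \<union> range (Node l) \<union> range In"
  by (auto simp: own_def)

lemma Node_own: "Node l b \<in> own n l"
  by (auto simp: own_def)

lemma snd_stage: "distinct l \<Longrightarrow> snd ` set (stage n l j) \<subseteq> own n l"
proof (induction j)
  case 0
  have "leaf n l i \<in> own n l" if "i \<in> set l" for i
    using that by (cases "l = [0..<n] \<or> length l = 1") (simp_all add: leaf_def own_def)
  then show ?case by (auto simp: stage_0 init_def)
next
  case (Suc j)
  show ?case
  proof
    fix q assume "q \<in> snd ` set (stage n l (Suc j))"
    then show "q \<in> own n l"
      using snd_nxt[of "stage n l j" q l] Suc tree_inv_stage[OF Suc.prems, of n j]
      by (auto simp: stage_Suc tree_inv_def own_def)
  qed
qed

text \<open>A level halves the length, rounding up; in the induction the arbitrary \<open>c\<close>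
  absorbs one factor 2 per level.\<close>

lemma length_stage_le: "length l \<le> c * 2 ^ j \<Longrightarrow> length (stage n l j) \<le> c"
proof (induction j arbitrary: c)
  case (Suc j)
  then have "length (stage n l j) \<le> 2 * c" by (simp add: mult.assoc)
  then show ?case by (simp add: stage_Suc length_nxt)
qed (simp add: stage_0 init_def)

lemma length_stage_gt: "length l > c * 2 ^ j \<Longrightarrow> length (stage n l j) > c"
proof (induction j arbitrary: c)
  case (Suc j)
  then have "length (stage n l j) > 2 * c" by (simp add: mult.assoc)
  then show ?case by (simp add: stage_Suc length_nxt)
qed (simp add: stage_0 init_def)

lemma hd_fst_nxt: "xs \<noteq> [] \<Longrightarrow> nxt l xs \<noteq> [] \<and> fst (hd (nxt l xs)) = fst (hd xs)"
  by (cases "(l, xs)" rule: nxt.cases) auto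

lemma hd_stage: "l \<noteq> [] \<Longrightarrow> stage n l j \<noteq> [] \<and> fst (hd (stage n l j)) = hd l"
  by (induction j) (auto simp: stage_0 init_def stage_Suc hd_fst_nxt hd_map)

text \<open>Each conjunction merges two entries into one. Once a single entry remains,
  \<open>length l - 1\<close> conjunctions have been spent.\<close>

lemma sum_length_tup:
  "(\<Sum>j<d. length (tup l (stage n l j))) + length (stage n l d) = length l"
proof (induction d)
  case (Suc d)
  then show ?case using length_tup_nxt[of l "stage n l d"] by (simp add: stage_Suc)
qed (simp add: stage_0 init_def)

definition root :: "nat \<Rightarrow> nat \<Rightarrow> nat list \<Rightarrow> lab" where
  "root n L l = snd (hd (stage n l L))"

lemma stage_last:
  assumes "l \<noteq> []" "length l \<le> 2 ^ L"
  shows "stage n l L = [(hd l, root n L l)]"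
proof -
  have "length (stage n l L) \<le> 1" by (rule length_stage_le) (use assms in simp)
  then show ?thesis using hd_stage[OF assms(1), of n L]
    by (cases "stage n l L") (auto simp: root_def prod_eq_iff)
qed

text \<open>Every level preserves the conjunction of its entries, and the last level has a single
  entry.\<close>

lemma root_value:
  assumes "l \<noteq> []" "length l \<le> 2 ^ L"
    "\<And>j x y z h. j < L \<Longrightarrow> (x, y, z, h) \<in> set (tup l (stage n l j)) \<Longrightarrow> v z = (v x \<and> v y)"
  shows "v (root n L l) = (\<forall>q\<in>snd ` set (init n l). v q)"
proof -
  have "(\<forall>q\<in>snd ` set (stage n l j). v q) = (\<forall>q\<in>snd ` set (init n l). v q)" if "j \<le> L" for j
    using that
  proof (induction j)
    case (Suc j)
    then show ?case using all_nxt[of l "stage n l j" v] assms(3)[of j] by (simp add: stage_Suc)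
  qed (simp add: stage_0)
  from this[of L] show ?thesis using stage_last[OF assms(1,2), of n] by simp
qed

text \<open>Identifies the qubit of a finished monomial. Since the name of a node contains its
  monomial, different monomials end on different qubits.\<close>

lemma root_cases:
  assumes "l \<noteq> []" "length l = 1 \<or> L > 0"
  shows "(length l = 1 \<and> root n L l = In (hd l)) \<or> (1 < length l \<and> (\<exists>b\<in>set (tl l). root n L l = Node l b))"
proof (cases "length l = 1")
  case True
  then obtain i where l: "l = [i]" by (auto simp: length_Suc_conv)
  have "stage n l j = [(i, In i)]" for j
    by (induction j) (auto simp: stage_0 stage_Suc init_def l leaf_def)
  then show ?thesis using True by (simp add: root_def l)
next
  case False
  then have len: "1 < length l" using assms(1) by (cases l) auto
  have sub: "fst ` set (tl (stage n l j)) \<subseteq> set (tl l)" for j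
  proof (induction j)
    case 0
    then show ?case by (cases l) (auto simp: stage_0 init_def)
  next
    case (Suc j)
    have "fst ` set (tl (nxt l xs)) \<subseteq> fst ` set (tl xs)" for xs
      using fst_nxt[of l "drop 2 xs"] by (cases "(l, xs)" rule: nxt.cases) auto
    with Suc show ?case by (force simp: stage_Suc)
  qed
  have "\<exists>b\<in>set (tl l). snd (hd (stage n l (Suc j))) = Node l b" for j
  proof (induction j)
    case 0
    obtain a b xs where l: "l = a # b # xs" using len by (cases l; cases "tl l") auto
    then show ?case by (simp add: stage_0 stage_Suc init_def)
  next
    case (Suc j)
    show ?case
      unfolding stage_Suc[of n l "Suc j"]
      using Suc sub[of "Suc j"] by (cases "(l, stage n l (Suc j))" rule: nxt.cases) (auto simp del: nxt.simps(1) simp: nxt.simps(1))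
  qed
  then show ?thesis using len assms(2) by (cases L) (auto simp: root_def)
qed

definition level :: "nat \<Rightarrow> nat \<Rightarrow> (lab \<times> lab \<times> lab \<times> lab) list" where
  "level n j = concat (map (\<lambda>l. tup l (stage n l j)) (monomials n))"

lemma distinct_monomials: "distinct (monomials n)"
  unfolding monomials_def using distinct_set_subseqs[of "[0..<n]"] by (simp add: distinct_map)

lemma tup_stage:
  assumes "l \<in> set (monomials n)" "(x, y, z, h) \<in> set (tup l (stage n l j))"
  shows "x \<in> snd ` set (stage n l j)" "y \<in> snd ` set (stage n l j)"
    "\<exists>b\<in>set (tl l). z = Node l b \<and> h = Help l b \<and> b \<in> fst ` set (stage n l j) \<and> b \<notin> fst ` set (stage n l (Suc j))"
    "1 < length l"
proof -
  have dl: "distinct l" "l \<noteq> []" using set_monomials[OF assms(1)] by auto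
  have inv: "distinct (map fst (stage n l j))" using tree_inv_stage[OF dl(1), of n j] by (simp add: tree_inv_def)
  note * = tup_props[OF inv assms(2)]
  then show "x \<in> snd ` set (stage n l j)" "y \<in> snd ` set (stage n l j)" by auto
  from * obtain b where b: "b \<in> fst ` set (tl (stage n l j))" "z = Node l b" "h = Help l b"
    "b \<notin> fst ` set (stage n l (Suc j))" by (auto simp: stage_Suc)
  have b1: "b \<in> fst ` set (stage n l j)" using b(1) by (cases "stage n l j") auto
  moreover have "b \<in> set (tl l)"
  proof -
    have "fst ` set (stage n l 0) = set l" by (force simp: stage_0 init_def)
    then have "b \<in> set l" using b1 fst_stage_mono[of 0 j n l] by auto
    moreover have "b \<noteq> hd l"
      using b(1) hd_stage[OF dl(2), of n j] inv by (cases "stage n l j") force+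
    ultimately show ?thesis using dl(2) by (cases l) auto
  qed
  ultimately show "\<exists>b\<in>set (tl l). z = Node l b \<and> h = Help l b \<and> b \<in> fst ` set (stage n l j) \<and> b \<notin> fst ` set (stage n l (Suc j))"
    using b by blast
  show "1 < length l" using \<open>b \<in> set (tl l)\<close> by (cases l; cases "tl l") auto
qed

text \<open>A single variable shares its input with the full monomial, which is harmless because it
  has no conjunctions; the length hypotheses set this case aside.\<close>

lemma own_disjoint:
  assumes "l \<noteq> l'" "1 < length l" "1 < length l'"
  shows "own n l \<inter> own n l' = {}"
  using assms by (auto simp: own_def)

text \<open>Different trees own disjoint qubits and the pairs merged in one tree are disjoint, so a
  whole level fits into the layers of a single conjunction and has T depth one.\<close>

lemma distinct_level: "distinct (concat (map (\<lambda>(x, y, z, h). [x, y, z, h]) (level n j)))"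
proof -
  let ?G = "\<lambda>l. concat (map (\<lambda>(x, y, z, h). [x, y, z, h]) (tup l (stage n l j)))"
  have eq: "concat (map (\<lambda>(x, y, z, h). [x, y, z, h]) (level n j)) = concat (map ?G (monomials n))"
    unfolding level_def by (rule concat_map_concat)
  have sub: "set (?G l) \<subseteq> own n l \<union> range (Help l)" if l: "l \<in> set (monomials n)" for l
  proof
    fix q assume "q \<in> set (?G l)"
    then obtain t where t': "t \<in> set (tup l (stage n l j))" "q \<in> set ((\<lambda>(x, y, z, h). [x, y, z, h]) t)"
      unfolding set_concat set_map by blast
    obtain x y z h where e: "t = (x, y, z, h)" by (cases t)
    have t: "(x, y, z, h) \<in> set (tup l (stage n l j))" "q \<in> {x, y, z, h}"
      using t' by (simp_all add: e)
    have "x \<in> own n l" "y \<in> own n l"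
      using tup_stage(1,2)[OF l t(1)] snd_stage[of l n j] set_monomials[OF l] by auto
    moreover obtain b where "z = Node l b" "h = Help l b" using tup_stage(3)[OF l t(1)] by blast
    ultimately show "q \<in> own n l \<union> range (Help l)" using t(2) Node_own by auto
  qed
  have len: "1 < length l" if l: "l \<in> set (monomials n)" "set (?G l) \<noteq> {}" for l
  proof -
    have "tup l (stage n l j) \<noteq> []" using l(2) by (cases "tup l (stage n l j)") simp_all
    then obtain x y z h where "(x, y, z, h) \<in> set (tup l (stage n l j))"
      by (metis list.set_intros(1) neq_Nil_conv surj_pair)
    from tup_stage(4)[OF l(1) this] show ?thesis .
  qed
  have "set (?G l) \<inter> set (?G l') = {}"
    if l: "l \<in> set (monomials n)" "l' \<in> set (monomials n)" "l \<noteq> l'" for l l'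
  proof (cases "set (?G l) = {} \<or> set (?G l') = {}")
    case False
    then have "own n l \<inter> own n l' = {}" using own_disjoint[OF l(3)] len[OF l(1)] len[OF l(2)] by blast
    moreover have "own n l \<inter> range (Help l') = {}" "own n l' \<inter> range (Help l) = {}" "range (Help l) \<inter> range (Help l') = {}"
      using l(3) own_subset[of n l] own_subset[of n l'] by auto
    ultimately have disj: "(own n l \<union> range (Help l)) \<inter> (own n l' \<union> range (Help l')) = {}" by blast
    show ?thesis
      using Int_mono[OF sub[OF l(1)] sub[OF l(2)]] unfolding disj by (simp only: subset_empty)
  next
    case True
    then show ?thesis by (elim disjE) (simp_all only: Int_empty_left Int_empty_right)
  qed
  then have "sorted_wrt (\<lambda>l l'. set (?G l) \<inter> set (?G l') = {}) (monomials n)"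
    by (intro sorted_wrt_distinct[OF distinct_monomials])
  moreover have "distinct (?G l)" if "l \<in> set (monomials n)" for l
    using distinct_tup[OF tree_inv_stage] set_monomials[OF that] by blast
  ultimately show ?thesis unfolding eq distinct_concat_map by blast
qed

lemma fed_forward_levels: "fed_forward (concat (map (level n) [0..<L]))"
proof -
  let ?R = "\<lambda>(x, y, z, h) (x', y', z', h'). z' \<notin> {x, y, z}"
  have ff: "fed_forward (tup l (stage n l j))" if "l \<in> set (monomials n)" for l j
    using fed_forward_tup[OF tree_inv_stage] set_monomials[OF that] by blast
  have R: "?R a b"
    if l: "l \<in> set (monomials n)" "l' \<in> set (monomials n)" and a: "a \<in> set (tup l (stage n l j))"
      and b: "b \<in> set (tup l' (stage n l' j'))" and "l \<noteq> l' \<or> j < j'" for l l' j j' a b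
  proof -
    obtain x y z h where a': "a = (x, y, z, h)" by (cases a)
    obtain x' y' z' h' where b': "b = (x', y', z', h')" by (cases b)
    note A = tup_stage[OF l(1) a[unfolded a']] and B = tup_stage[OF l(2) b[unfolded b']]
    have dl: "distinct l" using set_monomials[OF l(1)] by auto
    obtain c where c: "z = Node l c" "c \<notin> fst ` set (stage n l (Suc j))" using A(3) by blast
    obtain c' where c': "z' = Node l' c'" "c' \<in> fst ` set (stage n l' j')" using B(3) by blast
    show ?thesis
    proof (cases "l = l'")
      case False
      then have "Node l' c' \<notin> own n l" using own_subset[of n l] by auto
      then have "x \<noteq> z'" "y \<noteq> z'" using A(1,2) snd_stage[OF dl, of n j] c'(1) by auto
      then show ?thesis using False c c' unfolding a' b' by auto
    next
      case True
      \<comment> \<open>In the same tree the later node is named after an index still present at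
        stage \<open>Suc j\<close>. By the freshness invariant this node is not a factor at stage
        \<open>j\<close>, and it differs from the node created there, whose index has just been
        absorbed.\<close>
      then have jj: "j < j'" using that by simp
      have c1: "c' \<in> fst ` set (stage n l (Suc j))"
        using c'(2) jj True fst_stage_mono[of "Suc j" j' n l] by auto
      have c0: "c' \<in> fst ` set (stage n l j)"
        using c'(2) jj True fst_stage_mono[of j j' n l] by auto
      have "\<forall>b\<in>fst ` set (stage n l j). Node l b \<notin> snd ` set (stage n l j)"
        using tree_inv_stage[OF dl, of n j] unfolding tree_inv_def by blast
      with c0 have "Node l c' \<notin> snd ` set (stage n l j)" by (metis)
      then have "z' \<notin> snd ` set (stage n l j)" using c'(1) True by simp
      then have "x \<noteq> z'" "y \<noteq> z'" using A(1,2) by metis+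
      moreover have "c \<noteq> c'" using c1 c(2) by metis
      ultimately show ?thesis using c(1) c'(1) True unfolding a' b' by simp
    qed
  qed
  have lev: "sorted_wrt ?R (level n j)" for j
    unfolding level_def
  proof (rule sorted_wrt_concat_map)
    show "sorted_wrt ?R (tup l (stage n l j))" if "l \<in> set (monomials n)" for l
      using ff[OF that] by (simp add: fed_forward_def)
    show "sorted_wrt (\<lambda>l l'. \<forall>a\<in>set (tup l (stage n l j)). \<forall>b\<in>set (tup l' (stage n l' j)). ?R a b) (monomials n)"
      by (rule sorted_wrt_distinct[OF distinct_monomials]) (use R in blast)
  qed
  have "sorted_wrt ?R (concat (map (level n) [0..<L]))"
  proof (rule sorted_wrt_concat_map)
    have "?R a b" if jj: "j < j'" "a \<in> set (level n j)" "b \<in> set (level n j')" for j j' a b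
    proof -
      obtain l l' where "l \<in> set (monomials n)" "a \<in> set (tup l (stage n l j))"
        "l' \<in> set (monomials n)" "b \<in> set (tup l' (stage n l' j'))"
        using jj(2,3) unfolding level_def by auto
      with R jj(1) show ?thesis by blast
    qed
    then show "sorted_wrt (\<lambda>j j'. \<forall>a\<in>set (level n j). \<forall>b\<in>set (level n j'). ?R a b) [0..<L]"
      by (intro sorted_wrt_mono_rel[OF _ sorted_wrt_upt]) blast
  qed (rule lev)
  moreover have "\<forall>(x, y, z, h)\<in>set (concat (map (level n) [0..<L])). distinct [x, y, z, h]"
  proof
    fix a assume "a \<in> set (concat (map (level n) [0..<L]))"
    then obtain l j where "l \<in> set (monomials n)" "a \<in> set (tup l (stage n l j))"
      unfolding level_def by auto
    then show "case a of (x, y, z, h) \<Rightarrow> distinct [x, y, z, h]"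
      using ff unfolding fed_forward_def by blast
  qed
  ultimately show ?thesis unfolding fed_forward_def by blast
qed

section \<open>Monomials: algebraic normal form and counting\<close>

text \<open>Used to split the parity of an output into the monomials shared with its partner output
  and the remaining ones.\<close>

lemma odd_filter_split:
  "odd (length (filter P xs)) \<longleftrightarrow>
     odd (length (filter (\<lambda>x. P x \<and> Q x) xs)) \<noteq> odd (length (filter (\<lambda>x. P x \<and> \<not> Q x) xs))"
  by (induction xs) auto

text \<open>Davio expansion \<open>g = g0 xor (x and g1)\<close>: the cofactor \<open>g0\<close> for
  \<open>x = 0\<close> supplies the coefficients of the monomials without \<open>x\<close>, and the
  derivative \<open>g1\<close> those of the monomials with \<open>x\<close>. Neither depends on
  \<open>x\<close>, so the induction hypothesis applies to both.\<close>

lemma anf_exists: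
  assumes "distinct xs" "\<And>v w. (\<forall>i\<in>set xs. v i = w i) \<Longrightarrow> g v = g w"
  shows "\<exists>a. \<forall>v. g v = odd (length (filter (\<lambda>l. a l \<and> (\<forall>i\<in>set l. v i)) (subseqs xs)))"
  using assms
proof (induction xs arbitrary: g)
  case Nil
  have "g v = g (\<lambda>_. False)" for v by (rule Nil(2)) simp
  then show ?case by (intro exI[of _ "\<lambda>l. g (\<lambda>_. False)"]) auto
next
  case (Cons x xs)
  define g0 where "g0 v = g (v(x := False))" for v
  define g1 where "g1 v = (g (v(x := True)) \<noteq> g (v(x := False)))" for v
  have d: "distinct xs" "x \<notin> set xs" using Cons.prems(1) by auto
  have c: "g (v(x := u)) = g (w(x := u))" if "\<forall>i\<in>set xs. v i = w i" for v w u
    by (rule Cons.prems(2)) (use that in auto)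
  obtain a0 where a0: "g0 v = odd (length (filter (\<lambda>l. a0 l \<and> (\<forall>i\<in>set l. v i)) (subseqs xs)))" for v
    using Cons.IH[OF d(1), of g0] c unfolding g0_def by blast
  have "g1 v = g1 w" if "\<forall>i\<in>set xs. v i = w i" for v w
    using c[OF that] unfolding g1_def by simp
  then obtain a1 where a1: "g1 v = odd (length (filter (\<lambda>l. a1 l \<and> (\<forall>i\<in>set l. v i)) (subseqs xs)))" for v
    using Cons.IH[OF d(1), of g1] by blast
  \<comment> \<open>In \<open>subseqs (x # xs)\<close> a list containing \<open>x\<close> has it in
    front, so \<open>tl\<close> recovers the monomial of the derivative.\<close>
  define a where "a l = (if x \<in> set l then a1 (tl l) else a0 l)" for l
  have "g v = odd (length (filter (\<lambda>l. a l \<and> (\<forall>i\<in>set l. v i)) (subseqs (x # xs))))" for v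
  proof -
    have nx: "x \<notin> set l" if "l \<in> set (subseqs xs)" for l
    proof -
      have "set l \<in> set ` set (subseqs xs)" using that by blast
      then show ?thesis using d(2) unfolding subseqs_powset by auto
    qed
    have 1: "filter (\<lambda>l. a l \<and> (\<forall>i\<in>set l. v i)) (subseqs xs) = filter (\<lambda>l. a0 l \<and> (\<forall>i\<in>set l. v i)) (subseqs xs)"
      by (rule filter_cong) (auto simp: a_def nx)
    have 2: "length (filter (\<lambda>l. a l \<and> (\<forall>i\<in>set l. v i)) (map ((#) x) ls)) =
      (if v x then length (filter (\<lambda>l. a1 l \<and> (\<forall>i\<in>set l. v i)) ls) else 0)" for ls
      by (induction ls) (auto simp: a_def)
    have "g v = (g0 v \<noteq> (v x \<and> g1 v))"
    proof (cases "v x")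
      case True
      then have "v(x := True) = v" by (simp add: fun_upd_idem)
      then show ?thesis using True by (auto simp: g0_def g1_def)
    next
      case False
      then have "v(x := False) = v" by (simp add: fun_upd_idem)
      then show ?thesis using False by (auto simp: g0_def g1_def)
    qed
    moreover have "length (filter Q (subseqs (x # xs))) =
        length (filter Q (map ((#) x) (subseqs xs))) + length (filter Q (subseqs xs))" for Q
      by (simp add: Let_def)
    then have "length (filter (\<lambda>l. a l \<and> (\<forall>i\<in>set l. v i)) (subseqs (x # xs))) =
        (if v x then length (filter (\<lambda>l. a1 l \<and> (\<forall>i\<in>set l. v i)) (subseqs xs)) else 0) +
        length (filter (\<lambda>l. a0 l \<and> (\<forall>i\<in>set l. v i)) (subseqs xs))"
      unfolding 1[symmetric] 2[symmetric] .
    ultimately show ?thesis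
      unfolding a0[symmetric] a1[symmetric] by (simp only: even_add a0 a1 split: if_split) auto
  qed
  then show ?case by blast
qed

lemma filter_Nil_subseqs: "filter (\<lambda>l. l = []) (subseqs xs) = [[]]"
  by (induction xs) (auto simp: Let_def filter_empty_conv)

lemma monomials_split:
  "length (filter Q (subseqs [0..<n])) = (if Q [] then 1 else 0) + length (filter Q (monomials n))"
proof -
  have "length (filter Q ls) = length (filter Q (filter (\<lambda>l. l = []) ls)) + length (filter Q (filter (\<lambda>l. l \<noteq> []) ls))" for ls :: "nat list list"
    by (induction ls) auto
  from this[of "subseqs [0..<n]"] show ?thesis
    unfolding monomials_def filter_Nil_subseqs by simp
qed

lemma length_monomials: "length (monomials n) = 2 ^ n - 1"
  using monomials_split[of "\<lambda>_. True" n] by (simp add: length_subseqs)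

text \<open>Every variable occurs in half of all subsets.\<close>

lemma sum_length_subseqs: "2 * (\<Sum>l\<leftarrow>subseqs xs. length l) = length xs * 2 ^ length xs"
proof (induction xs)
  case (Cons x xs)
  have "(\<Sum>l\<leftarrow>map ((#) x) ls. length l) = length ls + (\<Sum>l\<leftarrow>ls. length l)" for ls
    by (induction ls) auto
  with Cons show ?case by (simp add: Let_def length_subseqs algebra_simps)
qed simp

lemma sum_length_monomials: "2 * (\<Sum>l\<leftarrow>monomials n. length l) = n * 2 ^ n"
proof -
  have "(\<Sum>l\<leftarrow>filter (\<lambda>l. l \<noteq> []) ls. length l) = (\<Sum>l\<leftarrow>ls. length l)" for ls :: "nat list list"
    by (induction ls) auto
  then show ?thesis using sum_length_subseqs[of "[0..<n]"] by (simp add: monomials_def)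
qed

lemma count_single_subseqs: "length (filter (\<lambda>l. length l = 1) (subseqs xs)) = length xs"
proof (induction xs)
  case (Cons x xs)
  have "length (filter (\<lambda>l. length l = 1) (map ((#) x) ls)) = length (filter (\<lambda>l. l = []) ls)" for ls
    by (induction ls) auto
  with Cons show ?case by (simp add: Let_def filter_Nil_subseqs)
qed simp

lemma count_single_monomials: "length (filter (\<lambda>l. length l = 1) (monomials n)) = n"
  using monomials_split[of "\<lambda>l. length l = 1" n] count_single_subseqs[of "[0..<n]"] by simp

lemma self_in_subseqs: "xs \<in> set (subseqs xs)"
  by (induction xs) (auto simp: Let_def)

lemma full_monomial: "0 < n \<Longrightarrow> [0..<n] \<in> set (monomials n)"
  using self_in_subseqs[of "[0..<n]"] by (simp add: monomials_def)

lemma sum_list_filter_split: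
  "(\<Sum>l\<leftarrow>ls. F l) = (\<Sum>l\<leftarrow>filter Q ls. F l) + (\<Sum>l\<leftarrow>filter (\<lambda>l. \<not> Q l) ls. (F l :: nat))"
  by (induction ls) auto

lemma sum_length_long: "(\<Sum>l\<leftarrow>filter (\<lambda>l. 1 < length l) (monomials n). length l) + n = (\<Sum>l\<leftarrow>monomials n. length l)"
proof -
  have "filter (\<lambda>l. \<not> 1 < length l) (monomials n) = filter (\<lambda>l. length l = 1) (monomials n)"
    by (rule filter_cong) (auto dest!: set_monomials simp: Suc_lessI not_less le_Suc_eq)
  moreover have "(\<Sum>l\<leftarrow>filter (\<lambda>l. length l = 1) ls. length l) = length (filter (\<lambda>l. length l = 1) ls)" for ls :: "nat list list"
    by (induction ls) auto
  ultimately show ?thesis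
    using sum_list_filter_split[of length "monomials n" "\<lambda>l. 1 < length l"] by (simp add: count_single_monomials[unfolded One_nat_def])
qed

text \<open>The monomials that work without copies are the \<open>n\<close> single variables and the
  full one, of total length \<open>n + n\<close>.\<close>

lemma sum_length_copied:
  assumes "2 \<le> n"
  shows "(\<Sum>l\<leftarrow>filter (\<lambda>l. 1 < length l \<and> l \<noteq> [0..<n]) (monomials n). length l) + 2 * n = (\<Sum>l\<leftarrow>monomials n. length l)"
proof -
  have one: "filter (\<lambda>l. l = a) ls = [a]" if "distinct ls" "a \<in> set ls" for a and ls :: "nat list list"
    using that
  proof (induction ls)
    case (Cons b ls)
    show ?case
    proof (cases "b = a")
      case True
      then have "filter (\<lambda>l. l = a) ls = []" using Cons.prems(1) by (auto simp: filter_empty_conv)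
      then show ?thesis using True by simp
    next
      case False
      then show ?thesis using Cons by simp
    qed
  qed simp
  let ?M = "filter (\<lambda>l. 1 < length l) (monomials n)"
  have "filter (\<lambda>l. l = [0..<n]) ?M = [[0..<n]]"
    by (rule one) (use assms full_monomial[of n] distinct_monomials in auto)
  moreover have "filter (\<lambda>l. l \<noteq> [0..<n]) ?M = filter (\<lambda>l. 1 < length l \<and> l \<noteq> [0..<n]) (monomials n)"
    by (simp add: conj_commute)
  ultimately have "(\<Sum>l\<leftarrow>?M. length l) = n + (\<Sum>l\<leftarrow>filter (\<lambda>l. 1 < length l \<and> l \<noteq> [0..<n]) (monomials n). length l)"
    using sum_list_filter_split[of length ?M "\<lambda>l. l = [0..<n]"] by simp
  with sum_length_long[of n] show ?thesis by simp
qed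

lemma sum_length_tl: "(\<Sum>l\<leftarrow>monomials n. length l - 1) + (2 ^ n - 1) = (\<Sum>l\<leftarrow>monomials n. length l)"
proof -
  have "(\<Sum>l\<leftarrow>ls. length l - 1) + length ls = (\<Sum>l\<leftarrow>ls. length l)" if "\<forall>l\<in>set ls. l \<noteq> []" for ls :: "nat list list"
    using that by (induction ls) (auto simp: Suc_le_eq)
  from this[of "monomials n"] show ?thesis using set_monomials by (auto simp: length_monomials)
qed

lemma sum_level: "(\<Sum>j<L. length (level n j)) \<le> (\<Sum>l\<leftarrow>monomials n. length l - 1)"
proof -
  have len: "length (level n j) = (\<Sum>l\<leftarrow>monomials n. length (tup l (stage n l j)))" for j
    by (simp add: level_def length_concat o_def)
  have sw: "(\<Sum>j<L. \<Sum>l\<leftarrow>ls. F j l) = (\<Sum>l\<leftarrow>ls. \<Sum>j<L. (F j l :: nat))" for F and ls :: "nat list list"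
    by (induction ls) (auto simp: sum.distrib)
  have "(\<Sum>j<L. length (tup l (stage n l j))) \<le> length l - 1" if "l \<in> set (monomials n)" for l
    using sum_length_tup[where d = L and n = n and l = l] hd_stage[of l n L] set_monomials[OF that]
    by (cases "stage n l L") auto
  then show ?thesis unfolding len sw by (rule sum_list_mono)
qed

section \<open>The circuit\<close>

lemma sched_concat_times:
  assumes "\<And>x. x \<in> set xs \<Longrightarrow> sched (G x)"
    "sorted_wrt (\<lambda>x y. \<forall>a\<in>set (G x). \<forall>b\<in>set (G y). fst a < fst b) xs"
  shows "sched (concat (map G xs))"
  unfolding sched_def
proof (rule sorted_wrt_concat_map)
  show "sorted_wrt (\<lambda>x y. \<forall>a\<in>set (G x). \<forall>b\<in>set (G y).
      op_qubits (snd a) \<inter> op_qubits (snd b) \<noteq> {} \<longrightarrow> fst a < fst b) xs"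
    using assms(2) by (rule sorted_wrt_mono_rel[rotated]) blast
qed (use assms(1) in \<open>simp add: sched_def\<close>)

text \<open>The inserted \<open>0\<close> keeps \<open>Max\<close> meaningful for an empty list,
  whose end is then 1.\<close>

definition tend :: "(nat \<times> op) list \<Rightarrow> nat" where
  "tend P = Suc (Max (insert 0 (fst ` set P)))"

lemma tend: "a \<in> set P \<Longrightarrow> fst a < tend P"
  unfolding tend_def by (simp add: less_Suc_eq_le)

text \<open>Qubits that neither the copying of the inputs nor the conjunctions touch, so that their
  preparation may overlap with these stages.\<close>

definition late :: "lab set" where
  "late = {a. (\<exists>r k. a = Fan r k) \<or> (\<exists>p. a = Duo p)}"

lemma late_simps [simp]:
  "Fan r k \<in> late" "Duo p \<in> late" "In i \<notin> late" "Out j \<notin> late" "Copy l i \<notin> late" "Help l i \<notin> late" "Node l i \<notin> late"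
  by (simp_all add: late_def)

text \<open>\<open>A j k\<close> tells whether monomial \<open>k\<close> occurs in output
  \<open>j\<close>, and \<open>c0 j\<close> is the constant term. \<open>A\<close> is false from row
  \<open>m\<close> on, so that for odd \<open>m\<close> the last output can be paired with an empty
  one. \<open>K\<close> is the number of output pairs in a block and \<open>L\<close> the number of
  conjunction levels.\<close>

locale mono_circuit =
  fixes n m K L :: nat and A :: "nat \<Rightarrow> nat \<Rightarrow> bool" and c0 :: "nat \<Rightarrow> bool" and e :: "lab \<Rightarrow> nat"
  assumes inj_e: "inj e" and n2: "2 \<le> n" and m1: "1 \<le> m" and BK: "2 ^ n - 1 \<le> K" and nL: "n \<le> 2 ^ L"
    and A: "\<And>j k. m \<le> j \<Longrightarrow> \<not> A j k"
begin

lemma e_iff [simp]: "e a = e b \<longleftrightarrow> a = b"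
  using inj_e by (auto dest: injD)

lemma e_image_iff [simp]: "e a \<in> e ` S \<longleftrightarrow> a \<in> S"
  by auto

lemma L1: "1 \<le> L"
  using n2 nL by (cases L) auto

definition B :: nat where "B = length (monomials n)"

lemma B_eq: "B = 2 ^ n - 1"
  by (simp add: B_def length_monomials)

lemma B_pos: "3 \<le> B"
proof -
  have "(2::nat) ^ 2 \<le> 2 ^ n" using n2 by (intro power_increasing) auto
  then show ?thesis by (simp add: B_eq)
qed

lemma B_le_K: "B \<le> K"
  using BK by (simp add: B_eq)

definition np :: nat where "np = (m + 1) div 2"

lemma np_pos: "1 \<le> np"
  using m1 by (simp add: np_def)

text \<open>The number of blocks, \<open>np / K\<close> rounded up.\<close>

definition R :: nat where "R = (np - 1) div K + 1"

definition src :: "nat \<Rightarrow> lab" where "src k = root n L (monomials n ! k)"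

definition loc :: "nat \<Rightarrow> nat \<Rightarrow> lab" where "loc r k = (if r = 0 then src k else Fan r k)"

definition cps :: "nat \<Rightarrow> nat list list" where
  "cps i = filter (\<lambda>l. i \<in> set l \<and> 1 < length l \<and> l \<noteq> [0..<n]) (monomials n)"

text \<open>No qubit is reserved for being a Bell partner: \<open>Copy l i\<close> is paired with
  \<open>Help l i\<close>, which serves as scratch space only later, and a \<open>Fan\<close> is
  paired with a \<open>Duo\<close> that has not been loaded yet.\<close>

definition ancs :: "lab list" where
  "ancs = concat (map (\<lambda>l. map (Copy l) l) (filter (\<lambda>l. 1 < length l \<and> l \<noteq> [0..<n]) (monomials n)))
     @ concat (map (\<lambda>l. map (Help l) l) (filter (\<lambda>l. 1 < length l) (monomials n)))
     @ concat (map (\<lambda>l. map (Node l) (tl l)) (monomials n))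
     @ map Duo [0..<np] @ concat (map (\<lambda>r. map (Fan r) [0..<B]) [1..<R])"

definition labs :: "lab set" where
  "labs = In ` {..<n} \<union> Out ` {..<m} \<union> set ancs"

lemma in_ancs:
  "Copy l i \<in> set ancs \<longleftrightarrow> l \<in> set (monomials n) \<and> i \<in> set l \<and> 1 < length l \<and> l \<noteq> [0..<n]"
  "Help l i \<in> set ancs \<longleftrightarrow> l \<in> set (monomials n) \<and> i \<in> set l \<and> 1 < length l"
  "Node l i \<in> set ancs \<longleftrightarrow> l \<in> set (monomials n) \<and> i \<in> set (tl l)"
  "Duo p \<in> set ancs \<longleftrightarrow> p < np"
  "Fan r k \<in> set ancs \<longleftrightarrow> 1 \<le> r \<and> r < R \<and> k < B"
  "In i \<notin> set ancs" "Out j \<notin> set ancs"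
  by (auto simp: ancs_def image_iff)

lemma set_cps: "l \<in> set (cps i) \<longleftrightarrow> l \<in> set (monomials n) \<and> i \<in> set l \<and> 1 < length l \<and> l \<noteq> [0..<n]"
  by (auto simp: cps_def)

lemma distinct_cps: "distinct (cps i)"
  using distinct_monomials by (simp add: cps_def)

section \<open>Fan-out and conjunction levels on named qubits\<close>

definition lchains :: "nat \<Rightarrow> nat \<Rightarrow> nat \<Rightarrow> (lab \<times> (lab \<times> lab) list) list \<Rightarrow> (nat \<times> op) list" where
  "lchains tH tB tL lst = concat (map (chain tH tB tL) (map (\<lambda>(s, l). (e s, map (map_prod e e) l)) lst))"

lemma concat_chain_qubits_map:
  "concat (map chain_qubits (map (\<lambda>(s, l). (e s, map (map_prod e e) l)) lst)) = map e (concat (map chain_qubits lst))"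
  by (induction lst) (auto simp: o_def)

lemma distinct_lchain:
  assumes "distinct (concat (map chain_qubits lst))"
  shows "distinct (concat (map chain_qubits (map (\<lambda>(s, l). (e s, map (map_prod e e) l)) lst)))"
  unfolding concat_chain_qubits_map using assms inj_e by (simp add: distinct_map inj_on_subset[OF inj_e])

lemma sends_lchains:
  assumes "distinct (concat (map chain_qubits lst))"
    "\<And>s l q p. (s, l) \<in> set lst \<Longrightarrow> (q, p) \<in> set l \<Longrightarrow> \<not> b (e q) \<and> \<not> b (e p)"
    "\<And>s l q p. (s, l) \<in> set lst \<Longrightarrow> (q, p) \<in> set l \<Longrightarrow> b' (e q) = b (e s)"
    "\<And>x. (\<And>s l q p. (s, l) \<in> set lst \<Longrightarrow> (q, p) \<in> set l \<Longrightarrow> x \<noteq> e q) \<Longrightarrow> b' x = b x"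
  shows "sends o' (map snd (lchains tH tB tL lst)) b b'"
  unfolding lchains_def
proof (rule sends_chains[OF distinct_lchain[OF assms(1)]])
  fix s l x
  assume *: "(s, l) \<in> set (map (\<lambda>(s, l). (e s, map (map_prod e e) l)) lst)" "x \<in> set (map fst l @ map snd l)"
  from *(1) obtain s' l' where l: "(s', l') \<in> set lst" "l = map (map_prod e e) l'" by auto
  from *(2) obtain q p where "(q, p) \<in> set l'" "x = e q \<or> x = e p" unfolding l(2) by auto
  with assms(2)[OF l(1)] show "\<not> b x" by blast
next
  fix s l q
  assume *: "(s, l) \<in> set (map (\<lambda>(s, l). (e s, map (map_prod e e) l)) lst)" "q \<in> set (map fst l)"
  from *(1) obtain s' l' where l: "(s', l') \<in> set lst" "s = e s'" "l = map (map_prod e e) l'" by auto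
  from *(2) obtain q' p where "(q', p) \<in> set l'" "q = e q'" unfolding l(3) by auto
  with assms(3)[OF l(1)] l(2) show "b' q = b s" by blast
next
  fix x
  assume *: "\<And>s l. (s, l) \<in> set (map (\<lambda>(s, l). (e s, map (map_prod e e) l)) lst) \<Longrightarrow> x \<notin> set (map fst l)"
  show "b' x = b x"
  proof (rule assms(4))
    fix s l q p assume l: "(s, l) \<in> set lst" "(q, p) \<in> set l"
    have "(e s, map (map_prod e e) l) \<in> set (map (\<lambda>(s, l). (e s, map (map_prod e e) l)) lst)"
      using l(1) by force
    from *[OF this] l(2) show "x \<noteq> e q" by force
  qed
qed

lemma sched_lchains:
  assumes "distinct (concat (map chain_qubits lst))" "tH < tB" "tB < tL"
  shows "sched (lchains tH tB tL lst)"
proof -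
  let ?l = "map (\<lambda>(s, l). (e s, map (map_prod e e) l)) lst"
  have d: "\<forall>x\<in>set ?l. distinct (chain_qubits x)" "sorted_wrt (\<lambda>x y. set (chain_qubits x) \<inter> set (chain_qubits y) = {}) ?l"
    using distinct_lchain[OF assms(1)] unfolding distinct_concat_map by blast+
  show ?thesis
    unfolding lchains_def
  proof (rule sched_concat)
    show "sorted_wrt (\<lambda>x y. qubits (chain tH tB tL x) \<inter> qubits (chain tH tB tL y) = {}) ?l"
    proof (rule sorted_wrt_mono_rel[OF _ d(2)])
      fix x y :: "nat \<times> (nat \<times> nat) list" assume xy: "set (chain_qubits x) \<inter> set (chain_qubits y) = {}"
      have "qubits (chain tH tB tL x) \<inter> qubits (chain tH tB tL y) \<subseteq> set (chain_qubits x) \<inter> set (chain_qubits y)"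
        by (intro Int_mono qubits_chain)
      then show "qubits (chain tH tB tL x) \<inter> qubits (chain tH tB tL y) = {}" unfolding xy by simp
    qed
  qed (use d(1) assms in \<open>blast intro: sched_chain\<close>)
qed

lemma wf_lchains:
  assumes "distinct (concat (map chain_qubits lst))" "set (concat (map chain_qubits lst)) \<subseteq> S"
  shows "wf_ops (e ` S) (lchains tH tB tL lst)"
  unfolding lchains_def wf_ops_concat
proof
  let ?l = "map (\<lambda>(s, l). (e s, map (map_prod e e) l)) lst"
  fix x assume x: "x \<in> set ?l"
  have "distinct (chain_qubits x)"
    using distinct_lchain[OF assms(1)] x unfolding distinct_concat_map by blast
  moreover have "set (chain_qubits x) \<subseteq> (\<Union>c\<in>set ?l. set (chain_qubits c))"
    using x by (rule UN_upper)
  then have "set (chain_qubits x) \<subseteq> set (concat (map chain_qubits ?l))"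
    by (simp only: set_concat set_map image_image)
  then have "set (chain_qubits x) \<subseteq> e ` set (concat (map chain_qubits lst))"
    unfolding concat_chain_qubits_map set_map .
  then have "set (chain_qubits x) \<subseteq> e ` S"
    using image_mono[OF assms(2), of e] by (rule subset_trans)
  ultimately show "wf_ops (e ` S) (chain tH tB tL x)" by (rule wf_chain)
qed

lemma causal_lchains: "causal (lchains tH tB tL lst)"
  unfolding lchains_def by (intro causal_concat causal_chain)

lemma count_lchains:
  "count_ops is_T_op (lchains tH tB tL lst) = 0"
  "count_ops is_CNOT_op (lchains tH tB tL lst) = (\<Sum>(s, l)\<leftarrow>lst. 2 * length l)"
  unfolding lchains_def by (induction lst) (auto simp: count_chain)

lemma op_times_lchains:
  "op_times is_T_op (lchains tH tB tL lst) = {}"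
  "op_times is_CNOT_op (lchains tH tB tL lst) \<subseteq> {tB, tL}"
  "(\<And>s l. (s, l) \<in> set lst \<Longrightarrow> l = []) \<Longrightarrow> op_times is_CNOT_op (lchains tH tB tL lst) = {}"
  unfolding lchains_def op_times_concat by (auto simp: op_times_chain split: if_splits)

lemma meas_bits_lchains:
  "meas_bits (lchains tH tB tL lst) = map (\<lambda>a. 2 * e a) (concat (map (\<lambda>(s, l). map snd l) lst))"
  unfolding lchains_def
proof (induction lst)
  case (Cons a lst)
  then show ?case by (cases a) (simp add: meas_bits_chain o_def case_prod_unfold)
qed simp

lemma lchains_times:
  assumes "(t, p') \<in> set (lchains tH tB tL lst)"
  shows "(t = tH \<or> t = tB) \<and> op_qubits p' \<subseteq> e ` (\<Union>(s, l)\<in>set lst. set (map fst l @ map snd l)) \<or> tL \<le> t"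
proof -
  obtain s l where l: "(s, l) \<in> set lst" "(t, p') \<in> set (chain tH tB tL (e s, map (map_prod e e) l))"
    using assms unfolding lchains_def by auto
  have "set (map fst (map (map_prod e e) l) @ map snd (map (map_prod e e) l)) \<subseteq> e ` (\<Union>(s, l)\<in>set lst. set (map fst l @ map snd l))"
    using l(1) by force
  with chain_times[OF l(2)] show ?thesis by blast
qed

definition et :: "lab \<times> lab \<times> lab \<times> lab \<Rightarrow> nat \<times> nat \<times> nat \<times> nat" where
  "et = (\<lambda>(x, y, z, h). (e x, e y, e z, e h))"

lemma flat_et: "concat (map (\<lambda>(x, y, z, h). [x, y, z, h]) (map et ts)) = map e (concat (map (\<lambda>(x, y, z, h). [x, y, z, h]) ts))"
  by (induction ts) (auto simp: et_def)

lemma distinct_level_et: "distinct (concat (map (\<lambda>(x, y, z, h). [x, y, z, h]) (map et (level n j))))"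
  unfolding flat_et using distinct_level[of n j] by (simp add: distinct_map inj_on_subset[OF inj_e])

lemma sched_and_level: "sched (concat (map (and_gate \<tau>) (map et (level n j))))"
  and sched_unand_level: "sched (concat (map (unand_gate \<tau>) (map et (rev (level n j)))))"
proof -
  let ?l = "map et (level n j)"
  let ?F = "\<lambda>(x, y, z, h). [x, y, z, h :: nat]"
  have d: "\<forall>x\<in>set ?l. distinct (?F x)" "sorted_wrt (\<lambda>x y. set (?F x) \<inter> set (?F y) = {}) ?l"
    using distinct_level_et[of j] unfolding distinct_concat_map by blast+
  have qa: "qubits (and_gate \<tau> x) = set (?F x)" for x by (cases x) (simp add: qubits_and_gate)
  have qu: "qubits (unand_gate \<tau> x) \<subseteq> set (?F x)" for x by (cases x) (auto simp: qubits_unand_gate)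
  show "sched (concat (map (and_gate \<tau>) ?l))"
  proof (rule sched_concat)
    show "sorted_wrt (\<lambda>x y. qubits (and_gate \<tau> x) \<inter> qubits (and_gate \<tau> y) = {}) ?l"
      unfolding qa by (rule d(2))
  next
    fix x assume "x \<in> set ?l"
    with d(1) have "distinct (?F x)" by blast
    then show "sched (and_gate \<tau> x)" by (cases x) (simp add: sched_and_gate)
  qed
  have "sched (concat (map (unand_gate \<tau>) (rev ?l)))"
  proof (rule sched_concat)
    show "sorted_wrt (\<lambda>x y. qubits (unand_gate \<tau> x) \<inter> qubits (unand_gate \<tau> y) = {}) (rev ?l)"
      unfolding sorted_wrt_rev
    proof (rule sorted_wrt_mono_rel[OF _ d(2)])
      fix x y assume xy: "set (?F x) \<inter> set (?F y) = {}"
      have "qubits (unand_gate \<tau> y) \<inter> qubits (unand_gate \<tau> x) \<subseteq> set (?F y) \<inter> set (?F x)"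
        by (intro Int_mono qu)
      then show "qubits (unand_gate \<tau> y) \<inter> qubits (unand_gate \<tau> x) = {}" using xy by (simp only: Int_commute subset_empty)
    qed
  qed (rule sched_unand_gate)
  then show "sched (concat (map (unand_gate \<tau>) (map et (rev (level n j)))))"
    by (simp add: rev_map)
qed

lemma level_labs:
  assumes "(x, y, z, h) \<in> set (level n j)"
  shows "x \<in> labs" "y \<in> labs" "z \<in> labs" "h \<in> labs" "distinct [x, y, z, h]"
    "{x, y, z, h} \<inter> late = {}"
    "\<exists>l b. z = Node l b \<and> h = Help l b \<and> z \<in> set ancs \<and> h \<in> set ancs"
proof -
  obtain l where l: "l \<in> set (monomials n)" "(x, y, z, h) \<in> set (tup l (stage n l j))"
    using assms unfolding level_def by auto
  note T = tup_stage[OF l]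
  have ml: "set l \<subseteq> {..<n}" "distinct l" using set_monomials[OF l(1)] by auto
  obtain b where b: "b \<in> set (tl l)" "z = Node l b" "h = Help l b" using T(3) by blast
  have bl: "b \<in> set l" using b(1) by (cases l) auto
  show zh: "\<exists>l b. z = Node l b \<and> h = Help l b \<and> z \<in> set ancs \<and> h \<in> set ancs"
    using b bl l(1) T(4) by (auto simp: in_ancs)
  then show "z \<in> labs" "h \<in> labs" by (auto simp: labs_def)
  have st: "q \<in> labs \<and> q \<notin> late" if "q \<in> snd ` set (stage n l j)" for j q
    using that
  proof (induction j arbitrary: q)
    case 0
    then obtain i where i: "i \<in> set l" "q = leaf n l i" by (auto simp: stage_0 init_def)
    show ?case
    proof (cases "l = [0..<n] \<or> length l = 1")
      case True
      then have "q = In i" using i(2) by (simp add: leaf_def)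
      then show ?thesis using i(1) ml(1) by (auto simp: labs_def)
    next
      case False
      then have "q = Copy l i" using i(2) by (simp add: leaf_def)
      then show ?thesis using i(1) l(1) T(4) False by (auto simp: labs_def in_ancs)
    qed
  next
    case (Suc j)
    have dj: "distinct (map fst (stage n l j))" using tree_inv_stage[OF ml(2), of n j] by (simp add: tree_inv_def)
    from snd_nxt[OF dj Suc.prems[unfolded stage_Suc]]
    consider "q \<in> snd ` set (stage n l j)" | b where "b \<in> fst ` set (stage n l j)" "q = Node l b" "b \<notin> fst ` set (stage n l (Suc j))"
      unfolding stage_Suc by blast
    then show ?case
    proof cases
      case 1
      then show ?thesis by (rule Suc.IH)
    next
      case 2
      have "fst ` set (stage n l 0) = set l" by (force simp: stage_0 init_def)
      then have "b \<in> set l" using 2(1) fst_stage_mono[of 0 j n l] by auto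
      moreover have "b \<noteq> hd l"
      proof
        assume "b = hd l"
        then have "b \<in> fst ` set (stage n l (Suc j))"
          using hd_stage[of l n "Suc j"] set_monomials[OF l(1)] by (metis hd_in_set imageI)
        with 2(3) show False by blast
      qed
      ultimately have "b \<in> set (tl l)" by (cases l) auto
      then show ?thesis using 2(2) l(1) by (auto simp: labs_def in_ancs)
    qed
  qed
  show "x \<in> labs" "y \<in> labs" using st T(1,2) by blast+
  show "{x, y, z, h} \<inter> late = {}"
    using st[OF T(1)] st[OF T(2)] b(2,3) by auto
  show "distinct [x, y, z, h]"
    using fed_forward_tup[OF tree_inv_stage[OF ml(2)], of n j] l(2) unfolding fed_forward_def by fastforce
qed

end

lemma sorted_wrt_neq: "distinct xs \<Longrightarrow> sorted_wrt (\<noteq>) xs"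
  by (induction xs) auto

lemma sorted_wrt_conj: "sorted_wrt P xs \<Longrightarrow> sorted_wrt Q xs \<Longrightarrow> sorted_wrt (\<lambda>x y. P x y \<and> Q x y) xs"
  by (induction xs) auto

lemma sched_map:
  assumes "sorted_wrt R xs" "\<And>x y. x \<in> set xs \<Longrightarrow> y \<in> set xs \<Longrightarrow> R x y \<Longrightarrow>
    op_qubits (snd (F x)) \<inter> op_qubits (snd (F y)) \<noteq> {} \<Longrightarrow> fst (F x) < fst (F y)"
  shows "sched (map F xs)"
  unfolding sched_def sorted_wrt_map by (rule sorted_wrt_mono_rel[OF _ assms(1)]) (use assms(2) in blast)

lemma and_gates_times: "a \<in> set (concat (map (and_gate \<tau>) xs)) \<Longrightarrow> \<tau> \<le> fst a \<and> fst a < \<tau> + 20"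
proof (induction xs)
  case (Cons x xs)
  then show ?case using and_gate_times[of "fst a" "snd a" \<tau> x] by auto
qed simp

lemma unand_gates_times: "a \<in> set (concat (map (unand_gate \<tau>) xs)) \<Longrightarrow> \<tau> \<le> fst a \<and> fst a < \<tau> + 9"
proof (induction xs)
  case (Cons x xs)
  then show ?case using unand_gate_times[of "fst a" "snd a" \<tau> x] by auto
qed simp

context mono_circuit
begin

text \<open>Below, \<open>S\<^sub>i\<close> is a stage of the circuit and \<open>T\<^sub>i\<close> its first layer: 1 copies the inputs, 2 computes
  the monomials, 4 copies the monomials, 5 and 6 add them to the outputs, 7 clears the auxiliary
  qubits of 4 to 6 and adds the constants, 8 and 9 undo 2 and 1.\<close>

definition chs1 :: "(lab \<times> (lab \<times> lab) list) list" where
  "chs1 = map (\<lambda>i. (In i, map (\<lambda>l. (Copy l i, Help l i)) (cps i))) [0..<n]"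

definition S1 :: "(nat \<times> op) list" where "S1 = lchains 0 1 2 chs1"

definition T2 :: nat where "T2 = tend S1"

definition S2 :: "(nat \<times> op) list" where
  "S2 = concat (map (\<lambda>j. concat (map (and_gate (T2 + 20 * j)) (map et (level n j)))) [0..<L])"

definition T4 :: nat where "T4 = T2 + 20 * L"

text \<open>The index \<open>(r - 1) * K + k\<close> runs through pairs of block
  \<open>r - 1\<close>, which is complete whenever block \<open>r\<close> exists. Division by
  \<open>K\<close> recovers \<open>r\<close> and \<open>k\<close>, so different copies get different
  partners.\<close>

definition chs4 :: "(lab \<times> (lab \<times> lab) list) list" where
  "chs4 = map (\<lambda>k. (src k, map (\<lambda>r. (Fan r k, Duo ((r - 1) * K + k))) [1..<R])) [0..<B]"

text \<open>The Bell pairs for the copies of the monomials do not depend on the inputs, so their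
  preparation shares its layers with the first level of conjunctions.\<close>

definition S4 :: "(nat \<times> op) list" where "S4 = lchains T2 (T2 + 1) T4 chs4"

text \<open>The summand \<open>T4\<close> keeps this stage behind the conjunctions even if
  \<open>S4\<close> is empty, which happens when there is only one block.\<close>

definition T5 :: nat where "T5 = T4 + tend S4"

definition tgt :: "nat \<Rightarrow> nat \<Rightarrow> lab" where
  "tgt p k = (if A (2 * p) k then if A (2 * p + 1) k then Duo p else Out (2 * p) else Out (2 * p + 1))"

text \<open>A cyclic Latin square. For a fixed pair different monomials get different slots, and for
  a fixed monomial different pairs of a block do. Blocks need not be kept apart, since they use
  their own copies.\<close>

definition slot :: "nat \<times> nat \<Rightarrow> nat" where "slot = (\<lambda>(p, k). (p mod K + k) mod K)"

definition pairs :: "(nat \<times> nat) list" where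
  "pairs = filter (\<lambda>(p, k). A (2 * p) k \<or> A (2 * p + 1) k) (List.product [0..<np] [0..<B])"

text \<open>The pairs are sorted by slot because \<open>sched\<close> asks the list order to agree
  with the stamps.\<close>

definition S5 :: "(nat \<times> op) list" where
  "S5 = map (\<lambda>a. (T5 + slot a, Gate (GCNOT (e (loc (fst a div K) (snd a))) (e (tgt (fst a) (snd a))))))
     (sort_key slot pairs)"

definition T6 :: nat where "T6 = T5 + K"

definition S6 :: "(nat \<times> op) list" where
  "S6 = map (\<lambda>p. (T6, Gate (GCNOT (e (Duo p)) (e (Out (2 * p)))))) [0..<m div 2]
      @ map (\<lambda>p. (T6 + 1, Gate (GCNOT (e (Duo p)) (e (Out (2 * p + 1)))))) [0..<m div 2]"

definition T7 :: nat where "T7 = T6 + 2"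

text \<open>At this time \<open>Duo p\<close> is the parity of the monomials common to both outputs
  of the pair. They are all still present in the block of \<open>p\<close>, so they can serve as the
  corrections of \<open>xclear\<close>.\<close>

definition clD :: "(nat \<times> nat list) list" where
  "clD = map (\<lambda>p. (e (Duo p), map (\<lambda>k. e (loc (p div K) k)) (filter (\<lambda>k. A (2 * p) k \<and> A (2 * p + 1) k) [0..<B])))
     [0..<m div 2]"

definition clF :: "(nat \<times> nat list) list" where
  "clF = map (\<lambda>a. (e (Fan (fst a) (snd a)), [e (src (snd a))])) (List.product [1..<R] [0..<B])"

definition flips :: "op list" where
  "flips = concat (map (\<lambda>j. map Gate (Xg (e (Out j)))) (filter c0 [0..<m]))"

definition ops7 :: "op list" where
  "ops7 = concat (map (\<lambda>(q, fs). xclear q fs) clD) @ concat (map (\<lambda>(q, fs). xclear q fs) clF) @ flips"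

text \<open>One operation per layer is affordable, as this stage contains neither T gates nor
  CNOTs.\<close>

definition S7 :: "(nat \<times> op) list" where "S7 = seqt T7 ops7"

definition T8 :: nat where "T8 = T7 + length ops7"

definition S8 :: "(nat \<times> op) list" where
  "S8 = concat (map (\<lambda>j. concat (map (unand_gate (T8 + 9 * (L - 1 - j))) (map et (rev (level n j))))) (rev [0..<L]))"

definition T9 :: nat where "T9 = T8 + 9 * L"

definition clC :: "(nat \<times> nat list) list" where
  "clC = concat (map (\<lambda>i. map (\<lambda>l. (e (Copy l i), [e (In i)])) (cps i)) [0..<n])"

definition S9 :: "(nat \<times> op) list" where "S9 = seqt T9 (concat (map (\<lambda>(q, fs). xclear q fs) clC))"

definition prog :: "(nat \<times> op) list" where
  "prog = S1 @ S2 @ S4 @ S5 @ S6 @ S7 @ S8 @ S9"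

section \<open>Disjointness of the qubits used within a stage\<close>

lemma K_pos: "0 < K"
  using B_le_K B_pos by linarith

lemma src_cases:
  assumes "k < B"
  shows "(\<exists>i<n. monomials n ! k = [i] \<and> src k = In i) \<or>
    (\<exists>b. 1 < length (monomials n ! k) \<and> src k = Node (monomials n ! k) b \<and> Node (monomials n ! k) b \<in> set ancs)"
proof -
  let ?l = "monomials n ! k"
  have l: "?l \<in> set (monomials n)" using assms by (simp add: B_def)
  then have s: "set ?l \<subseteq> {..<n}" "?l \<noteq> []" using set_monomials by blast+
  from root_cases[OF s(2), of L n] L1
  consider "length ?l = 1" "src k = In (hd ?l)" | b where "1 < length ?l" "b \<in> set (tl ?l)" "src k = Node ?l b"
    unfolding src_def by auto
  then show ?thesis
  proof cases
    case 1
    then obtain i where "?l = [i]" by (auto simp: length_Suc_conv)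
    with 1 s show ?thesis by auto
  next
    case 2
    then show ?thesis using l by (auto simp: in_ancs)
  qed
qed

lemma in_labs:
  "Copy l i \<in> labs \<longleftrightarrow> l \<in> set (monomials n) \<and> i \<in> set l \<and> 1 < length l \<and> l \<noteq> [0..<n]"
  "Help l i \<in> labs \<longleftrightarrow> l \<in> set (monomials n) \<and> i \<in> set l \<and> 1 < length l"
  "Node l i \<in> labs \<longleftrightarrow> l \<in> set (monomials n) \<and> i \<in> set (tl l)"
  "Duo p \<in> labs \<longleftrightarrow> p < np"
  "Fan r k \<in> labs \<longleftrightarrow> 1 \<le> r \<and> r < R \<and> k < B"
  "In i \<in> labs \<longleftrightarrow> i < n" "Out j \<in> labs \<longleftrightarrow> j < m"
  unfolding labs_def by (auto simp: in_ancs)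

lemma src_labs: "k < B \<Longrightarrow> src k \<in> labs"
  using src_cases[of k] by (auto simp: labs_def)

lemma src_neq:
  assumes "k < B"
  shows "src k \<noteq> Fan r k'" "src k \<noteq> Duo p" "src k \<noteq> Out j" "src k \<noteq> Copy l i" "src k \<noteq> Help l i"
    "Fan r k' \<noteq> src k" "Duo p \<noteq> src k" "Out j \<noteq> src k"
  using src_cases[OF assms] by auto

lemma src_inj:
  assumes "k < B" "k' < B" "src k = src k'"
  shows "k = k'"
proof -
  have "monomials n ! k = monomials n ! k'"
    using src_cases[OF assms(1)] src_cases[OF assms(2)] assms(3) by auto
  then show ?thesis
    using distinct_monomials[of n] assms(1,2) by (simp add: nth_eq_iff_index_eq B_def)
qed

lemma R_bound: "r < R \<Longrightarrow> r * K < np"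
proof -
  assume "r < R"
  then have "r * K \<le> (np - 1) div K * K" by (simp add: R_def)
  also have "\<dots> \<le> np - 1" by simp
  finally show ?thesis using np_pos by linarith
qed

lemma helper_bound: "1 \<le> r \<Longrightarrow> r < R \<Longrightarrow> k < B \<Longrightarrow> (r - 1) * K + k < np"
proof -
  assume r: "1 \<le> r" "r < R" "k < B"
  then have "(r - 1) * K + k < (r - 1) * K + K" using B_le_K by linarith
  also have "\<dots> = r * K" using r(1) by (cases r) auto
  finally show ?thesis using R_bound[OF r(2)] by linarith
qed

lemma block_lt_R: "p < np \<Longrightarrow> p div K < R"
  unfolding R_def using div_le_mono[of p "np - 1" K] by linarith

lemma loc_labs: "r < R \<Longrightarrow> k < B \<Longrightarrow> loc r k \<in> labs"
  using src_labs by (auto simp: loc_def labs_def in_ancs)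

lemma loc_neq: "k < B \<Longrightarrow> loc r k \<noteq> Out j" "k < B \<Longrightarrow> loc r k \<noteq> Duo p"
  using src_neq by (auto simp: loc_def)

lemma loc_inj: "k < B \<Longrightarrow> k' < B \<Longrightarrow> loc r k = loc r' k' \<Longrightarrow> r = r' \<and> k = k'"
  unfolding loc_def using src_neq src_inj by (cases "r = 0"; cases "r' = 0") auto

lemma distinct_chs1: "distinct (concat (map chain_qubits chs1))"
proof -
  let ?G = "\<lambda>i. In i # map (\<lambda>l. Copy l i) (cps i) @ map (\<lambda>l. Help l i) (cps i)"
  have eq: "map chain_qubits chs1 = map ?G [0..<n]"
    by (simp add: chs1_def o_def)
  show ?thesis
    unfolding eq distinct_concat_map
    by (intro conjI ballI sorted_wrt_distinct)
      (auto simp: distinct_map inj_on_def distinct_cps)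
qed

lemma helper_inj:
  assumes "k < B" "k' < B" "1 \<le> r" "1 \<le> r'" "(r - 1) * K + k = (r' - 1) * K + k'"
  shows "r = r' \<and> k = k'"
proof -
  have k: "k < K" "k' < K" using assms(1,2) B_le_K by linarith+
  have "((r - 1) * K + k) div K = ((r' - 1) * K + k') div K" "((r - 1) * K + k) mod K = ((r' - 1) * K + k') mod K"
    using assms(5) by simp_all
  then show ?thesis using k assms(3,4) by simp
qed

lemma distinct_chs4: "distinct (concat (map chain_qubits chs4))"
proof -
  let ?G = "\<lambda>k. src k # map (\<lambda>r. Fan r k) [1..<R] @ map (\<lambda>r. Duo ((r - 1) * K + k)) [1..<R]"
  have eq: "map chain_qubits chs4 = map ?G [0..<B]"
    by (simp add: chs4_def o_def)
  show ?thesis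
    unfolding eq distinct_concat_map
  proof (intro conjI ballI sorted_wrt_distinct)
    fix k assume k: "k \<in> set [0..<B]"
    have "inj_on (\<lambda>r. Duo ((r - 1) * K + k)) (set [1..<R])"
      using helper_inj[of k k] k by (auto simp: inj_on_def)
    moreover have "inj_on (\<lambda>r. Fan r k) (set [1..<R])" by (auto simp: inj_on_def)
    ultimately have "distinct (map (\<lambda>r. Fan r k) [1..<R])" "distinct (map (\<lambda>r. Duo ((r - 1) * K + k)) [1..<R])"
      by (simp_all only: distinct_map distinct_upt simp_thms)
    then show "distinct (?G k)"
      using k by (auto simp: src_neq)
  next
    fix k k' assume k: "k \<in> set [0..<B]" "k' \<in> set [0..<B]" "k \<noteq> k'"
    have s: "src k \<noteq> src k'" using src_inj[of k k'] k by auto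
    have d: "(r - 1) * K + k \<noteq> (r' - 1) * K + k'" if "1 \<le> r" "1 \<le> r'" for r r'
      using helper_inj[of k k' r r'] k that by auto
    show "set (?G k) \<inter> set (?G k') = {}"
      using k s d by (auto simp: src_neq)
  qed simp
qed

lemma chs1_labs: "set (concat (map chain_qubits chs1)) \<subseteq> labs"
proof -
  have "map chain_qubits chs1 = map (\<lambda>i. In i # map (\<lambda>l. Copy l i) (cps i) @ map (\<lambda>l. Help l i) (cps i)) [0..<n]"
    by (simp add: chs1_def o_def)
  then show ?thesis by (auto simp: in_labs set_cps)
qed

lemma chs4_labs: "set (concat (map chain_qubits chs4)) \<subseteq> labs"
proof -
  have "map chain_qubits chs4 = map (\<lambda>k. src k # map (\<lambda>r. Fan r k) [1..<R] @ map (\<lambda>r. Duo ((r - 1) * K + k)) [1..<R]) [0..<B]"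
    by (simp add: chs4_def o_def)
  then show ?thesis using helper_bound by (auto simp: src_labs in_labs)
qed

lemma set_pairs: "(p, k) \<in> set pairs \<longleftrightarrow> p < np \<and> k < B \<and> (A (2 * p) k \<or> A (2 * p + 1) k)"
  by (auto simp: pairs_def)

lemma A_less: "A j k \<Longrightarrow> j < m"
  using A by (meson not_le_imp_less)

lemma tgt_labs: "(p, k) \<in> set pairs \<Longrightarrow> tgt p k \<in> labs"
  using A_less[of "2 * p" k] A_less[of "2 * p + 1" k] by (auto simp: set_pairs tgt_def labs_def in_ancs)

lemma tgt_cases: "tgt p k \<in> {Duo p, Out (2 * p), Out (2 * p + 1)}"
  by (simp add: tgt_def)

lemma tgt_inj: "tgt p k = tgt p' k' \<Longrightarrow> p = p'"
proof -
  assume "tgt p k = tgt p' k'"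
  then consider "p = p'" | "2 * p = 2 * p' + 1" | "2 * p + 1 = 2 * p'"
    using tgt_cases[of p k] tgt_cases[of p' k'] by auto
  then show ?thesis by cases presburger+
qed

lemma slot_eq:
  assumes "slot (p, k) = slot (p', k')" "k < B" "k' < B"
  shows "k = k' \<Longrightarrow> p mod K = p' mod K" "p = p' \<Longrightarrow> k = k'"
proof -
  have k: "k < K" "k' < K" using assms(2,3) B_le_K by linarith+
  have *: "x = x'" if "(x + y) mod K = (x' + y) mod K" "x < K" "x' < K" for x x' y
  proof -
    have le: "u = w" if "(u + y) mod K = (w + y) mod K" "u \<le> w" "w < K" for u w
    proof -
      have "K dvd (w + y) - (u + y)"
        using mod_eq_dvd_iff_nat[of "u + y" "w + y" K] that by simp
      then have "K dvd w - u" by simp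
      then show ?thesis using that(2,3) nat_dvd_not_less[of "w - u" K] by (cases "u = w") auto
    qed
    show ?thesis using that le[of x x'] le[of x' x] by (cases "x \<le> x'") auto
  qed
  show "p mod K = p' mod K" if "k = k'"
    using assms(1) that *[of "p mod K" k "p' mod K"] K_pos by (simp add: slot_def)
  show "k = k'" if "p = p'"
    using assms(1) that *[of k "p mod K" k'] k by (simp add: slot_def add.commute)
qed

section \<open>Layer windows and the schedule of the whole circuit\<close>

lemma S1_times: "a \<in> set S1 \<Longrightarrow> fst a < T2"
  by (simp add: T2_def tend)

lemma S2_times: "a \<in> set S2 \<Longrightarrow> T2 \<le> fst a \<and> fst a < T4"
proof -
  assume "a \<in> set S2"
  then have "a \<in> (\<Union>j\<in>{0..<L}. set (concat (map (and_gate (T2 + 20 * j)) (map et (level n j)))))"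
    unfolding S2_def by (simp only: set_concat set_map image_image set_upt)
  then obtain j where j: "j < L" "a \<in> set (concat (map (and_gate (T2 + 20 * j)) (map et (level n j))))"
    by (meson UN_E atLeastLessThan_iff)
  from and_gates_times[OF j(2)] have "T2 + 20 * j \<le> fst a" "fst a < T2 + 20 * j + 20" by blast+
  then show ?thesis using j(1) unfolding T4_def by linarith
qed

lemma S4_times: "a \<in> set S4 \<Longrightarrow> fst a < T5"
  using tend[of a S4] by (simp add: T5_def)

lemma slot_less: "slot a < K"
  using K_pos by (simp add: slot_def case_prod_unfold)

lemma S5_times: "a \<in> set S5 \<Longrightarrow> T5 \<le> fst a \<and> fst a < T6"
  using slot_less by (auto simp: S5_def T6_def)

lemma S6_times: "a \<in> set S6 \<Longrightarrow> T6 \<le> fst a \<and> fst a < T7"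
  by (auto simp: S6_def T7_def)

lemma S7_times: "a \<in> set S7 \<Longrightarrow> T7 \<le> fst a \<and> fst a < T8"
  using set_seqt[of "fst a" "snd a" T7 ops7] by (simp add: S7_def T8_def)

lemma S8_times: "a \<in> set S8 \<Longrightarrow> T8 \<le> fst a \<and> fst a < T9"
proof -
  assume "a \<in> set S8"
  then have "a \<in> (\<Union>j\<in>{0..<L}. set (concat (map (unand_gate (T8 + 9 * (L - 1 - j))) (map et (rev (level n j))))))"
    unfolding S8_def by (simp only: set_concat set_map image_image set_upt set_rev)
  then obtain j where j: "j < L" "a \<in> set (concat (map (unand_gate (T8 + 9 * (L - 1 - j))) (map et (rev (level n j)))))"
    by (meson UN_E atLeastLessThan_iff)
  from unand_gates_times[OF j(2)] have "T8 + 9 * (L - 1 - j) \<le> fst a" "fst a < T8 + 9 * (L - 1 - j) + 9" by blast+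
  then show ?thesis using j(1) unfolding T9_def by linarith
qed

lemma S9_times: "a \<in> set S9 \<Longrightarrow> T9 \<le> fst a"
  using set_seqt[of "fst a" "snd a" T9] by (simp add: S9_def)

lemma sched_S1: "sched S1"
  unfolding S1_def by (rule sched_lchains[OF distinct_chs1]) auto

lemma T2_T4: "T2 + 1 < T4"
  using L1 by (simp add: T4_def)

lemma sched_S4: "sched S4"
  unfolding S4_def by (rule sched_lchains[OF distinct_chs4]) (use T2_T4 in auto)

lemma sched_S2: "sched S2"
  unfolding S2_def
proof (rule sched_concat_times)
  show "sorted_wrt (\<lambda>i j. \<forall>a\<in>set (concat (map (and_gate (T2 + 20 * i)) (map et (level n i)))).
      \<forall>b\<in>set (concat (map (and_gate (T2 + 20 * j)) (map et (level n j)))). fst a < fst b) [0..<L]"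
  proof (rule sorted_wrt_mono_rel[OF _ sorted_wrt_upt], intro ballI)
    fix i j a b assume ij: "i < j" and a: "a \<in> set (concat (map (and_gate (T2 + 20 * i)) (map et (level n i))))"
      and b: "b \<in> set (concat (map (and_gate (T2 + 20 * j)) (map et (level n j))))"
    have "fst a < T2 + 20 * i + 20" "T2 + 20 * j \<le> fst b"
      using and_gates_times[OF a] and_gates_times[OF b] by blast+
    then show "fst a < fst b" using ij by linarith
  qed
qed (rule sched_and_level)

lemma sched_S8: "sched S8"
  unfolding S8_def
proof (rule sched_concat_times)
  let ?G = "\<lambda>j. concat (map (unand_gate (T8 + 9 * (L - 1 - j))) (map et (rev (level n j))))"
  show "sorted_wrt (\<lambda>i j. \<forall>a\<in>set (?G i). \<forall>b\<in>set (?G j). fst a < fst b) (rev [0..<L])"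
    unfolding sorted_wrt_rev
  proof (rule sorted_wrt_mono_rel[OF _ sorted_wrt_upt], intro ballI)
    fix i j a b assume ij: "i \<in> set [0..<L]" "j \<in> set [0..<L]" "i < j" and a: "a \<in> set (?G j)" and b: "b \<in> set (?G i)"
    have "fst a < T8 + 9 * (L - 1 - j) + 9" "T8 + 9 * (L - 1 - i) \<le> fst b"
      using unand_gates_times[OF a] unand_gates_times[OF b] by blast+
    moreover have "L - 1 - j + 1 \<le> L - 1 - i" using ij by auto
    ultimately show "fst a < fst b" by linarith
  qed
qed (rule sched_unand_level)

lemma distinct_pairs: "distinct pairs"
  unfolding pairs_def by (intro distinct_filter distinct_product distinct_upt)

text \<open>Controls and targets are disjoint kinds of qubits. A common control determines the block
  and the monomial, a common target determines the pair; the equal slot then determines the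
  rest.\<close>

lemma ring_conflict:
  assumes "(p, k) \<in> set pairs" "(p', k') \<in> set pairs" "slot (p, k) = slot (p', k')"
    "{loc (p div K) k, tgt p k} \<inter> {loc (p' div K) k', tgt p' k'} \<noteq> {}"
  shows "p = p' \<and> k = k'"
proof -
  have k: "k < B" "k' < B" using assms(1,2) by (simp_all add: set_pairs)
  have 1: "loc (p div K) k \<noteq> tgt p' k'" "loc (p' div K) k' \<noteq> tgt p k"
    using loc_neq[OF k(1)] loc_neq[OF k(2)] tgt_cases[of p k] tgt_cases[of p' k'] by (metis empty_iff insert_iff)+
  from assms(4) 1 have "loc (p div K) k = loc (p' div K) k' \<or> tgt p k = tgt p' k'"
    by auto
  then show ?thesis
  proof
    assume "loc (p div K) k = loc (p' div K) k'"
    then have *: "p div K = p' div K" "k = k'" using loc_inj[OF k] by blast+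
    then have "p mod K = p' mod K" using slot_eq(1)[OF assms(3) k] by simp
    with * show ?thesis by (metis div_mult_mod_eq)
  next
    assume "tgt p k = tgt p' k'"
    then have "p = p'" by (rule tgt_inj)
    then show ?thesis using slot_eq(2)[OF assms(3) k] by simp
  qed
qed

definition ring_op :: "nat \<times> nat \<Rightarrow> nat \<times> op" where
  "ring_op a = (T5 + slot a, Gate (GCNOT (e (loc (fst a div K) (snd a))) (e (tgt (fst a) (snd a)))))"

lemma S5_eq: "S5 = map ring_op (sort_key slot pairs)"
  by (simp add: S5_def ring_op_def[abs_def])

lemma ring_op_conflict:
  assumes "x \<in> set pairs" "y \<in> set pairs" "slot x \<le> slot y" "x \<noteq> y"
    "op_qubits (snd (ring_op x)) \<inter> op_qubits (snd (ring_op y)) \<noteq> {}"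
  shows "fst (ring_op x) < fst (ring_op y)"
proof -
  have *: "(fst x, snd x) \<in> set pairs" "(fst y, snd y) \<in> set pairs" using assms(1,2) by simp_all
  have q: "op_qubits (snd (ring_op a)) = e ` {loc (fst a div K) (snd a), tgt (fst a) (snd a)}" for a
    by (simp add: ring_op_def)
  have "{loc (fst x div K) (snd x), tgt (fst x) (snd x)} \<inter> {loc (fst y div K) (snd y), tgt (fst y) (snd y)} \<noteq> {}"
    using assms(5) unfolding q image_Int[OF inj_e, symmetric] by blast
  then have "slot x \<noteq> slot y"
    using ring_conflict[OF *] assms(4) by (metis prod.collapse)
  then show ?thesis using assms(3) by (simp add: ring_op_def)
qed

lemma sched_S5: "sched S5"
proof -
  have s: "sorted_wrt (\<lambda>x y. slot x \<le> slot y) (sort_key slot pairs)"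
    using sorted_sort_key[of slot pairs] unfolding sorted_map .
  have d: "distinct (sort_key slot pairs)" using distinct_pairs by (simp only: distinct_sort)
  have sd: "sorted_wrt (\<lambda>x y. slot x \<le> slot y \<and> x \<noteq> y) (sort_key slot pairs)"
    by (rule sorted_wrt_conj[OF s sorted_wrt_neq[OF d]])
  show ?thesis
    unfolding S5_eq
  proof (rule sched_map[OF sd])
    fix x y assume "x \<in> set (sort_key slot pairs)" "y \<in> set (sort_key slot pairs)" "slot x \<le> slot y \<and> x \<noteq> y"
      and o: "op_qubits (snd (ring_op x)) \<inter> op_qubits (snd (ring_op y)) \<noteq> {}"
    then have "x \<in> set pairs" "y \<in> set pairs" "slot x \<le> slot y" "x \<noteq> y" by simp_all
    then show "fst (ring_op x) < fst (ring_op y)" using o by (rule ring_op_conflict)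
  qed
qed

lemma sched_S6: "sched S6"
  unfolding S6_def
proof (rule sched_append_times)
  show "sched (map (\<lambda>p. (T6, Gate (GCNOT (e (Duo p)) (e (Out (2 * p)))))) [0..<m div 2])"
    by (rule sched_map[OF sorted_wrt_neq]) auto
  show "sched (map (\<lambda>p. (T6 + 1, Gate (GCNOT (e (Duo p)) (e (Out (2 * p + 1)))))) [0..<m div 2])"
    by (rule sched_map[OF sorted_wrt_neq]) auto
qed auto

lemma qubits_early:
  assumes "a \<in> set S1 \<union> set S2"
  shows "op_qubits (snd a) \<inter> e ` late = {}"
  using assms
proof
  assume "a \<in> set S1"
  then have "op_qubits (snd a) \<subseteq> qubits S1" by (auto simp: qubits_def)
  also have "\<dots> \<subseteq> (\<Union>c\<in>set (map (\<lambda>(s, l). (e s, map (map_prod e e) l)) chs1). set (chain_qubits c))"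
    unfolding S1_def lchains_def qubits_concat by (intro UN_mono subset_refl qubits_chain)
  also have "\<dots> = set (concat (map chain_qubits (map (\<lambda>(s, l). (e s, map (map_prod e e) l)) chs1)))"
    by (simp only: set_concat set_map image_image)
  also have "\<dots> = e ` set (concat (map chain_qubits chs1))"
    by (simp only: concat_chain_qubits_map set_map)
  finally have 1: "op_qubits (snd a) \<subseteq> e ` set (concat (map chain_qubits chs1))" .
  have "map chain_qubits chs1 = map (\<lambda>i. In i # map (\<lambda>l. Copy l i) (cps i) @ map (\<lambda>l. Help l i) (cps i)) [0..<n]"
    by (simp add: chs1_def o_def)
  then have 2: "set (concat (map chain_qubits chs1)) \<inter> late = {}" by auto
  have "op_qubits (snd a) \<inter> e ` late \<subseteq> e ` set (concat (map chain_qubits chs1)) \<inter> e ` late"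
    using 1 by (rule Int_mono) simp
  also have "\<dots> = {}" unfolding image_Int[OF inj_e, symmetric] 2 by simp
  finally show ?thesis by simp
next
  assume "a \<in> set S2"
  then obtain j t where j: "t \<in> set (level n j)" "a \<in> set (and_gate (T2 + 20 * j) (et t))"
    unfolding S2_def by auto
  obtain x y z h where t: "t = (x, y, z, h)" by (cases t)
  have "op_qubits (snd a) \<subseteq> e ` {x, y, z, h}"
    using j(2) qubits_and_gate[of "T2 + 20 * j" "e x" "e y" "e z" "e h"] unfolding t et_def qubits_def by auto
  then have "op_qubits (snd a) \<inter> e ` late \<subseteq> e ` {x, y, z, h} \<inter> e ` late"
    by (rule Int_mono) simp
  also have "\<dots> = {}"
    unfolding image_Int[OF inj_e, symmetric] level_labs(6)[OF j(1)[unfolded t]] by simp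
  finally show ?thesis by simp
qed

lemma sched_prog: "sched prog"
proof -
  have 4: "sched (S1 @ S2)"
    by (rule sched_append_times[OF sched_S1 sched_S2]) (use S1_times S2_times in fastforce)
  \<comment> \<open>The only stage that overlaps earlier ones in time. Its operations before
    \<open>T4\<close> stay within \<open>late\<close>, which \<open>S1\<close> and \<open>S2\<close>
    avoid.\<close>
  have 5: "sched ((S1 @ S2) @ S4)"
    unfolding sched_append[of "S1 @ S2"]
  proof (intro conjI ballI impI 4 sched_S4)
    fix a b assume a: "a \<in> set (S1 @ S2)" and b: "b \<in> set S4"
      and ne: "op_qubits (snd a) \<inter> op_qubits (snd b) \<noteq> {}"
    have "(\<Union>(s, l)\<in>set chs4. set (map fst l @ map snd l)) \<subseteq> late"
      by (auto simp: chs4_def)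
    then have "e ` (\<Union>(s, l)\<in>set chs4. set (map fst l @ map snd l)) \<subseteq> e ` late" by (rule image_mono)
    moreover have "op_qubits (snd a) \<inter> e ` late = {}"
      by (rule qubits_early) (use a in simp)
    ultimately have "\<not> op_qubits (snd b) \<subseteq> e ` (\<Union>(s, l)\<in>set chs4. set (map fst l @ map snd l))" using ne by blast
    then have "T4 \<le> fst b"
      using lchains_times[of "fst b" "snd b" T2 "T2 + 1" T4 chs4] b by (auto simp: S4_def)
    moreover have "fst a < T4"
      using a S1_times[of a] S2_times[of a] T2_T4 by auto
    ultimately show "fst a < fst b" by linarith
  qed
  have b5: "fst a < T5" if "a \<in> set ((S1 @ S2) @ S4)" for a
    using that S1_times[of a] S2_times[of a] S4_times[of a] T2_T4 by (auto simp: T5_def)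
  have 6: "sched (S8 @ S9)"
    by (rule sched_append_times[OF sched_S8]) (use S8_times S9_times in \<open>fastforce simp: S9_def sched_seqt\<close>)+
  have t: "T5 \<le> T6" "T6 \<le> T7" "T7 \<le> T8" "T8 \<le> T9" by (simp_all add: T6_def T7_def T8_def T9_def)
  have b8: "T8 \<le> fst a" if "a \<in> set (S8 @ S9)" for a
    using that S8_times[of a] S9_times[of a] t by auto
  have 7: "sched (S7 @ S8 @ S9)"
    by (rule sched_append_times[OF _ 6]) (use S7_times b8 in \<open>fastforce simp: S7_def sched_seqt\<close>)+
  have b7: "T7 \<le> fst a" if "a \<in> set (S7 @ S8 @ S9)" for a
    using that S7_times[of a] b8[of a] t by auto
  have 8: "sched (S6 @ S7 @ S8 @ S9)"
    by (rule sched_append_times[OF sched_S6 7]) (use S6_times b7 in fastforce)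
  have b6: "T6 \<le> fst a" if "a \<in> set (S6 @ S7 @ S8 @ S9)" for a
    using that S6_times[of a] b7[of a] t by auto
  have 9: "sched (S5 @ S6 @ S7 @ S8 @ S9)"
    by (rule sched_append_times[OF sched_S5 8]) (use S5_times b6 in fastforce)
  have b5': "T5 \<le> fst a" if "a \<in> set (S5 @ S6 @ S7 @ S8 @ S9)" for a
    using that S5_times[of a] b6[of a] t by auto
  have "sched (((S1 @ S2) @ S4) @ (S5 @ S6 @ S7 @ S8 @ S9))"
    by (rule sched_append_times[OF 5 9]) (use b5 b5' in fastforce)
  then show ?thesis by (simp add: prog_def)
qed

end

context mono_circuit
begin

section \<open>Well-formedness, causality and distinct classical bits\<close>

lemma wf_S2: "wf_ops (e ` labs) S2"
  unfolding S2_def wf_ops_concat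
proof (intro ballI)
  fix j a assume a: "a \<in> set (map et (level n j))"
  then obtain t where t: "t \<in> set (level n j)" "a = et t" unfolding set_map by blast
  obtain x y z h where f: "t = (x, y, z, h)" by (cases t)
  note l = level_labs[OF t(1)[unfolded f]]
  show "wf_ops (e ` labs) (and_gate (T2 + 20 * j) a)"
    unfolding t(2) f et_def prod.case by (rule wf_and_gate) (use l in auto)
qed

lemma wf_S8: "wf_ops (e ` labs) S8"
  unfolding S8_def wf_ops_concat
proof (intro ballI)
  fix j a assume a: "a \<in> set (map et (rev (level n j)))"
  then obtain t where t: "t \<in> set (level n j)" "a = et t" unfolding set_map set_rev by blast
  obtain x y z h where f: "t = (x, y, z, h)" by (cases t)
  note l = level_labs[OF t(1)[unfolded f]]
  show "wf_ops (e ` labs) (unand_gate (T8 + 9 * (L - 1 - j)) a)"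
    unfolding t(2) f et_def prod.case by (rule wf_unand_gate) (use l in auto)
qed

lemma wf_S5: "wf_ops (e ` labs) S5"
  unfolding wf_ops_def
proof
  fix a assume "a \<in> set S5"
  then obtain x where x: "x \<in> set pairs" "a = ring_op x" unfolding S5_eq by auto
  obtain p k where pk: "x = (p, k)" by (cases x)
  have k: "p < np" "k < B" using x(1) by (simp_all add: pk set_pairs)
  have 1: "loc (p div K) k \<in> labs" by (rule loc_labs[OF block_lt_R[OF k(1)] k(2)])
  have 2: "tgt p k \<in> labs" by (rule tgt_labs) (use x(1) pk in simp)
  have 3: "loc (p div K) k \<noteq> tgt p k"
    using loc_neq[OF k(2)] tgt_cases[of p k] by (metis empty_iff insert_iff)
  show "case a of (t, p) \<Rightarrow> op_ok p \<and> op_qubits p \<subseteq> e ` labs"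
    using 1 2 3 by (simp add: x(2) pk ring_op_def)
qed

lemma Duo_labs: "p < m div 2 \<Longrightarrow> Duo p \<in> labs"
  by (simp add: in_labs np_def)

lemma wf_S6: "wf_ops (e ` labs) S6"
proof -
  have "2 * p < m" "2 * p + 1 < m" if "p < m div 2" for p using that by linarith+
  then show ?thesis using Duo_labs by (auto simp: S6_def wf_ops_def in_labs)
qed

lemma op_xclears:
  assumes "p \<in> set (concat (map (\<lambda>(q, fs). xclear q fs) l))" "\<forall>(q, fs)\<in>set l. {q} \<union> set fs \<subseteq> S"
  shows "op_ok p \<and> op_qubits p \<subseteq> S"
proof -
  obtain q fs where "(q, fs) \<in> set l" "p \<in> set (xclear q fs)" using assms(1) by auto
  then show ?thesis using set_xclear[of p q fs] assms(2) by blast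
qed

lemma clD_labs: "\<forall>(q, fs)\<in>set clD. {q} \<union> set fs \<subseteq> e ` labs"
proof -
  have "loc (p div K) k \<in> labs" if "p < m div 2" "k < B" for p k
    by (rule loc_labs[OF block_lt_R that(2)]) (use Duo_labs[OF that(1)] in \<open>simp add: in_labs\<close>)
  then show ?thesis using Duo_labs unfolding clD_def by auto
qed

lemma clF_labs: "\<forall>(q, fs)\<in>set clF. {q} \<union> set fs \<subseteq> e ` labs"
  unfolding clF_def by (auto simp: in_labs src_labs)

lemma clC_labs: "\<forall>(q, fs)\<in>set clC. {q} \<union> set fs \<subseteq> e ` labs"
  unfolding clC_def by (auto simp: in_labs set_cps)

lemma flips_op:
  assumes "p \<in> set flips"
  shows "op_ok p \<and> op_qubits p \<subseteq> e ` labs \<and> \<not> is_T_op p \<and> \<not> is_CNOT_op p \<and> meas_bit p = None \<and> (\<forall>c g. p \<noteq> CGate c g)"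
proof -
  obtain j g where j: "j < m" "g \<in> set (Xg (e (Out j)))" "p = Gate g" using assms unfolding flips_def by auto
  then show ?thesis using set_Xg[OF j(2)] by (simp add: in_labs)
qed

lemma wf_S7: "wf_ops (e ` labs) S7"
  unfolding S7_def wf_ops_seqt
proof
  fix p assume "p \<in> set ops7"
  then consider "p \<in> set (concat (map (\<lambda>(q, fs). xclear q fs) clD))"
    | "p \<in> set (concat (map (\<lambda>(q, fs). xclear q fs) clF))" | "p \<in> set flips"
    unfolding ops7_def by auto
  then show "op_ok p \<and> op_qubits p \<subseteq> e ` labs"
  proof cases
    case 1
    then show ?thesis using clD_labs by (rule op_xclears)
  next
    case 2
    then show ?thesis using clF_labs by (rule op_xclears)
  next
    case 3
    then show ?thesis using flips_op by blast
  qed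
qed

lemma wf_S9: "wf_ops (e ` labs) S9"
  unfolding S9_def wf_ops_seqt using op_xclears[OF _ clC_labs] by blast

lemma wf_prog: "wf_ops (e ` labs) prog"
  unfolding prog_def wf_ops_simps
  using wf_lchains[OF distinct_chs1 chs1_labs] wf_lchains[OF distinct_chs4 chs4_labs]
    wf_S2 wf_S5 wf_S6 wf_S7 wf_S8 wf_S9
  by (simp add: S1_def S4_def)

lemma causal_xclears: "causal (seqt t (concat (map (\<lambda>(q, fs). xclear q fs) l)))"
proof (rule causal_seqt_concat)
  fix x :: "nat \<times> nat list" and t
  show "causal (seqt t (case x of (q, fs) \<Rightarrow> xclear q fs))" by (cases x) (simp add: causal_xclear)
qed

lemma causal_prog: "causal prog"
  unfolding prog_def
proof (intro causal_append)
  show "causal S1" "causal S4" unfolding S1_def S4_def by (rule causal_lchains)+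
  show "causal S2" unfolding S2_def by (intro causal_concat causal_and_gate)
  show "causal S5" by (rule causal_no_cgate) (auto simp: S5_eq ring_op_def)
  show "causal S6" by (rule causal_no_cgate) (auto simp: S6_def)
  show "causal S8" unfolding S8_def by (intro causal_concat causal_unand_gate)
  show "causal S9" unfolding S9_def by (rule causal_xclears)
  show "causal S7"
    unfolding S7_def ops7_def seqt_append
    by (intro causal_append causal_xclears causal_seqt_no_cgate) (use flips_op in blast)
qed

definition all_ands :: "(lab \<times> lab \<times> lab \<times> lab) list" where
  "all_ands = concat (map (level n) [0..<L])"

lemma meas_bits_xclears:
  "List.map_filter meas_bit (concat (map (\<lambda>(q, fs). xclear q fs) l)) = map (\<lambda>(q, fs). 2 * q + 1) l"
proof (induction l)
  case Nil
  then show ?case by (simp add: map_filter_def)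
next
  case (Cons a l)
  then show ?case by (cases a) (simp add: map_filter_xclear)
qed

lemma meas_bits_S2: "meas_bits S2 = map (\<lambda>a. 2 * e a + 1) (map (\<lambda>(x, y, z, h). h) all_ands)"
proof -
  have 1: "meas_bits (concat (map (and_gate \<tau>) (map et ts))) = map (\<lambda>a. 2 * e a + 1) (map (\<lambda>(x, y, z, h). h) ts)" for \<tau> ts
  proof (induction ts)
    case (Cons t ts)
    then show ?case by (cases t) (simp add: et_def meas_bits_and_gate)
  qed simp
  have "meas_bits (concat (map (\<lambda>j. concat (map (and_gate (f j)) (map et (level n j)))) js)) =
      map (\<lambda>a. 2 * e a + 1) (map (\<lambda>(x, y, z, h). h) (concat (map (level n) js)))" for f js
    by (induction js) (simp_all add: 1 del: map_map)
  then show ?thesis unfolding S2_def all_ands_def .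
qed

lemma meas_bits_S8: "meas_bits S8 = map (\<lambda>a. 2 * e a + 1) (map (\<lambda>(x, y, z, h). z) (rev all_ands))"
proof -
  have 1: "meas_bits (concat (map (unand_gate \<tau>) (map et ts))) = map (\<lambda>a. 2 * e a + 1) (map (\<lambda>(x, y, z, h). z) ts)" for \<tau> ts
  proof (induction ts)
    case (Cons t ts)
    then show ?case by (cases t) (simp add: et_def meas_bits_unand_gate)
  qed simp
  have "meas_bits (concat (map (\<lambda>j. concat (map (unand_gate (f j)) (map et (rev (level n j))))) js)) =
      map (\<lambda>a. 2 * e a + 1) (map (\<lambda>(x, y, z, h). z) (concat (map (\<lambda>j. rev (level n j)) js)))" for f js
    by (induction js) (simp_all add: 1 del: map_map)
  then show ?thesis unfolding S8_def all_ands_def by (simp add: rev_concat rev_map o_def)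
qed

lemma distinct_chain_helpers: "distinct (concat (map chain_qubits (lst :: (lab \<times> (lab \<times> lab) list) list))) \<Longrightarrow> distinct (concat (map (\<lambda>(s, l). map snd l) lst))"
  unfolding distinct_concat_map
proof (elim conjE, intro conjI ballI)
  assume "sorted_wrt (\<lambda>x y. set (chain_qubits x) \<inter> set (chain_qubits y) = {}) lst"
  then show "sorted_wrt (\<lambda>x y. set (case x of (s, l) \<Rightarrow> map snd l) \<inter> set (case y of (s, l) \<Rightarrow> map snd l) = {}) lst"
  proof (rule sorted_wrt_mono_rel[rotated])
    fix x y :: "lab \<times> (lab \<times> lab) list" assume xy: "set (chain_qubits x) \<inter> set (chain_qubits y) = {}"
    have "set (case x of (s, l) \<Rightarrow> map snd l) \<subseteq> set (chain_qubits x)" for x :: "lab \<times> (lab \<times> lab) list"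
      by (cases x) auto
    from Int_mono[OF this this, of x y]
    show "set (case x of (s, l) \<Rightarrow> map snd l) \<inter> set (case y of (s, l) \<Rightarrow> map snd l) = {}"
      unfolding xy subset_empty .
  qed
next
  fix x assume "\<forall>x\<in>set lst. distinct (chain_qubits x)" "x \<in> set lst"
  then have "distinct (chain_qubits x)" by blast
  then show "distinct (case x of (s, l) \<Rightarrow> map snd l)" by (cases x) simp
qed

lemma distinct_ands: "distinct (map (\<lambda>(x, y, z, h). z) all_ands)" "distinct (map (\<lambda>(x, y, z, h). h) all_ands)"
proof -
  have s: "sorted_wrt (\<lambda>(x, y, z, h) (x', y', z', h'). z' \<notin> {x, y, z}) all_ands"
    using fed_forward_levels[of n L] unfolding fed_forward_def all_ands_def by blast
  have zh: "\<exists>l b. z = Node l b \<and> h = Help l b" if "(x, y, z, h) \<in> set all_ands" for x y z h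
  proof -
    obtain j where "(x, y, z, h) \<in> set (level n j)" using \<open>_ \<in> set all_ands\<close> unfolding all_ands_def by auto
    from level_labs(7)[OF this] show ?thesis by blast
  qed
  have dw: "distinct (map f xs)" if "sorted_wrt (\<lambda>x y. f x \<noteq> f y) xs" for f :: "'x \<Rightarrow> 'y" and xs
    using that by (induction xs) auto
  show "distinct (map (\<lambda>(x, y, z, h). z) all_ands)"
    by (rule dw, rule sorted_wrt_mono_rel[OF _ s]) auto
  show "distinct (map (\<lambda>(x, y, z, h). h) all_ands)"
  proof (rule dw, rule sorted_wrt_mono_rel[OF _ s])
    fix a b assume ab: "a \<in> set all_ands" "b \<in> set all_ands" "(\<lambda>(x, y, z, h) (x', y', z', h'). z' \<notin> {x, y, z}) a b"
    obtain x y z h where a: "a = (x, y, z, h)" by (cases a)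
    obtain x' y' z' h' where b: "b = (x', y', z', h')" by (cases b)
    show "(case a of (x, y, z, h) \<Rightarrow> h) \<noteq> (case b of (x, y, z, h) \<Rightarrow> h)"
      using zh[OF ab(1)[unfolded a]] zh[OF ab(2)[unfolded b]] ab(3) unfolding a b by auto
  qed
qed

text \<open>Some qubits are measured twice, once as a Bell partner and once when cleared. The first
  kind of measurement of \<open>q\<close> uses the bit \<open>2 * q\<close>, the second
  \<open>2 * q + 1\<close>, so it remains to see that no qubit repeats within one kind.\<close>

lemma distinct_meas_bits: "distinct (meas_bits prog)"
proof -
  define M1 where "M1 = concat (map (\<lambda>(s, l). map snd l) chs1)"
  define M2 where "M2 = map (\<lambda>(x, y, z, h). h) all_ands"
  define M4 where "M4 = concat (map (\<lambda>(s, l). map snd l) chs4)"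
  define M7 where "M7 = map Duo [0..<m div 2] @ map (\<lambda>a. Fan (fst a) (snd a)) (List.product [1..<R] [0..<B])"
  define M8 where "M8 = map (\<lambda>(x, y, z, h). z) (rev all_ands)"
  define M9 where "M9 = concat (map (\<lambda>i. map (\<lambda>l. Copy l i) (cps i)) [0..<n])"
  let ?ev = "\<lambda>a. 2 * e a" and ?od = "\<lambda>a. 2 * e a + 1"
  have m5: "meas_bits S5 = []" "meas_bits S6 = []"
    by (simp_all add: meas_bits_def S5_eq S6_def ring_op_def map_filter_def)
  have m7: "meas_bits S7 = map ?od M7"
    unfolding S7_def meas_bits_seqt ops7_def map_filter_simp meas_bits_xclears M7_def
    using flips_op by (simp add: clD_def clF_def o_def map_filter_def filter_empty_conv)
  have m9: "meas_bits S9 = map ?od M9"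
    unfolding S9_def meas_bits_seqt meas_bits_xclears M9_def
    by (simp add: clC_def map_concat o_def)
  have eq: "meas_bits prog = map ?ev M1 @ map ?od M2 @ map ?ev M4 @ map ?od M7 @ map ?od M8 @ map ?od M9"
    unfolding prog_def meas_bits_simps m5 m7 m9 meas_bits_S2 meas_bits_S8 M2_def M8_def
    by (simp add: S1_def S4_def meas_bits_lchains M1_def M4_def del: map_map)
  have inj: "inj_on ?ev X" "inj_on ?od X" for X by (auto simp: inj_on_def)
  have sets: "set M1 \<subseteq> {a. \<exists>l i. a = Help l i}" "set M2 \<subseteq> {a. \<exists>l i. a = Help l i}" "set M4 \<subseteq> {a. \<exists>p. a = Duo p}"
    "set M7 \<subseteq> late" "set M8 \<subseteq> {a. \<exists>l i. a = Node l i}" "set M9 \<subseteq> {a. \<exists>l i. a = Copy l i}"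
  proof -
    show "set M1 \<subseteq> {a. \<exists>l i. a = Help l i}" unfolding M1_def chs1_def by auto
    show "set M4 \<subseteq> {a. \<exists>p. a = Duo p}" unfolding M4_def chs4_def by auto
    show "set M7 \<subseteq> late" unfolding M7_def by auto
    show "set M9 \<subseteq> {a. \<exists>l i. a = Copy l i}" unfolding M9_def by auto
    have "\<exists>l b. z = Node l b \<and> h = Help l b" if "(x, y, z, h) \<in> set all_ands" for x y z h
    proof -
      obtain j where "(x, y, z, h) \<in> set (level n j)" using \<open>_ \<in> set all_ands\<close> unfolding all_ands_def by auto
      from level_labs(7)[OF this] show ?thesis by blast
    qed
    then show "set M2 \<subseteq> {a. \<exists>l i. a = Help l i}" "set M8 \<subseteq> {a. \<exists>l i. a = Node l i}"
      unfolding M2_def M8_def by fastforce+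
  qed
  have d: "distinct M1" "distinct M2" "distinct M4" "distinct M7" "distinct M8" "distinct M9"
  proof -
    show "distinct M1" unfolding M1_def by (rule distinct_chain_helpers[OF distinct_chs1])
    show "distinct M4" unfolding M4_def by (rule distinct_chain_helpers[OF distinct_chs4])
    show "distinct M2" unfolding M2_def by (rule distinct_ands)
    show "distinct M8" unfolding M8_def rev_map[symmetric] distinct_rev by (rule distinct_ands)
    have "distinct (map (\<lambda>a. Fan (fst a) (snd a)) (List.product [1..<R] [0..<B]))"
      unfolding distinct_map by (intro conjI distinct_product distinct_upt) (auto simp: inj_on_def)
    then show "distinct M7" unfolding M7_def distinct_append by (auto simp: distinct_map inj_on_def)
    show "distinct M9"
      unfolding M9_def distinct_concat_map
      by (intro conjI ballI sorted_wrt_distinct) (auto simp: distinct_map distinct_cps inj_on_def)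
  qed
  have ed: "?ev ` X \<inter> ?od ` Y = {}" "?od ` X \<inter> ?ev ` Y = {}" for X Y
  proof -
    have "?ev a \<noteq> ?od b" for a b by presburger
    then show "?ev ` X \<inter> ?od ` Y = {}" "?od ` X \<inter> ?ev ` Y = {}" by (auto dest: sym)
  qed
  have oo: "?od ` X \<inter> ?od ` Y = {}" "?ev ` X \<inter> ?ev ` Y = {}" if "X \<inter> Y = {}" for X Y
    using that by auto
  have j: "set M1 \<inter> set M4 = {}" "set M2 \<inter> set M7 = {}" "set M2 \<inter> set M8 = {}" "set M2 \<inter> set M9 = {}"
    "set M7 \<inter> set M8 = {}" "set M7 \<inter> set M9 = {}" "set M8 \<inter> set M9 = {}"
    using sets unfolding late_def by blast+
  show ?thesis
    unfolding eq distinct_append distinct_map set_append set_map Int_Un_distrib ed oo[OF j(1)] oo[OF j(2)]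
      oo[OF j(3)] oo[OF j(4)] oo[OF j(5)] oo[OF j(6)] oo[OF j(7)]
    using d inj by simp
qed

end

lemma fed_forward_map:
  assumes "fed_forward ts" "inj f"
  shows "fed_forward (map (\<lambda>(x, y, z, h). (f x, f y, f z, f h)) ts)"
  unfolding fed_forward_def
proof
  show "\<forall>(x, y, z, h)\<in>set (map (\<lambda>(x, y, z, h). (f x, f y, f z, f h)) ts). distinct [x, y, z, h]"
    using assms by (auto simp: fed_forward_def inj_eq)
  have s: "sorted_wrt (\<lambda>(x, y, z, h) (x', y', z', h'). z' \<notin> {x, y, z}) ts"
    using assms(1) by (simp add: fed_forward_def)
  show "sorted_wrt (\<lambda>(x, y, z, h) (x', y', z', h'). z' \<notin> {x, y, z}) (map (\<lambda>(x, y, z, h). (f x, f y, f z, f h)) ts)"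
    unfolding sorted_wrt_map
    by (rule sorted_wrt_mono_rel[OF _ s]) (auto simp: inj_eq[OF assms(2)])
qed

lemma length_filter_product:
  assumes "distinct xs"
  shows "length (filter (\<lambda>(x, y). x = a \<and> Q y) (List.product xs ys)) = (if a \<in> set xs then length (filter Q ys) else 0)"
  using assms
proof (induction xs)
  case (Cons x xs)
  have "length (filter (\<lambda>(x, y). x = a \<and> Q y) (map (Pair x) ys)) = (if x = a then length (filter Q ys) else 0)"
    by (induction ys) auto
  then show ?case using Cons by (auto simp del: filter_map)
qed simp

lemma length_filter_sort_key: "length (filter Q (sort_key f xs)) = length (filter Q xs)"
proof -
  have "mset (filter Q (sort_key f xs)) = mset (filter Q xs)" by simp
  then show ?thesis by (metis size_mset)
qed

context mono_circuit
begin

lemma tuple_labs: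
  assumes "(x, y, z, h) \<in> set all_ands"
  shows "x \<notin> late" "y \<notin> late" "x \<noteq> Out j" "y \<noteq> Out j" "\<exists>l b. z = Node l b \<and> h = Help l b"
    "z \<in> set ancs" "h \<in> set ancs"
proof -
  obtain j where j: "(x, y, z, h) \<in> set (level n j)" using assms unfolding all_ands_def by auto
  note l = level_labs[OF j]
  show "x \<notin> late" "y \<notin> late" using l(6) by auto
  show "\<exists>l b. z = Node l b \<and> h = Help l b" "z \<in> set ancs" "h \<in> set ancs" using l(7) by blast+
  obtain l where m: "l \<in> set (monomials n)" "(x, y, z, h) \<in> set (tup l (stage n l j))"
    using j unfolding level_def by auto
  have "distinct l" using set_monomials[OF m(1)] by blast
  then have "x \<in> own n l" "y \<in> own n l" using snd_stage[of l n j] tup_stage(1,2)[OF m] by auto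
  then show "x \<noteq> Out j" "y \<noteq> Out j" for j using own_subset[of n l] by auto
qed

lemma map_snd_S2: "map snd S2 = concat (map (\<lambda>a. map snd (and_gate 0 a)) (map et all_ands))"
proof -
  have 1: "map snd (concat (map (and_gate \<tau>) ts)) = concat (map (\<lambda>a. map snd (and_gate 0 a)) ts)" for \<tau> ts
    by (induction ts) (simp_all add: map_snd_and_gate[of \<tau>])
  have "map snd (concat (map (\<lambda>j. concat (map (and_gate (f j)) (map et (level n j)))) js)) =
      concat (map (\<lambda>a. map snd (and_gate 0 a)) (map et (concat (map (level n) js))))" for f js
    by (induction js) (simp_all add: 1 del: map_map)
  then show ?thesis unfolding S2_def all_ands_def .
qed

lemma map_snd_S8: "map snd S8 = concat (map (\<lambda>a. map snd (unand_gate 0 a)) (rev (map et all_ands)))"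
proof -
  have 1: "map snd (concat (map (unand_gate \<tau>) ts)) = concat (map (\<lambda>a. map snd (unand_gate 0 a)) ts)" for \<tau> ts
    by (induction ts) (simp_all add: map_snd_unand_gate[of \<tau>])
  have "map snd (concat (map (\<lambda>j. concat (map (unand_gate (f j)) (map et (rev (level n j))))) js)) =
      concat (map (\<lambda>a. map snd (unand_gate 0 a)) (map et (concat (map (\<lambda>j. rev (level n j)) js))))" for f js
    by (induction js) (simp_all add: 1 del: map_map)
  moreover have "map et (concat (map (\<lambda>j. rev (level n j)) (rev [0..<L]))) = rev (map et all_ands)"
    by (simp add: all_ands_def rev_concat rev_map o_def map_concat)
  ultimately show ?thesis unfolding S8_def by metis
qed

lemma fed_forward_et: "fed_forward (map et all_ands)"
  using fed_forward_map[OF fed_forward_levels inj_e] unfolding all_ands_def et_def .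

lemma sends_flips:
  "distinct js \<Longrightarrow> sends o' (concat (map (\<lambda>j. map Gate (Xg (e (Out j)))) js)) b (\<lambda>q. b q \<noteq> (\<exists>j\<in>set js. q = e (Out j)))"
proof (induction js arbitrary: b)
  case Nil
  then show ?case using sends_Nil by simp
next
  case (Cons j js)
  let ?b = "b(e (Out j) := \<not> b (e (Out j)))"
  have 1: "sends o' (concat (map (\<lambda>j. map Gate (Xg (e (Out j)))) js)) ?b (\<lambda>q. ?b q \<noteq> (\<exists>j\<in>set js. q = e (Out j)))"
    by (rule Cons.IH) (use Cons.prems in simp)
  have 2: "(\<lambda>q. ?b q \<noteq> (\<exists>j\<in>set js. q = e (Out j))) = (\<lambda>q. b q \<noteq> (\<exists>j\<in>set (j # js). q = e (Out j)))"
    using Cons.prems by (auto simp: fun_eq_iff)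
  from sends_append[OF sends_X 1] show ?case
    unfolding 2 list.map concat.simps .
qed

end

section \<open>The state after each stage on a basis input\<close>

locale mono_run = mono_circuit +
  fixes o' :: "nat \<Rightarrow> bool" and b :: basis
  assumes zero: "\<And>a. a \<in> set ancs \<Longrightarrow> \<not> b (e a)"
begin

lemma inv_e [simp]: "inv e (e a) = a"
  by (rule inv_f_f[OF inj_e])

definition CopyS :: "lab set" where "CopyS = {a. \<exists>l i. a = Copy l i \<and> l \<in> set (cps i)}"

text \<open>States are indexed by qubit numbers, so the case distinction on labels goes through
  \<open>inv e\<close>; the default covers the constructors outside \<open>CopyS\<close>.\<close>

definition b1 :: basis where
  "b1 q = (if q \<in> e ` CopyS then (case inv e q of Copy l i \<Rightarrow> b (e (In i)) | _ \<Rightarrow> False) else b q)"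

lemma CopyS_simps [simp]:
  "Copy l i \<in> CopyS \<longleftrightarrow> l \<in> set (cps i)" "In i \<notin> CopyS" "Out j \<notin> CopyS" "Node l i \<notin> CopyS" "Help l i \<notin> CopyS"
  "Duo p \<notin> CopyS" "Fan r k \<notin> CopyS"
  by (auto simp: CopyS_def)

lemma b1_simps:
  "b1 (e (Copy l i)) = (if l \<in> set (cps i) then b (e (In i)) else b (e (Copy l i)))"
  "a \<notin> CopyS \<Longrightarrow> b1 (e a) = b (e a)" "q \<notin> range e \<Longrightarrow> b1 q = b q"
  by (auto simp: b1_def)

lemma cps_less: "l \<in> set (cps i) \<Longrightarrow> i < n"
  using set_monomials by (fastforce simp: set_cps)

lemma step1: "sends o' (map snd S1) b b1"
  unfolding S1_def
proof (rule sends_lchains[OF distinct_chs1])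
  fix s l q p assume "(s, l) \<in> set chs1" "(q, p) \<in> set l"
  then obtain i l' where i: "s = In i" "q = Copy l' i" "p = Help l' i" "l' \<in> set (cps i)"
    unfolding chs1_def by auto
  then have "q \<in> set ancs" "p \<in> set ancs" by (simp_all add: in_ancs set_cps)
  then show "\<not> b (e q) \<and> \<not> b (e p)" using zero by blast
  show "b1 (e q) = b (e s)" using i by (simp add: b1_simps)
next
  fix x assume *: "\<And>s l q p. (s, l) \<in> set chs1 \<Longrightarrow> (q, p) \<in> set l \<Longrightarrow> x \<noteq> e q"
  have "x \<notin> e ` CopyS"
  proof
    assume "x \<in> e ` CopyS"
    then obtain l i where li: "x = e (Copy l i)" "l \<in> set (cps i)" by (auto simp: CopyS_def)
    have "(In i, map (\<lambda>l. (Copy l i, Help l i)) (cps i)) \<in> set chs1"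
      using cps_less[OF li(2)] by (simp add: chs1_def)
    from *[OF this, of "Copy l i" "Help l i"] li show False by auto
  qed
  then show "b1 x = b x" by (simp add: b1_def)
qed

definition b2 :: basis where "b2 = fold and_val (map et all_ands) b1"

definition NodeS :: "lab set" where "NodeS = res ` set all_ands"

lemma res_et: "res ` set (map et all_ands) = e ` NodeS"
proof -
  have "res (et t) = e (res t)" for t by (cases t) (simp add: et_def)
  then show ?thesis unfolding NodeS_def set_map image_image by simp
qed

lemma NodeS_Node: "a \<in> NodeS \<Longrightarrow> \<exists>l i. a = Node l i \<and> a \<in> set ancs"
proof -
  assume "a \<in> NodeS"
  then obtain x y z h where t: "(x, y, z, h) \<in> set all_ands" "a = z" unfolding NodeS_def by auto
  then show ?thesis using tuple_labs(5,6)[OF t(1)] by auto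
qed

lemma step2: "sends o' (map snd S2) b1 b2"
  unfolding map_snd_S2 b2_def
proof (rule sends_ands[OF fed_forward_et])
  have "\<not> b1 (e z) \<and> \<not> b1 (e h) \<and> e h \<notin> e ` NodeS" if t: "(x, y, z, h) \<in> set all_ands" for x y z h
  proof -
    obtain l c where lc: "z = Node l c" "h = Help l c" using tuple_labs(5)[OF t] by blast
    have "\<not> b (e z)" "\<not> b (e h)" using zero tuple_labs(6,7)[OF t] by blast+
    moreover have "h \<notin> NodeS" using NodeS_Node[of h] lc(2) by auto
    ultimately show ?thesis using lc by (simp add: b1_simps)
  qed
  note tuple = this
  show "\<forall>(x, y, z, h)\<in>set (map et all_ands). \<not> b1 z \<and> \<not> b1 h \<and> h \<notin> res ` set (map et all_ands)"
    unfolding res_et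
  proof
    fix a assume "a \<in> set (map et all_ands)"
    then obtain t where t: "t \<in> set all_ands" "a = et t" unfolding set_map by blast
    obtain x y z h where f: "t = (x, y, z, h)" by (cases t)
    show "case a of (x, y, z, h) \<Rightarrow> \<not> b1 z \<and> \<not> b1 h \<and> h \<notin> e ` NodeS"
      using tuple[OF t(1)[unfolded f]] unfolding t(2) f et_def prod.case .
  qed
qed

lemma b2_outside: "q \<notin> e ` NodeS \<Longrightarrow> b2 q = b1 q"
  unfolding b2_def by (rule and_vals_outside) (simp only: res_et not_False_eq_True)

lemma b2_and: "(x, y, z, h) \<in> set all_ands \<Longrightarrow> b2 (e z) = (b2 (e x) \<and> b2 (e y))"
proof -
  assume "(x, y, z, h) \<in> set all_ands"
  then have "et (x, y, z, h) \<in> set (map et all_ands)" by simp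
  then have "(e x, e y, e z, e h) \<in> set (map et all_ands)" by (simp add: et_def)
  then show ?thesis unfolding b2_def by (rule and_vals[OF fed_forward_et])
qed

definition mv :: "nat \<Rightarrow> bool" where "mv k = (\<forall>i\<in>set (monomials n ! k). b (e (In i)))"

lemma b2_src:
  assumes "k < B"
  shows "b2 (e (src k)) = mv k"
proof -
  let ?l = "monomials n ! k"
  have l: "?l \<in> set (monomials n)" using assms by (simp add: B_def)
  then have l0: "?l \<noteq> []" "set ?l \<subseteq> {..<n}" "distinct ?l" using set_monomials by blast+
  have "length ?l \<le> 2 ^ L"
  proof -
    have "card (set ?l) \<le> card {..<n}" by (rule card_mono) (use l0 in auto)
    then show ?thesis using nL distinct_card[OF l0(3)] by simp
  qed
  have "(b2 \<circ> e) (root n L ?l) = (\<forall>q\<in>snd ` set (init n ?l). (b2 \<circ> e) q)"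
  proof (rule root_value[OF l0(1) \<open>length ?l \<le> 2 ^ L\<close>])
    fix j x y z h assume j: "j < L" "(x, y, z, h) \<in> set (tup ?l (stage n ?l j))"
    then have "(x, y, z, h) \<in> set (level n j)" using l unfolding level_def set_concat set_map by blast
    then have "(x, y, z, h) \<in> set all_ands" using j(1) unfolding all_ands_def by auto
    from b2_and[OF this] show "(b2 \<circ> e) z = ((b2 \<circ> e) x \<and> (b2 \<circ> e) y)" by simp
  qed
  moreover have "b2 (e (leaf n ?l i)) = b (e (In i))" if i: "i \<in> set ?l" for i
  proof (cases "?l = [0..<n] \<or> length ?l = 1")
    case True
    then have "leaf n ?l i = In i" by (simp add: leaf_def)
    moreover have "In i \<notin> NodeS" using NodeS_Node by blast
    ultimately show ?thesis by (simp add: b2_outside b1_simps)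
  next
    case False
    then have "leaf n ?l i = Copy ?l i" by (simp add: leaf_def)
    moreover have "1 < length ?l" using False l0(1) by (cases ?l) auto
    then have "?l \<in> set (cps i)" using False i l by (simp add: set_cps)
    moreover have "Copy ?l i \<notin> NodeS" using NodeS_Node by blast
    ultimately show ?thesis by (simp add: b2_outside b1_simps)
  qed
  ultimately show ?thesis by (simp add: src_def mv_def init_def)
qed

lemma b2_late:
  assumes "a \<in> late \<or> (\<exists>j. a = Out j) \<or> (\<exists>i. a = In i)"
  shows "b2 (e a) = b (e a)"
proof -
  have "a \<notin> NodeS" using assms NodeS_Node[of a] by auto
  moreover have "a \<notin> CopyS" using assms by (auto simp: CopyS_def)
  ultimately show ?thesis by (simp add: b2_outside b1_simps)
qed

definition FanS :: "lab set" where "FanS = {a. \<exists>r k. a = Fan r k \<and> 1 \<le> r \<and> r < R \<and> k < B}"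

definition b4 :: basis where
  "b4 q = (if q \<in> e ` FanS then (case inv e q of Fan r k \<Rightarrow> mv k | _ \<Rightarrow> False) else b2 q)"

lemma FanS_simps [simp]:
  "Fan r k \<in> FanS \<longleftrightarrow> 1 \<le> r \<and> r < R \<and> k < B" "In i \<notin> FanS" "Out j \<notin> FanS" "Node l i \<notin> FanS" "Help l i \<notin> FanS"
  "Duo p \<notin> FanS" "Copy l i \<notin> FanS"
  by (auto simp: FanS_def)

lemma b4_simps:
  "1 \<le> r \<Longrightarrow> r < R \<Longrightarrow> k < B \<Longrightarrow> b4 (e (Fan r k)) = mv k"
  "a \<notin> FanS \<Longrightarrow> b4 (e a) = b2 (e a)" "q \<notin> e ` FanS \<Longrightarrow> b4 q = b2 q"
  by (auto simp: b4_def)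

lemma step4: "sends o' (map snd S4) b2 b4"
  unfolding S4_def
proof (rule sends_lchains[OF distinct_chs4])
  fix s l q p assume "(s, l) \<in> set chs4" "(q, p) \<in> set l"
  then obtain r k where i: "s = src k" "q = Fan r k" "p = Duo ((r - 1) * K + k)" "1 \<le> r" "r < R" "k < B"
    unfolding chs4_def by auto
  then have "q \<in> set ancs" "p \<in> set ancs" using helper_bound by (simp_all add: in_ancs)
  then have "\<not> b (e q)" "\<not> b (e p)" using zero by blast+
  then show "\<not> b2 (e q) \<and> \<not> b2 (e p)" using i by (simp add: b2_late)
  show "b4 (e q) = b2 (e s)" using i by (simp add: b4_simps b2_src)
next
  fix x assume *: "\<And>s l q p. (s, l) \<in> set chs4 \<Longrightarrow> (q, p) \<in> set l \<Longrightarrow> x \<noteq> e q"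
  have "x \<notin> e ` FanS"
  proof
    assume "x \<in> e ` FanS"
    then obtain r k where rk: "x = e (Fan r k)" "1 \<le> r" "r < R" "k < B" by (auto simp: FanS_def)
    have "(src k, map (\<lambda>r. (Fan r k, Duo ((r - 1) * K + k))) [1..<R]) \<in> set chs4"
      unfolding chs4_def set_map using rk(4) by (intro image_eqI[of _ _ k]) auto
    moreover have "(Fan r k, Duo ((r - 1) * K + k)) \<in> set (map (\<lambda>r. (Fan r k, Duo ((r - 1) * K + k))) [1..<R])"
      unfolding set_map using rk(2,3) by (intro image_eqI[of _ _ r]) auto
    ultimately show False using *[of "src k" _ "Fan r k" "Duo ((r - 1) * K + k)"] rk(1) by blast
  qed
  then show "b4 x = b2 x" by (simp add: b4_simps)
qed

lemma b4_loc: "r < R \<Longrightarrow> k < B \<Longrightarrow> b4 (e (loc r k)) = mv k"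
proof (cases "r = 0")
  case True
  assume "k < B"
  then have "src k \<notin> FanS" using src_neq(1) by (auto simp: FanS_def)
  then show ?thesis using True \<open>k < B\<close> by (simp add: loc_def b4_simps b2_src)
next
  case False
  assume "r < R" "k < B"
  then show ?thesis using False by (simp add: loc_def b4_simps)
qed

definition cs5 :: "(nat \<times> nat) list" where
  "cs5 = map (\<lambda>a. (e (loc (fst a div K) (snd a)), e (tgt (fst a) (snd a)))) (sort_key slot pairs)"

definition b5 :: basis where
  "b5 q = (b4 q \<noteq> odd (length (filter (\<lambda>(c, t). t = q \<and> b4 c) cs5)))"

lemma step5: "sends o' (map snd S5) b4 b5"
proof -
  have "fst ` set cs5 \<inter> snd ` set cs5 = {}"
  proof -
    have "c \<noteq> t" if "c \<in> fst ` set cs5" "t \<in> snd ` set cs5" for c t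
    proof -
      from that(1) obtain p k where 1: "c = e (loc (p div K) k)" "k < B" unfolding cs5_def by (auto simp: set_pairs)
      from that(2) obtain p' k' where 2: "t = e (tgt p' k')" unfolding cs5_def by auto
      have "loc (p div K) k \<noteq> tgt p' k'"
        using loc_neq[OF 1(2)] tgt_cases[of p' k'] by (metis empty_iff insert_iff)
      then show ?thesis using 1 2 by simp
    qed
    then show ?thesis by blast
  qed
  from sends_CNOTs[OF this, of o' b4]
  have "sends o' (map (\<lambda>(c, t). Gate (GCNOT c t)) cs5) b4 b5" unfolding b5_def[abs_def] .
  moreover have "map (\<lambda>(c, t). Gate (GCNOT c t)) cs5 = map snd S5"
    by (simp add: cs5_def S5_eq ring_op_def o_def)
  ultimately show ?thesis by simp
qed

lemma b5_count: "b5 (e a) = (b4 (e a) \<noteq> odd (length (filter (\<lambda>(p, k). tgt p k = a \<and> mv k) pairs)))"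
proof -
  have "length (filter (\<lambda>(c, t). t = e a \<and> b4 c) cs5) =
      length (filter (\<lambda>x. tgt (fst x) (snd x) = a \<and> b4 (e (loc (fst x div K) (snd x)))) (sort_key slot pairs))"
    unfolding cs5_def filter_map length_map by (simp add: o_def)
  also have "\<dots> = length (filter (\<lambda>x. tgt (fst x) (snd x) = a \<and> b4 (e (loc (fst x div K) (snd x)))) pairs)"
    by (rule length_filter_sort_key)
  also have "filter (\<lambda>x. tgt (fst x) (snd x) = a \<and> b4 (e (loc (fst x div K) (snd x)))) pairs =
      filter (\<lambda>(p, k). tgt p k = a \<and> mv k) pairs"
  proof (rule filter_cong[OF refl])
    fix x assume x: "x \<in> set pairs"
    obtain p k where pk: "x = (p, k)" by (cases x)
    have "p < np" "k < B" using x by (simp_all add: pk set_pairs)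
    then show "(tgt (fst x) (snd x) = a \<and> b4 (e (loc (fst x div K) (snd x)))) = (case x of (p, k) \<Rightarrow> tgt p k = a \<and> mv k)"
      by (simp add: pk b4_loc[OF block_lt_R])
  qed
  finally show ?thesis by (simp add: b5_def)
qed

lemma b5_other: "q \<notin> e ` (Out ` {..<m} \<union> Duo ` {..<np}) \<Longrightarrow> b5 q = b4 q"
proof -
  assume q: "q \<notin> e ` (Out ` {..<m} \<union> Duo ` {..<np})"
  have "filter (\<lambda>(c, t). t = q \<and> b4 c) cs5 = []"
  proof -
    have "t \<noteq> q" if ct: "(c, t) \<in> set cs5" for c t
    proof -
      from ct obtain p k where pk: "(p, k) \<in> set pairs" "t = e (tgt p k)" unfolding cs5_def by auto
      have "tgt p k \<in> labs" by (rule tgt_labs[OF pk(1)])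
      then have "tgt p k \<in> Out ` {..<m} \<union> Duo ` {..<np}"
        using tgt_cases[of p k] by (auto simp: in_labs)
      then show ?thesis using q pk(2) by auto
    qed
    then show ?thesis by (auto simp: filter_empty_conv)
  qed
  then show ?thesis by (simp add: b5_def)
qed

text \<open>The target determines the pair, so the scheduled CNOTs into \<open>a\<close> lie in the
  single row \<open>p\<close> and only monomials remain to be counted.\<close>

lemma count_pairs:
  assumes "p < np" "\<And>p' k. (A (2 * p') k \<or> A (2 * p' + 1) k) \<and> tgt p' k = a \<longleftrightarrow> p' = p \<and> Q k"
  shows "length (filter (\<lambda>(p, k). tgt p k = a \<and> mv k) pairs) = length (filter (\<lambda>k. Q k \<and> mv k) [0..<B])"
proof -
  have "filter (\<lambda>(p, k). tgt p k = a \<and> mv k) pairs =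
      filter (\<lambda>(p', k). p' = p \<and> (Q k \<and> mv k)) (List.product [0..<np] [0..<B])"
    unfolding pairs_def filter_filter
    by (rule filter_cong[OF refl]) (use assms(2) in \<open>auto simp: case_prod_unfold\<close>)
  then show ?thesis using assms(1) by (simp add: length_filter_product)
qed

lemma b4_Duo: "p < np \<Longrightarrow> \<not> b4 (e (Duo p))"
  using zero[of "Duo p"] by (simp add: b4_simps b2_late in_ancs)

lemma b5_Duo: "p < np \<Longrightarrow> b5 (e (Duo p)) = odd (length (filter (\<lambda>k. (A (2 * p) k \<and> A (2 * p + 1) k) \<and> mv k) [0..<B]))"
  unfolding b5_count
  by (subst count_pairs[where p = p and Q = "\<lambda>k. A (2 * p) k \<and> A (2 * p + 1) k"]) (auto simp: b4_Duo tgt_def)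

lemma b5_Out0: "p < np \<Longrightarrow> b5 (e (Out (2 * p))) =
    (b (e (Out (2 * p))) \<noteq> odd (length (filter (\<lambda>k. (A (2 * p) k \<and> \<not> A (2 * p + 1) k) \<and> mv k) [0..<B])))"
  unfolding b5_count
  by (subst count_pairs[where p = p and Q = "\<lambda>k. A (2 * p) k \<and> \<not> A (2 * p + 1) k"])
    (auto simp: b4_simps b2_late tgt_def split: if_splits, presburger+)

lemma b5_Out1: "p < np \<Longrightarrow> b5 (e (Out (2 * p + 1))) =
    (b (e (Out (2 * p + 1))) \<noteq> odd (length (filter (\<lambda>k. (\<not> A (2 * p) k \<and> A (2 * p + 1) k) \<and> mv k) [0..<B])))"
  unfolding b5_count
  by (subst count_pairs[where p = p and Q = "\<lambda>k. \<not> A (2 * p) k \<and> A (2 * p + 1) k"])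
    (auto simp: b4_simps b2_late tgt_def split: if_splits, presburger+)

definition cs6 :: "(nat \<times> nat) list" where
  "cs6 = map (\<lambda>p. (e (Duo p), e (Out (2 * p)))) [0..<m div 2] @ map (\<lambda>p. (e (Duo p), e (Out (2 * p + 1)))) [0..<m div 2]"

definition b6 :: basis where
  "b6 q = (b5 q \<noteq> odd (length (filter (\<lambda>(c, t). t = q \<and> b5 c) cs6)))"

lemma step6: "sends o' (map snd S6) b5 b6"
proof -
  have "fst ` set cs6 \<inter> snd ` set cs6 = {}"
    unfolding cs6_def by auto
  from sends_CNOTs[OF this, of o' b5]
  have "sends o' (map (\<lambda>(c, t). Gate (GCNOT c t)) cs6) b5 b6" unfolding b6_def[abs_def] .
  moreover have "map (\<lambda>(c, t). Gate (GCNOT c t)) cs6 = map snd S6"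
    by (simp add: cs6_def S6_def o_def)
  ultimately show ?thesis by simp
qed

lemma b6_other: "q \<notin> e ` Out ` {..<m} \<Longrightarrow> b6 q = b5 q"
proof -
  assume q: "q \<notin> e ` Out ` {..<m}"
  have "t \<noteq> q" if ct: "(c, t) \<in> set cs6" for c t
  proof -
    from ct obtain p where p: "p < m div 2" "t = e (Out (2 * p)) \<or> t = e (Out (2 * p + 1))"
      unfolding cs6_def by auto
    have "2 * p < m" "2 * p + 1 < m" using p(1) by linarith+
    then have "t \<in> e ` Out ` {..<m}" using p(2) by auto
    then show ?thesis using q by auto
  qed
  then have "filter (\<lambda>(c, t). t = q \<and> b5 c) cs6 = []" by (auto simp: filter_empty_conv)
  then show ?thesis by (simp add: b6_def)
qed

text \<open>The offset \<open>s\<close> selects the first or the second output of a pair; the parity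
  of the index keeps the two groups of CNOTs apart.\<close>

lemma count_cs6:
  assumes "s < 2"
  shows "length (filter (\<lambda>(c, t). t = e (Out (2 * p + s)) \<and> b5 c) cs6) = (if p < m div 2 \<and> b5 (e (Duo p)) then 1 else 0)"
proof -
  have 1: "length (filter (\<lambda>(c, t). t = e (Out (2 * p + s)) \<and> b5 c) (map (\<lambda>p. (e (Duo p), e (Out (2 * p + s)))) [0..<M])) =
      (if p < M \<and> b5 (e (Duo p)) then 1 else 0)" for M
    by (induction M) auto
  have 2: "filter (\<lambda>(c, t). t = e (Out (2 * p + s)) \<and> b5 c) (map (\<lambda>p. (e (Duo p), e (Out (2 * p + s')))) ps) = []"
    if "s' < 2" "s' \<noteq> s" for s' ps
  proof -
    have "2 * p' + s' \<noteq> 2 * p + s" for p' using that assms by presburger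
    then show ?thesis by (auto simp: filter_empty_conv)
  qed
  have cs: "cs6 = map (\<lambda>p. (e (Duo p), e (Out (2 * p + 0)))) [0..<m div 2] @ map (\<lambda>p. (e (Duo p), e (Out (2 * p + 1)))) [0..<m div 2]"
    by (simp add: cs6_def)
  from assms consider "s = 0" | "s = 1" by linarith
  then show ?thesis
  proof cases
    case s: 1
    show ?thesis unfolding cs filter_append length_append using 1[of "m div 2"] 2[of 1] unfolding s by simp
  next
    case s: 2
    show ?thesis unfolding cs filter_append length_append using 1[of "m div 2"] 2[of 0] unfolding s by simp
  qed
qed

text \<open>The monomials of output \<open>j\<close> are split by whether the partner output has
  them too: those it has alone were added directly, the common ones arrive through
  \<open>Duo p\<close>.\<close>

lemma b6_Out:
  assumes "j < m"
  shows "b6 (e (Out j)) = (b (e (Out j)) \<noteq> odd (length (filter (\<lambda>k. A j k \<and> mv k) [0..<B])))"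
proof -
  define p where "p = j div 2"
  have p: "p < np" using assms by (simp add: p_def np_def)
  have sp: "odd (length (filter (\<lambda>k. X k \<and> mv k) [0..<B])) \<longleftrightarrow>
     odd (length (filter (\<lambda>k. (X k \<and> Y k) \<and> mv k) [0..<B])) \<noteq> odd (length (filter (\<lambda>k. (X k \<and> \<not> Y k) \<and> mv k) [0..<B]))" for X Y
    using odd_filter_split[of "\<lambda>k. X k \<and> mv k" "[0..<B]" Y] by (simp add: conj_ac)
  consider "j = 2 * p" | "j = 2 * p + 1" unfolding p_def by linarith
  then show ?thesis
  proof cases
    case 1
    have b6: "b6 (e (Out j)) = (b5 (e (Out j)) \<noteq> (p < m div 2 \<and> b5 (e (Duo p))))"
      using count_cs6[of 0 p] by (simp add: b6_def 1)
    show ?thesis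
    proof (cases "p < m div 2")
      case True
      show ?thesis
        unfolding b6 unfolding 1 b5_Out0[OF p] b5_Duo[OF p] sp[of "A (2 * p)" "A (2 * p + 1)"] using True by auto
    next
      case False
      \<comment> \<open>The last output of an odd number of outputs: its partner row is empty, so
        nothing was diverted to \<open>Duo p\<close> and everything was added directly.\<close>
      then have "\<not> A (2 * p + 1) k" for k by (intro A) linarith
      then show ?thesis unfolding b6 unfolding 1 b5_Out0[OF p] using False by simp
    qed
  next
    case 2
    have b6: "b6 (e (Out j)) = (b5 (e (Out j)) \<noteq> (p < m div 2 \<and> b5 (e (Duo p))))"
      using count_cs6[of 1 p] by (simp add: b6_def 2)
    have True: "p < m div 2" using 2 assms by linarith
    have c: "(\<lambda>k. (A (2 * p) k \<and> A (2 * p + 1) k) \<and> mv k) = (\<lambda>k. (A (2 * p + 1) k \<and> A (2 * p) k) \<and> mv k)"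
      "(\<lambda>k. (\<not> A (2 * p) k \<and> A (2 * p + 1) k) \<and> mv k) = (\<lambda>k. (A (2 * p + 1) k \<and> \<not> A (2 * p) k) \<and> mv k)" by auto
    show ?thesis
      unfolding b6 unfolding 2 b5_Out1[OF p] b5_Duo[OF p] c sp[of "A (2 * p + 1)" "A (2 * p)"] using True by auto
  qed
qed

lemma b6_loc: "r < R \<Longrightarrow> k < B \<Longrightarrow> b6 (e (loc r k)) = mv k"
proof -
  assume rk: "r < R" "k < B"
  have n1: "e (loc r k) \<notin> e ` Out ` {..<m}" and n2: "e (loc r k) \<notin> e ` (Out ` {..<m} \<union> Duo ` {..<np})"
    using loc_neq[OF rk(2)] by (auto simp del: e_image_iff)
  show ?thesis unfolding b6_other[OF n1] b5_other[OF n2] by (rule b4_loc[OF rk])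
qed

definition b7a :: basis where "b7a q = (if q \<in> fst ` set clD then False else b6 q)"
definition b7b :: basis where "b7b q = (if q \<in> fst ` set clF then False else b7a q)"
definition b7 :: basis where "b7 q = (b7b q \<noteq> (\<exists>j\<in>set (filter c0 [0..<m]). q = e (Out j)))"

lemma fst_clD: "fst ` set clD = e ` Duo ` {..<m div 2}"
  by (auto simp: clD_def image_image)

lemma fst_clF: "fst ` set clF = e ` FanS"
  by (force simp: clF_def image_image FanS_def)

lemma step7a: "sends o' (concat (map (\<lambda>(q, fs). xclear q fs) clD)) b6 b7a"
proof (rule sends_xclears)
  have "map fst clD = map (\<lambda>p. e (Duo p)) [0..<m div 2]" by (simp add: clD_def)
  then show "distinct (map fst clD)" by (simp add: distinct_map inj_on_def)
  have cl: "\<exists>p<m div 2. x = e (Duo p) \<and> fs = map (\<lambda>k. e (loc (p div K) k)) (filter (\<lambda>k. A (2 * p) k \<and> A (2 * p + 1) k) [0..<B])"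
    if "(x, fs) \<in> set clD" for x fs
    using that unfolding clD_def by auto
  show "\<forall>(q, fs)\<in>set clD. set fs \<inter> fst ` set clD = {}"
    unfolding fst_clD
  proof (clarify)
    fix x fs assume "(x, fs) \<in> set clD"
    from cl[OF this] show "set fs \<inter> e ` Duo ` {..<m div 2} = {}" using loc_neq(2) loc_neq(2)[symmetric] by auto
  qed
  show "\<forall>(q, fs)\<in>set clD. b6 q = odd (length (filter b6 fs))"
  proof (clarify)
    fix x fs assume "(x, fs) \<in> set clD"
    from cl[OF this] obtain p where p: "p < m div 2" "x = e (Duo p)"
      "fs = map (\<lambda>k. e (loc (p div K) k)) (filter (\<lambda>k. A (2 * p) k \<and> A (2 * p + 1) k) [0..<B])" by blast
    have pn: "p < np" using p(1) by (simp add: np_def)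
    have "e (Duo p) \<notin> e ` Out ` {..<m}" by auto
    then have "b6 x = b5 (e (Duo p))" unfolding p(2) by (rule b6_other)
    also have "\<dots> = odd (length (filter (\<lambda>k. (A (2 * p) k \<and> A (2 * p + 1) k) \<and> mv k) [0..<B]))" by (rule b5_Duo[OF pn])
    also have "filter (\<lambda>k. (A (2 * p) k \<and> A (2 * p + 1) k) \<and> mv k) [0..<B] =
        filter (\<lambda>k. (A (2 * p) k \<and> A (2 * p + 1) k) \<and> b6 (e (loc (p div K) k))) [0..<B]"
      by (rule filter_cong[OF refl]) (simp add: b6_loc[OF block_lt_R[OF pn]])
    also have "length \<dots> = length (filter b6 fs)"
      unfolding p(3) filter_map length_map filter_filter by (simp add: o_def conj_ac)
    finally show "b6 x = odd (length (filter b6 fs))" .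
  qed
qed (simp add: b7a_def)

lemma step7b: "sends o' (concat (map (\<lambda>(q, fs). xclear q fs) clF)) b7a b7b"
proof (rule sends_xclears)
  have m: "map fst clF = map (\<lambda>a. e (Fan (fst a) (snd a))) (List.product [1..<R] [0..<B])" by (simp add: clF_def)
  show "distinct (map fst clF)"
    unfolding m distinct_map by (intro conjI distinct_product distinct_upt) (auto simp: inj_on_def)
  have cl: "\<exists>r k. 1 \<le> r \<and> r < R \<and> k < B \<and> x = e (Fan r k) \<and> fs = [e (src k)]" if "(x, fs) \<in> set clF" for x fs
    using that unfolding clF_def by auto
  have nD: "e (loc r k) \<notin> fst ` set clD" if "k < B" for r k
    unfolding fst_clD using loc_neq(2)[OF that] loc_neq(2)[OF that, symmetric] by auto
  show "\<forall>(q, fs)\<in>set clF. set fs \<inter> fst ` set clF = {}"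
    unfolding fst_clF
  proof (clarify)
    fix x fs assume "(x, fs) \<in> set clF"
    from cl[OF this] show "set fs \<inter> e ` FanS = {}" using src_neq(1,6) by (auto simp: FanS_def)
  qed
  show "\<forall>(q, fs)\<in>set clF. b7a q = odd (length (filter b7a fs))"
  proof (clarify)
    fix x fs assume "(x, fs) \<in> set clF"
    from cl[OF this] obtain r k where rk: "1 \<le> r" "r < R" "k < B" "x = e (Fan r k)" "fs = [e (src k)]" by blast
    have "e (Fan r k) = e (loc r k)" "e (src k) = e (loc 0 k)" using rk(1) by (simp_all add: loc_def)
    moreover have "b7a (e (loc r k)) = mv k" "b7a (e (loc 0 k)) = mv k"
      using nD[OF rk(3)] b6_loc[OF rk(2,3)] b6_loc[of 0 k] rk(1-3) by (simp_all add: b7a_def)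
    ultimately show "b7a x = odd (length (filter b7a fs))" unfolding rk(4,5) by simp
  qed
qed (simp add: b7b_def)

lemma step7: "sends o' (map snd S7) b6 b7"
proof -
  have "sends o' flips b7b b7"
    unfolding flips_def b7_def[abs_def] by (rule sends_flips) simp
  then show ?thesis
    unfolding S7_def map_snd_seqt ops7_def by (intro sends_append[OF step7a] sends_append[OF step7b])
qed

lemma b7_simps:
  "q \<notin> e ` Out ` {..<m} \<Longrightarrow> q \<notin> e ` Duo ` {..<np} \<Longrightarrow> q \<notin> e ` FanS \<Longrightarrow> b7 q = b2 q"
  "a \<in> FanS \<Longrightarrow> \<not> b7 (e a)" "p < np \<Longrightarrow> \<not> b7 (e (Duo p))"
  "j < m \<Longrightarrow> b7 (e (Out j)) = (b6 (e (Out j)) \<noteq> c0 j)"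
proof -
  show "b7 q = b2 q" if q: "q \<notin> e ` Out ` {..<m}" "q \<notin> e ` Duo ` {..<np}" "q \<notin> e ` FanS"
  proof -
    have "q \<notin> e ` Duo ` {..<m div 2}" using q(2) by (auto simp: np_def)
    moreover have "\<not> (\<exists>j\<in>set (filter c0 [0..<m]). q = e (Out j))" using q(1) by auto
    ultimately have "b7 q = b6 q" using q by (simp add: b7_def b7b_def b7a_def fst_clD fst_clF)
    also have "\<dots> = b5 q" by (rule b6_other[OF q(1)])
    also have "\<dots> = b4 q" by (rule b5_other) (use q in auto)
    also have "\<dots> = b2 q" by (rule b4_simps(3)[OF q(3)])
    finally show ?thesis .
  qed
  show "\<not> b7 (e a)" if "a \<in> FanS"
    using that by (auto simp: b7_def b7b_def fst_clF)
  show "\<not> b7 (e (Duo p))" if p: "p < np"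
  proof (cases "p < m div 2")
    case True
    then show ?thesis by (auto simp: b7_def b7b_def b7a_def fst_clF fst_clD)
  next
    case False
    \<comment> \<open>Without a second output no monomial is common to the pair, so
      \<open>Duo p\<close> was never loaded and needs no clearing.\<close>
    then have "\<not> A (2 * p + 1) k" for k by (intro A) linarith
    then have "\<not> b5 (e (Duo p))" by (simp add: b5_Duo[OF p])
    moreover have "e (Duo p) \<notin> e ` Out ` {..<m}" by auto
    then have "b6 (e (Duo p)) = b5 (e (Duo p))" by (rule b6_other)
    ultimately show ?thesis by (auto simp: b7_def b7b_def b7a_def)
  qed
  show "b7 (e (Out j)) = (b6 (e (Out j)) \<noteq> c0 j)" if "j < m"
    using that by (auto simp: b7_def b7b_def b7a_def fst_clF fst_clD FanS_def)
qed

lemma b7_b2: "a \<notin> late \<Longrightarrow> (\<And>j. a \<noteq> Out j) \<Longrightarrow> b7 (e a) = b2 (e a)"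
  by (rule b7_simps(1)) (auto simp: FanS_def)

definition b8 :: basis where "b8 q = (if q \<in> e ` NodeS then False else b7 q)"

lemma step8: "sends o' (map snd S8) b7 b8"
  unfolding map_snd_S8
proof (rule sends_unands[OF fed_forward_et])
  fix x y z h assume "(x, y, z, h) \<in> set (map et all_ands)"
  then obtain t where t: "t \<in> set all_ands" "(x, y, z, h) = et t" unfolding set_map by blast
  obtain x' y' z' h' where f: "t = (x', y', z', h')" by (cases t)
  have eqs: "x = e x'" "y = e y'" "z = e z'" using t(2) unfolding f et_def by simp_all
  note l = tuple_labs[OF t(1)[unfolded f]]
  obtain l c where "z' = Node l c" using l(5) by blast
  then have "b7 (e z') = b2 (e z')" by (intro b7_b2) auto
  moreover have "b7 (e x') = b2 (e x')" "b7 (e y') = b2 (e y')"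
    by (rule b7_b2; use l in blast)+
  ultimately show "b7 z = (b7 x \<and> b7 y)"
    unfolding eqs using b2_and[OF t(1)[unfolded f]] by simp
next
  show "b8 x = (if x \<in> res ` set (map et all_ands) then False else b7 x)" for x
    unfolding res_et b8_def ..
qed

definition b9 :: basis where "b9 q = (if q \<in> e ` CopyS then False else b8 q)"

lemma fst_clC: "fst ` set clC = e ` CopyS"
proof -
  have "fst ` set clC = (\<Union>i\<in>{0..<n}. (\<lambda>l. e (Copy l i)) ` set (cps i))"
    by (simp add: clC_def image_UN image_image)
  also have "\<dots> = e ` CopyS"
    using cps_less by (force simp: CopyS_def)
  finally show ?thesis .
qed

lemma b8_In: "b8 (e (In i)) = b (e (In i))"
proof -
  have "In i \<notin> NodeS" using NodeS_Node by blast
  then have "b8 (e (In i)) = b7 (e (In i))" by (simp add: b8_def)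
  also have "\<dots> = b2 (e (In i))" by (rule b7_b2) auto
  finally show ?thesis by (simp add: b2_late)
qed

lemma step9: "sends o' (map snd S9) b8 b9"
  unfolding S9_def map_snd_seqt
proof (rule sends_xclears)
  have m: "map fst clC = concat (map (\<lambda>i. map (\<lambda>l. e (Copy l i)) (cps i)) [0..<n])"
    by (simp add: clC_def map_concat o_def)
  show "distinct (map fst clC)"
    unfolding m distinct_concat_map
    by (intro conjI ballI sorted_wrt_distinct) (auto simp: distinct_map distinct_cps inj_on_def)
  have cl: "\<exists>l i. l \<in> set (cps i) \<and> x = e (Copy l i) \<and> fs = [e (In i)]" if "(x, fs) \<in> set clC" for x fs
    using that unfolding clC_def by auto
  show "\<forall>(q, fs)\<in>set clC. set fs \<inter> fst ` set clC = {}"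
    unfolding fst_clC
  proof (clarify)
    fix x fs assume "(x, fs) \<in> set clC"
    from cl[OF this] show "set fs \<inter> e ` CopyS = {}" by (auto simp: CopyS_def)
  qed
  show "\<forall>(q, fs)\<in>set clC. b8 q = odd (length (filter b8 fs))"
  proof (clarify)
    fix x fs assume "(x, fs) \<in> set clC"
    from cl[OF this] obtain l i where li: "l \<in> set (cps i)" "x = e (Copy l i)" "fs = [e (In i)]" by blast
    have nn: "Copy l i \<notin> NodeS" using NodeS_Node by blast
    then have "b8 x = b7 (e (Copy l i))" by (simp add: b8_def li(2))
    also have "\<dots> = b2 (e (Copy l i))" by (rule b7_b2) auto
    also have "\<dots> = b (e (In i))" using nn li(1) by (simp add: b2_outside b1_simps)
    finally show "b8 x = odd (length (filter b8 fs))" unfolding li(3) by (simp add: b8_In)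
  qed
qed (simp add: b9_def fst_clC)

lemma b9_eq:
  "b9 q = (b q \<noteq> (\<exists>j<m. q = e (Out j) \<and> (c0 j \<noteq> odd (length (filter (\<lambda>k. A j k \<and> mv k) [0..<B])))))"
proof (cases "q \<in> range e")
  case False
  then have "b9 q = b7 q" by (auto simp: b9_def b8_def)
  also have "\<dots> = b2 q" by (rule b7_simps(1)) (use False in auto)
  also have "\<dots> = b1 q" by (rule b2_outside) (use False in auto)
  also have "\<dots> = b q" by (rule b1_simps(3)[OF False])
  finally show ?thesis using False by auto
next
  case True
  then obtain a where q: "q = e a" by blast
  have keep: "b9 q = b q" if "a \<notin> CopyS" "a \<notin> NodeS" "a \<notin> Out ` {..<m}" "a \<notin> Duo ` {..<np}" "a \<notin> FanS"
  proof -
    have "b9 q = b7 q" using that(1,2) by (simp add: b9_def b8_def q)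
    also have "\<dots> = b2 q" by (rule b7_simps(1)) (use that in \<open>auto simp: q\<close>)
    also have "\<dots> = b q" using that(1,2) by (simp add: b2_outside b1_simps q)
    finally show ?thesis .
  qed
  have clear: "b9 q = b q" if "\<not> b9 (e a)" "a \<in> set ancs"
    using that zero[OF that(2)] by (simp add: q)
  consider (out) j where "a = Out j" "j < m" | (copy) "a \<in> CopyS" | (node) "a \<in> NodeS" | (duo) p where "a = Duo p" "p < np"
    | (fan) "a \<in> FanS" | (none) "a \<notin> CopyS" "a \<notin> NodeS" "a \<notin> Out ` {..<m}" "a \<notin> Duo ` {..<np}" "a \<notin> FanS"
    by blast
  then show ?thesis
  proof cases
    case out
    have "Out j \<notin> NodeS" using NodeS_Node by blast
    then have "b9 q = (b6 (e (Out j)) \<noteq> c0 j)"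
      using out by (simp add: b9_def b8_def q b7_simps)
    then show ?thesis unfolding b6_Out[OF out(2)] using out by (auto simp: q)
  next
    case copy
    then have "a \<in> set ancs" by (auto simp: CopyS_def in_ancs set_cps)
    moreover have "\<not> b9 (e a)" using copy by (simp add: b9_def)
    ultimately show ?thesis using clear copy by (auto simp: q)
  next
    case node
    then have "a \<in> set ancs" "\<And>j. a \<noteq> Out j" using NodeS_Node by blast+
    moreover have "\<not> b9 (e a)" using node by (simp add: b9_def b8_def)
    ultimately show ?thesis using clear by (auto simp: q)
  next
    case duo
    then have "a \<in> set ancs" by (simp add: in_ancs)
    moreover have "\<not> b9 (e a)" using b7_simps(3)[OF duo(2)] by (simp add: b9_def b8_def duo(1))
    ultimately show ?thesis using clear duo by (auto simp: q)
  next
    case fan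
    then have "a \<in> set ancs" "\<And>j. a \<noteq> Out j" by (auto simp: FanS_def in_ancs)
    moreover have "\<not> b9 (e a)" using b7_simps(2)[OF fan] by (simp add: b9_def b8_def)
    ultimately show ?thesis using clear by (auto simp: q)
  next
    case none
    then show ?thesis using keep by (auto simp: q)
  qed
qed

lemma sends_prog:
  "sends o' (map snd prog) b
     (\<lambda>q. b q \<noteq> (\<exists>j<m. q = e (Out j) \<and> (c0 j \<noteq> odd (length (filter (\<lambda>k. A j k \<and> mv k) [0..<B])))))"
proof -
  have "sends o' (map snd prog) b b9"
    unfolding prog_def map_append
    by (intro sends_append[OF step1] sends_append[OF step2] sends_append[OF step4] sends_append[OF step5]
      sends_append[OF step6] sends_append[OF step7] sends_append[OF step8] step9)
  then show ?thesis unfolding b9_eq[abs_def] .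
qed

end

section \<open>Resources\<close>

context mono_circuit
begin

definition half :: nat where "half = 2 ^ (n - 1)"

lemma pow_half: "2 ^ n = 2 * half"
  using n2 power_eq_if[of "2 :: nat" n] by (simp add: half_def)

lemma B_half: "B + 1 = 2 * half"
  using B_pos by (simp add: B_eq pow_half)

lemma sum_length_half: "(\<Sum>l\<leftarrow>monomials n. length l) = n * half"
  using sum_length_monomials[of n] by (simp add: pow_half)

lemma ands_le: "length all_ands + B \<le> n * half"
proof -
  have "length all_ands = (\<Sum>j<L. length (level n j))"
  proof -
    have "length (concat (map (level n) [0..<d])) = (\<Sum>j<d. length (level n j))" for d
      by (induction d) auto
    then show ?thesis by (simp add: all_ands_def)
  qed
  then show ?thesis
    using sum_level[where L = L and n = n] sum_length_tl[of n] unfolding sum_length_half B_eq by linarith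
qed

lemma copied: "(\<Sum>l\<leftarrow>filter (\<lambda>l. 1 < length l \<and> l \<noteq> [0..<n]) (monomials n). length l) + 2 * n = n * half"
  using sum_length_copied[OF n2] unfolding sum_length_half .

text \<open>Double counting of the incidences between variables and monomials.\<close>

lemma sum_length_filter_mem:
  "\<forall>l\<in>set ls. distinct l \<and> set l \<subseteq> {..<n} \<Longrightarrow>
     (\<Sum>i\<leftarrow>[0..<n]. length (filter (\<lambda>l. i \<in> set l) ls)) = (\<Sum>l\<leftarrow>ls. length l)"
proof (induction ls)
  case (Cons l ls)
  have c: "(\<Sum>i\<leftarrow>[0..<n]. if i \<in> set l then 1 else 0 :: nat) = length l"
  proof -
    have "(\<Sum>i\<leftarrow>[0..<n]. if i \<in> set l then 1 else 0 :: nat) = (\<Sum>i\<in>{..<n}. if i \<in> set l then 1 else 0)"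
      by (simp add: sum_list_distinct_conv_sum_set atLeast0LessThan)
    also have "\<dots> = card ({..<n} \<inter> set l)"
      by (simp add: sum.If_cases)
    also have "{..<n} \<inter> set l = set l" using Cons.prems by auto
    also have "card (set l) = length l" using Cons.prems by (simp add: distinct_card)
    finally show ?thesis .
  qed
  have "(\<Sum>i\<leftarrow>[0..<n]. length (filter (\<lambda>l. i \<in> set l) (l # ls))) =
     (\<Sum>i\<leftarrow>[0..<n]. (if i \<in> set l then 1 else 0) + length (filter (\<lambda>l. i \<in> set l) ls))"
    by (intro arg_cong[where f = sum_list] map_cong) auto
  also have "\<dots> = length l + (\<Sum>l\<leftarrow>ls. length l)"
    using Cons c by (simp add: sum_list_addf)
  finally show ?case by simp
qed simp

lemma sum_cps: "(\<Sum>i\<leftarrow>[0..<n]. length (cps i)) + 2 * n = n * half"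
proof -
  have "(\<Sum>i\<leftarrow>[0..<n]. length (cps i)) =
      (\<Sum>l\<leftarrow>filter (\<lambda>l. 1 < length l \<and> l \<noteq> [0..<n]) (monomials n). length l)"
    by (subst sum_length_filter_mem[symmetric]) (use set_monomials in \<open>auto simp: cps_def filter_filter conj_ac\<close>)
  then show ?thesis using copied by simp
qed

lemma count_and_stage:
  "count_ops is_T_op S2 = 4 * length all_ands" "count_ops is_CNOT_op S2 = 6 * length all_ands"
proof -
  have 1: "count_ops is_T_op (concat (map (and_gate \<tau>) ts)) = 4 * length ts"
    "count_ops is_CNOT_op (concat (map (and_gate \<tau>) ts)) = 6 * length ts" for \<tau> ts
    by (induction ts) (simp_all add: count_and_gate)
  have 2: "count_ops is_T_op (concat (map (\<lambda>j. concat (map (and_gate (f j)) (map et (level n j)))) js)) = 4 * length (concat (map (level n) js))"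
    "count_ops is_CNOT_op (concat (map (\<lambda>j. concat (map (and_gate (f j)) (map et (level n j)))) js)) = 6 * length (concat (map (level n) js))" for f js
    by (induction js) (simp_all add: 1 del: map_map)
  show "count_ops is_T_op S2 = 4 * length all_ands" "count_ops is_CNOT_op S2 = 6 * length all_ands"
    unfolding S2_def all_ands_def by (rule 2)+
qed

lemma count_unand_stage:
  "count_ops is_T_op S8 = 0" "count_ops is_CNOT_op S8 = length all_ands"
proof -
  have 1: "count_ops is_T_op (concat (map (unand_gate \<tau>) ts)) = 0"
    "count_ops is_CNOT_op (concat (map (unand_gate \<tau>) ts)) = length ts" for \<tau> ts
    by (induction ts) (simp_all add: count_unand_gate)
  have 2: "count_ops is_T_op (concat (map (\<lambda>j. concat (map (unand_gate (f j)) (map et (rev (level n j))))) js)) = 0"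
    "count_ops is_CNOT_op (concat (map (\<lambda>j. concat (map (unand_gate (f j)) (map et (rev (level n j))))) js)) =
      length (concat (map (level n) js))" for f js
    by (induction js) (simp_all add: 1 del: map_map)
  have "length (concat (map (level n) (rev [0..<L]))) = length all_ands"
    unfolding all_ands_def length_concat map_map rev_map[symmetric] sum_list_rev ..
  then show "count_ops is_T_op S8 = 0" "count_ops is_CNOT_op S8 = length all_ands"
    unfolding S8_def 2 by simp_all
qed

lemma filter_xclears:
  "filter is_T_op (concat (map (\<lambda>(q, fs). xclear q fs) l)) = []"
  "filter is_CNOT_op (concat (map (\<lambda>(q, fs). xclear q fs) l)) = []"
  by (induction l) auto

lemma filter_ops7: "filter is_T_op ops7 = []" "filter is_CNOT_op ops7 = []"
  using flips_op by (auto simp: ops7_def filter_xclears filter_empty_conv)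

lemma count_free:
  "count_ops is_T_op S7 = 0" "count_ops is_CNOT_op S7 = 0" "count_ops is_T_op S9 = 0" "count_ops is_CNOT_op S9 = 0"
  by (simp_all add: S7_def S9_def count_ops_seqt filter_ops7 filter_xclears)

lemma op_times_free:
  "op_times is_T_op S7 = {}" "op_times is_CNOT_op S7 = {}" "op_times is_T_op S9 = {}" "op_times is_CNOT_op S9 = {}"
proof -
  show "op_times is_T_op S7 = {}" "op_times is_CNOT_op S7 = {}"
    unfolding S7_def using filter_ops7 by (auto intro!: op_times_seqt_empty simp: filter_empty_conv)
  show "op_times is_T_op S9 = {}" "op_times is_CNOT_op S9 = {}"
    unfolding S9_def using filter_xclears[of clC] by (auto intro!: op_times_seqt_empty simp: filter_empty_conv)
qed

lemma count_ring: "count_ops is_T_op S5 = 0" "count_ops is_CNOT_op S5 = length pairs"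
proof -
  have "count_ops is_T_op (map ring_op xs) = 0" "count_ops is_CNOT_op (map ring_op xs) = length xs" for xs
    by (induction xs) (simp_all add: ring_op_def)
  then show "count_ops is_T_op S5 = 0" "count_ops is_CNOT_op S5 = length pairs"
    by (simp_all add: S5_eq)
qed

lemma count_S6: "count_ops is_T_op S6 = 0" "count_ops is_CNOT_op S6 = 2 * (m div 2)"
proof -
  have "count_ops is_T_op (map (\<lambda>p. (t, Gate (GCNOT (f p) (g p)))) xs) = 0"
    "count_ops is_CNOT_op (map (\<lambda>p. (t, Gate (GCNOT (f p) (g p)))) xs) = length xs" for t f g and xs :: "nat list"
    by (induction xs) simp_all
  then show "count_ops is_T_op S6 = 0" "count_ops is_CNOT_op S6 = 2 * (m div 2)"
    by (simp_all add: S6_def)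
qed

lemma count_chains: "count_ops is_CNOT_op S1 + 4 * n = 2 * (n * half)" "count_ops is_CNOT_op S4 = 2 * (B * (R - 1))"
proof -
  have "count_ops is_CNOT_op S1 = (\<Sum>i\<leftarrow>[0..<n]. 2 * length (cps i))"
    by (simp add: S1_def count_lchains chs1_def o_def)
  also have "\<dots> = 2 * (\<Sum>i\<leftarrow>[0..<n]. length (cps i))"
    by (rule sum_list_const_mult)
  finally show "count_ops is_CNOT_op S1 + 4 * n = 2 * (n * half)" using sum_cps by linarith
  show "count_ops is_CNOT_op S4 = 2 * (B * (R - 1))"
    by (simp add: S4_def count_lchains chs4_def o_def sum_list_triv)
qed

lemma length_pairs: "length pairs \<le> np * B"
  unfolding pairs_def using length_filter_le[of _ "List.product [0..<np] [0..<B]"] by (simp add: length_product)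

text \<open>Four T gates for each of at most \<open>n * half - B\<close> conjunctions. With
  \<open>B = 2 * half - 1\<close> this is the bound of the theorem without any slack.\<close>

lemma T_total: "count_ops is_T_op prog + 4 * B \<le> 4 * (n * half)"
  using ands_le by (simp add: prog_def count_and_stage count_unand_stage count_free count_ring count_S6 S1_def S4_def count_lchains)

lemma R_K: "(R - 1) * K \<le> np - 1"
  by (simp add: R_def)

text \<open>Two CNOTs per copied input and seven per conjunction, six to compute and one in the CZ
  that undoes it. The hypothesis makes \<open>B * u\<close>, the direct price of the
  \<open>u\<close> second outputs, cover both the copies of the monomials and the
  \<open>2 * u\<close> CNOTs from the auxiliary qubits.\<close>

lemma CNOT_total:
  assumes "2 * K + 2 * B \<le> B * K"
  shows "count_ops is_CNOT_op prog + 4 * n + 7 * B \<le> 9 * (n * half) + B * m"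
proof -
  define u where "u = m div 2"
  have np_u: "np - 1 \<le> u" "np + u = m" by (simp_all add: np_def u_def)
  \<comment> \<open>Multiplying by \<open>K\<close> avoids a division, since \<open>R\<close> is
    only controlled through \<open>(R - 1) * K \<le> np - 1 \<le> u\<close>.\<close>
  have "K * (2 * (B * (R - 1)) + 2 * u) = 2 * B * ((R - 1) * K) + 2 * K * u" by (simp add: algebra_simps)
  also have "\<dots> \<le> 2 * B * u + 2 * K * u"
    using R_K np_u(1) by (intro add_mono mult_le_mono) auto
  also have "\<dots> = (2 * K + 2 * B) * u" by (simp add: algebra_simps)
  also have "\<dots> \<le> B * K * u" by (rule mult_le_mono1[OF assms])
  also have "\<dots> = K * (B * u)" by (simp add: algebra_simps)
  finally have 1: "2 * (B * (R - 1)) + 2 * u \<le> B * u"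
    by (simp only: nat_mult_le_cancel1[OF K_pos])
  have "np * B + B * u = B * (np + u)" by (simp add: algebra_simps)
  then have "np * B + B * u = B * m" by (simp only: np_u(2))
  then have 2: "2 * (B * (R - 1)) + 2 * u + length pairs \<le> B * m" using 1 length_pairs by linarith
  have "count_ops is_CNOT_op prog + 4 * n = 2 * (n * half) + 7 * length all_ands + (2 * (B * (R - 1)) + 2 * u + length pairs)"
    using count_chains by (simp add: prog_def count_and_stage count_unand_stage count_free count_ring count_S6 u_def)
  then show ?thesis using 2 ands_le by linarith
qed

lemma ancilla_total: "card (set ancs) + 3 * n + B \<le> 3 * (n * half) + m"
proof -
  have l1: "length (concat (map (\<lambda>l. map (F l) l) ls)) = (\<Sum>l\<leftarrow>ls. length l)" for F :: "nat list \<Rightarrow> nat \<Rightarrow> lab" and ls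
    by (induction ls) auto
  have l2: "length (concat (map (\<lambda>l. map (F l) (tl l)) ls)) = (\<Sum>l\<leftarrow>ls. length l - 1)" for F :: "nat list \<Rightarrow> nat \<Rightarrow> lab" and ls
    by (induction ls) auto
  have l3: "length (concat (map (\<lambda>r. map (Fan r) [0..<B]) [1..<R])) = (R - 1) * B"
    by (simp add: length_concat o_def sum_list_triv)
  have "card (set ancs) \<le> length ancs" by (rule card_length)
  also have "\<dots> = (\<Sum>l\<leftarrow>filter (\<lambda>l. 1 < length l \<and> l \<noteq> [0..<n]) (monomials n). length l) +
      ((\<Sum>l\<leftarrow>filter (\<lambda>l. 1 < length l) (monomials n). length l) + ((\<Sum>l\<leftarrow>monomials n. length l - 1) + (np + (R - 1) * B)))"
    unfolding ancs_def length_append l1 l2 l3 by simp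
  finally have 1: "card (set ancs) \<le> \<dots>" .
  have 2: "(\<Sum>l\<leftarrow>filter (\<lambda>l. 1 < length l) (monomials n). length l) + n = n * half"
    using sum_length_long[of n] unfolding sum_length_half .
  have 3: "(\<Sum>l\<leftarrow>monomials n. length l - 1) + B = n * half"
    using sum_length_tl[of n] unfolding sum_length_half B_eq .
  have "(R - 1) * B \<le> (R - 1) * K" by (rule mult_le_mono2[OF B_le_K])
  \<comment> \<open>From \<open>2 * np - 1 \<le> m\<close>: the auxiliary qubits take
    \<open>np\<close> of the \<open>m\<close> available, the copies at most
    \<open>np - 1\<close>.\<close>
  then have 4: "np + (R - 1) * B \<le> m" using R_K np_pos unfolding np_def by linarith
  show ?thesis using 1 2 3 4 copied by linarith
qed

section \<open>Layers containing T gates or CNOTs\<close>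

lemma op_times_S2:
  "op_times is_T_op S2 = (\<lambda>j. T2 + 20 * j + 3) ` {j. j < L \<and> level n j \<noteq> []}"
  "op_times is_CNOT_op S2 \<subseteq> (\<Union>j<L. {T2 + 20 * j + 1, T2 + 20 * j + 2, T2 + 20 * j + 16, T2 + 20 * j + 17})"
proof -
  have 1: "op_times is_T_op (concat (map (and_gate \<tau>) ts)) = (if ts = [] then {} else {\<tau> + 3})"
    "op_times is_CNOT_op (concat (map (and_gate \<tau>) ts)) \<subseteq> {\<tau> + 1, \<tau> + 2, \<tau> + 16, \<tau> + 17}" for \<tau> ts
    by (induction ts) (auto simp: op_times_and_gate)
  show "op_times is_T_op S2 = (\<lambda>j. T2 + 20 * j + 3) ` {j. j < L \<and> level n j \<noteq> []}"
    unfolding S2_def op_times_concat[of _ "\<lambda>j. concat (map (and_gate (T2 + 20 * j)) (map et (level n j)))"] 1(1) by auto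
  have "op_times is_CNOT_op S2 = (\<Union>j\<in>{..<L}. op_times is_CNOT_op (concat (map (and_gate (T2 + 20 * j)) (map et (level n j)))))"
    unfolding S2_def op_times_concat[of _ "\<lambda>j. concat (map (and_gate (T2 + 20 * j)) (map et (level n j)))"] by (simp add: atLeast0LessThan)
  also have "\<dots> \<subseteq> (\<Union>j<L. {T2 + 20 * j + 1, T2 + 20 * j + 2, T2 + 20 * j + 16, T2 + 20 * j + 17})"
    by (rule UN_mono[OF subset_refl 1(2)])
  finally show "op_times is_CNOT_op S2 \<subseteq> \<dots>" .
qed

lemma op_times_S8:
  "op_times is_T_op S8 = {}" "op_times is_CNOT_op S8 \<subseteq> (\<lambda>j. T8 + 9 * (L - 1 - j) + 7) ` {..<L}"
proof -
  have 1: "op_times is_T_op (concat (map (unand_gate \<tau>) ts)) = {}"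
    "op_times is_CNOT_op (concat (map (unand_gate \<tau>) ts)) \<subseteq> {\<tau> + 7}" for \<tau> ts
    by (induction ts) (auto simp: op_times_unand_gate)
  let ?G = "\<lambda>j. concat (map (unand_gate (T8 + 9 * (L - 1 - j))) (map et (rev (level n j))))"
  show "op_times is_T_op S8 = {}"
    unfolding S8_def op_times_concat[of _ ?G] 1(1) by simp
  have "op_times is_CNOT_op S8 = (\<Union>j\<in>{..<L}. op_times is_CNOT_op (?G j))"
    unfolding S8_def op_times_concat[of _ ?G] by (simp add: atLeast0LessThan)
  also have "\<dots> \<subseteq> (\<Union>j<L. {T8 + 9 * (L - 1 - j) + 7})"
    by (rule UN_mono[OF subset_refl 1(2)])
  also have "\<dots> = (\<lambda>j. T8 + 9 * (L - 1 - j) + 7) ` {..<L}" by auto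
  finally show "op_times is_CNOT_op S8 \<subseteq> (\<lambda>j. T8 + 9 * (L - 1 - j) + 7) ` {..<L}" .
qed

lemma op_times_S5: "op_times is_T_op S5 = {}" "op_times is_CNOT_op S5 \<subseteq> {T5..<T6}"
proof -
  show "op_times is_T_op S5 = {}" by (auto simp: op_times_def S5_eq ring_op_def)
  show "op_times is_CNOT_op S5 \<subseteq> {T5..<T6}"
    using S5_times by (force simp: op_times_def)
qed

lemma op_times_S6: "op_times is_T_op S6 = {}" "op_times is_CNOT_op S6 \<subseteq> {T6, T6 + 1}"
  by (auto simp: op_times_def S6_def)

text \<open>At every level below \<open>L\<close> the full monomial still has more than one factor.
  Hence the T depth is exactly \<open>L\<close>, not merely at most \<open>L\<close>.\<close>

lemma level_nonempty:
  assumes "2 ^ (L - 1) < n" "j < L"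
  shows "level n j \<noteq> []"
proof -
  have "(2::nat) ^ j \<le> 2 ^ (L - 1)" using assms(2) by (intro power_increasing) auto
  then have "2 ^ j < n" using assms(1) by (rule le_less_trans)
  then have "length [0..<n] > 1 * 2 ^ j" by simp
  then have len: "length (stage n [0..<n] j) > 1" by (rule length_stage_gt)
  then have "tup [0..<n] (stage n [0..<n] j) \<noteq> []"
    by (cases "([0..<n], stage n [0..<n] j)" rule: tup.cases) auto
  moreover have "[0..<n] \<in> set (monomials n)" using full_monomial n2 by simp
  ultimately show ?thesis unfolding level_def by auto
qed

lemma T_depth_prog:
  assumes "2 ^ (L - 1) < n"
  shows "card (op_times is_T_op prog) = L"
proof -
  have "op_times is_T_op prog = (\<lambda>j. T2 + 20 * j + 3) ` {j. j < L \<and> level n j \<noteq> []}"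
    by (simp add: prog_def S1_def S4_def op_times_lchains op_times_S2(1) op_times_S5 op_times_S6 op_times_S8 op_times_free)
  also have "{j. j < L \<and> level n j \<noteq> []} = {..<L}" using level_nonempty[OF assms] by auto
  finally show ?thesis by (simp add: card_image inj_on_def)
qed

text \<open>A level takes four CNOT layers to compute and one to undo, and the cyclic schedule takes
  \<open>K\<close>. The summand 3 is the merging layer \<open>T4\<close> plus the two layers of
  \<open>S6\<close>. For \<open>n = 2\<close> every monomial works without copies, so the two layers
  of the input fan-out disappear.\<close>

lemma CNOT_depth_prog: "card (op_times is_CNOT_op prog) \<le> (if n = 2 then 0 else 2) + 5 * L + K + 3"
proof -
  define S where "S = (if n = 2 then {} else {1, 2 :: nat})"
  define X where "X = (\<Union>j<L. {T2 + 20 * j + 1, T2 + 20 * j + 2, T2 + 20 * j + 16, T2 + 20 * j + 17})"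
  define Y where "Y = (\<lambda>j. T8 + 9 * (L - 1 - j) + 7) ` {..<L}"
  have 1: "op_times is_CNOT_op S1 \<subseteq> S"
  proof (cases "n = 2")
    case True
    have "cps i = []" for i
    proof -
      have u: "[0..<n] = [0, 1]" by (simp add: True upt_rec)
      then have "monomials n = [[0, 1], [0], [1]]" by (simp add: monomials_def)
      then show ?thesis unfolding cps_def u by simp
    qed
    then have "op_times is_CNOT_op S1 = {}"
      unfolding S1_def by (intro op_times_lchains(3)) (auto simp: chs1_def)
    then show ?thesis by simp
  next
    case False
    then show ?thesis unfolding S1_def S_def using op_times_lchains(2)[of 0 1 2 chs1] by simp
  qed
  \<comment> \<open>The Bell pairs for the monomial copies are created in the first CNOT layer of
    the conjunctions, so that the fan-out adds only the layer \<open>T4\<close>.\<close>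
  have "T2 + 20 * 0 + 1 \<in> X" unfolding X_def using L1 by (intro UN_I[of 0]) auto
  then have 4: "op_times is_CNOT_op S4 \<subseteq> X \<union> {T4}"
    unfolding S4_def using op_times_lchains(2)[of T2 "T2 + 1" T4 chs4] by auto
  have sub: "op_times is_CNOT_op prog \<subseteq> S \<union> X \<union> {T4} \<union> {T5..<T6} \<union> {T6, T6 + 1} \<union> Y"
    using 1 4 op_times_S2(2)[folded X_def] op_times_S5(2) op_times_S6(2) op_times_S8(2)[folded Y_def]
    unfolding prog_def op_times_simps op_times_free by blast
  have fin: "finite S" "finite X" "finite Y" by (auto simp: S_def X_def Y_def)
  have cS: "card S = (if n = 2 then 0 else 2)" by (simp add: S_def)
  have cX: "card X \<le> 4 * L"
  proof -
    have "card X \<le> (\<Sum>j<L. card {T2 + 20 * j + 1, T2 + 20 * j + 2, T2 + 20 * j + 16, T2 + 20 * j + 17})"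
      unfolding X_def by (rule card_UN_le) simp
    also have "\<dots> = (\<Sum>j<L. 4)" by (intro sum.cong) auto
    finally show ?thesis by simp
  qed
  have cY: "card Y \<le> L" unfolding Y_def using card_image_le[of "{..<L}"] by simp
  have "card (op_times is_CNOT_op prog) \<le> card (S \<union> X \<union> {T4} \<union> {T5..<T6} \<union> {T6, T6 + 1} \<union> Y)"
    by (rule card_mono[OF _ sub]) (use fin in simp)
  also have "\<dots> \<le> card S + card X + card {T4} + card {T5..<T6} + card {T6, T6 + 1} + card Y"
    by (intro order.trans[OF card_Un_le] add_mono order.refl)
  also have "\<dots> \<le> (if n = 2 then 0 else 2) + 4 * L + 1 + K + 2 + L"
    using cS cX cY by (simp add: T6_def)
  finally show ?thesis by simp
qed

end

text \<open>Only finitely many labels name qubits of the circuit, but injectivity is required on the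
  whole type; the remaining labels are sent beyond \<open>n + m + card S\<close> by means of
  \<open>to_nat\<close>.\<close>

lemma label_encoding:
  fixes n m :: nat and S :: "lab set"
  assumes fin: "finite S" and S: "\<And>i. In i \<notin> S" "\<And>j. Out j \<notin> S"
  shows "\<exists>e. inj e \<and> (\<forall>i<n. e (In i) = i) \<and> (\<forall>j<m. e (Out j) = n + j) \<and>
    (\<forall>a\<in>S. n + m \<le> e a \<and> e a < n + m + card S)"
proof -
  obtain h where h: "bij_betw h S {0..<card S}" using ex_bij_betw_finite_nat[OF fin] by blast
  have hS: "h a < card S" if "a \<in> S" for a
    using bij_betw_apply[OF h that] by simp
  have hi: "h a = h a' \<longleftrightarrow> a = a'" if "a \<in> S" "a' \<in> S" for a a'
    using bij_betw_imp_inj_on[OF h] that by (auto dest: inj_onD)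
  define big :: "lab \<Rightarrow> nat" where "big a = n + m + card S + to_nat a" for a
  define e where "e a = (if a \<in> S then n + m + h a else case a of
     In i \<Rightarrow> if i < n then i else big a | Out j \<Rightarrow> if j < m then n + j else big a | _ \<Rightarrow> big a)" for a
  have eS: "e a = n + m + h a" if "a \<in> S" for a
    using that by (simp add: e_def)
  have cases: "(a \<in> S \<and> e a = n + m + h a) \<or> (\<exists>i<n. a = In i \<and> e a = i) \<or> (\<exists>j<m. a = Out j \<and> e a = n + j) \<or> (a \<notin> S \<and> e a = big a)" for a
    by (cases a) (simp_all add: e_def S)
  have "inj e"
  proof (rule injI)
    fix a a' assume eq: "e a = e a'"
    consider (s) "a \<in> S" "e a = n + m + h a" | (i) i where "i < n" "a = In i" "e a = i"
      | (o) j where "j < m" "a = Out j" "e a = n + j" | (b) "e a = big a"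
      using cases[of a] by blast
    note c = this
    consider (s) "a' \<in> S" "e a' = n + m + h a'" | (i) i where "i < n" "a' = In i" "e a' = i"
      | (o) j where "j < m" "a' = Out j" "e a' = n + j" | (b) "e a' = big a'"
      using cases[of a'] by blast
    note c' = this
    show "a = a'"
    proof (rule c)
      assume a: "a \<in> S" "e a = n + m + h a"
      show ?thesis
      proof (rule c')
        assume a': "a' \<in> S" "e a' = n + m + h a'"
        then have "h a = h a'" using a eq by linarith
        then show ?thesis using hi[OF a(1) a'(1)] by blast
      qed (use a eq hS[OF a(1)] in \<open>simp_all add: big_def\<close>)
    next
      fix i assume a: "i < n" "a = In i" "e a = i"
      show ?thesis
        by (rule c') (use a eq in \<open>simp_all add: big_def\<close>)
    next
      fix j assume a: "j < m" "a = Out j" "e a = n + j"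
      show ?thesis
        by (rule c') (use a eq in \<open>simp_all add: big_def\<close>)
    next
      assume a: "e a = big a"
      show ?thesis
      proof (rule c')
        assume a': "a' \<in> S" "e a' = n + m + h a'"
        then show ?thesis using a eq hS[OF a'(1)] by (simp add: big_def)
      qed (use a eq in \<open>simp_all add: big_def\<close>)
    qed
  qed
  moreover have "e (In i) = i" if "i < n" for i using that S by (simp add: e_def)
  moreover have "e (Out j) = n + j" if "j < m" for j using that S by (simp add: e_def)
  moreover have "n + m \<le> e a \<and> e a < n + m + card S" if "a \<in> S" for a
    using hS[OF that] eS[OF that] by simp
  ultimately show ?thesis by (intro exI[of _ e]) simp
qed

lemma ceil_log2:
  fixes n :: nat
  assumes "2 \<le> n"
  defines "L \<equiv> nat \<lceil>log 2 (real n)\<rceil>"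
  shows "n \<le> 2 ^ L" "2 ^ (L - 1) < n" "int L = \<lceil>log 2 (real n)\<rceil>" "1 \<le> L"
proof -
  have pos: "0 < log 2 (real n)" using assms(1) by simp
  then have c: "0 < \<lceil>log 2 (real n)\<rceil>" by simp
  show L: "int L = \<lceil>log 2 (real n)\<rceil>" "1 \<le> L" using c unfolding L_def by linarith+
  have "log 2 (real n) \<le> real L" using L(1) by (metis le_of_int_ceiling of_int_of_nat_eq)
  then have "real n \<le> 2 powr real L" using assms(1) by (simp add: log_le_iff)
  then have "real n \<le> real (2 ^ L)" by (simp add: powr_realpow)
  then show "n \<le> 2 ^ L" by (simp only: of_nat_le_iff)
  have "real (L - 1) < log 2 (real n)"
    using L ceiling_correct[of "log 2 (real n)"] by (metis L(1) L(2) diff_less_mono of_int_of_nat_eq of_nat_1 of_nat_diff)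
  then have "2 powr real (L - 1) < real n" using assms(1) by (simp add: less_log_iff)
  then have "real (2 ^ (L - 1)) < real n" by (simp add: powr_realpow)
  then show "2 ^ (L - 1) < n" by (simp only: of_nat_less_iff)
qed

theorem theorem1:
  fixes n m :: nat and f :: "bool list \<Rightarrow> bool list"
  assumes "n \<ge> 2" and "m \<ge> 1"
    and "\<forall>xs. length xs = n \<longrightarrow> length (f xs) = m"
  shows "\<exists>C a. wf_circuit (n + m + a) C \<and> implements n m f C \<and>
           T_depth C = nat \<lceil>log 2 (real n)\<rceil> \<and>
           int a \<le> 2 ^ (n - 1) * (3 * int n - 2) - 3 * int n + int m + 1 \<and>
           T_count C \<le> 2 ^ (n + 1) * (n - 2) + 4 \<and>
           int (CNOT_count C) \<le> 2 ^ (n - 1) * (11 * int n + 2 * int m - 18) - 4 * int n - int m + 9 \<and>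
           int (CNOT_depth C) \<le> 2 ^ n + 2 * int n + 9 * \<lceil>log 2 (real n)\<rceil> - 3"
proof -
  define L where "L = nat \<lceil>log 2 (real n)\<rceil>"
  note L = ceil_log2[OF assms(1), folded L_def]
  \<comment> \<open>For \<open>n = 2\<close> there are three monomials, and
    \<open>2 * K + 6 \<le> 3 * K\<close> needs \<open>K \<ge> 6\<close>. For
    \<open>n \<ge> 3\<close> there are at least seven and \<open>K = B\<close> suffices.\<close>
  define K where "K = (if n = 2 then 6 else 2 ^ n - 1 :: nat)"
  have "\<exists>a. \<forall>v. f (map v [0..<n]) ! j = odd (length (filter (\<lambda>l. a l \<and> (\<forall>i\<in>set l. v i)) (subseqs [0..<n])))" for j
    by (rule anf_exists) (auto intro!: arg_cong[where f = "\<lambda>xs. f xs ! j"])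
  note ex = this
  from choice[OF allI[OF ex]] obtain a where
    a': "\<forall>j v. f (map v [0..<n]) ! j = odd (length (filter (\<lambda>l. a j l \<and> (\<forall>i\<in>set l. v i)) (subseqs [0..<n])))"
    by (rule exE)
  have a: "f (map v [0..<n]) ! j = odd (length (filter (\<lambda>l. a j l \<and> (\<forall>i\<in>set l. v i)) (subseqs [0..<n])))" for j v
    by (rule a'[THEN spec, THEN spec])
  define A where "A j k \<longleftrightarrow> j < m \<and> a j (monomials n ! k)" for j k
  define c0 where "c0 j = a j []" for j
  define S where "S = set (mono_circuit.ancs n m K)"
  have mc: "mono_circuit n m K L A e'" if "inj e'" for e' :: "lab \<Rightarrow> nat"
  proof
    show "2 ^ n - 1 \<le> K" by (cases "n = 2") (simp_all add: K_def)
    show "\<not> A j k" if "m \<le> j" for j k using that by (simp add: A_def)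
  qed (use that assms(1,2) L(1) in blast)+
  \<comment> \<open>The set of ancilla labels does not depend on the encoding, so its properties are
    obtained with \<open>to_nat\<close> before \<open>e\<close> is chosen to fit it.\<close>
  note pre = mono_circuit.in_ancs(6,7)[OF mc[OF inj_to_nat], folded S_def]
  have S: "finite S" "In i \<notin> S" "Out j \<notin> S" for i j
    using pre unfolding S_def by (blast intro: finite_set)+
  from label_encoding[OF S, of n m] obtain e where e': "inj e \<and> (\<forall>i<n. e (In i) = i) \<and> (\<forall>j<m. e (Out j) = n + j) \<and>
    (\<forall>a\<in>S. n + m \<le> e a \<and> e a < n + m + card S)"
    by (rule exE)
  have e: "inj e" "\<And>i. i < n \<Longrightarrow> e (In i) = i" "\<And>j. j < m \<Longrightarrow> e (Out j) = n + j"
    "\<And>a. a \<in> S \<Longrightarrow> n + m \<le> e a \<and> e a < n + m + card S"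
    using e' by simp_all
  interpret mono_circuit n m K L A c0 e
    by (rule mc[OF e(1)])
  obtain D where D: "\<forall>x\<in>set prog. fst x < D"
    using tend[where P = prog] by (intro that[of "tend prog"]) simp
  define C where "C = layers D prog"
  have labs_less: "e ` labs \<subseteq> {..<n + m + card S}"
  proof
    fix q assume "q \<in> e ` labs"
    then obtain x where x: "q = e x" "x \<in> In ` {..<n} \<or> x \<in> Out ` {..<m} \<or> x \<in> S"
      by (auto simp: labs_def S_def)
    then show "q \<in> {..<n + m + card S}" using e(2,3,4) by fastforce
  qed
  have wf: "wf_circuit (n + m + card S) C"
    unfolding C_def
  proof (rule wf_circuit_layers[OF sched_prog _ causal_prog distinct_meas_bits D])
    show "wf_ops {..<n + m + card S} prog"
      using wf_prog labs_less unfolding wf_ops_def by blast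
  qed
  have impl: "implements n m f C"
    unfolding implements_def
  proof
    fix o' :: "nat \<Rightarrow> bool"
    \<comment> \<open>One factor \<open>1 / sqrt 2\<close> per measurement; it depends neither on
      the input nor on the branch.\<close>
    let ?\<kappa> = "rt ^ length (filter (\<lambda>p. meas_bit p \<noteq> None) (map snd prog))"
    show "\<exists>\<kappa>. \<forall>xs ys. length xs = n \<longrightarrow> length ys = m \<longrightarrow>
        exec o' C (ket (enc xs ys)) = (\<lambda>b. \<kappa> * ket (enc xs (map2 (\<noteq>) ys (f xs))) b)"
    proof (intro exI[of _ ?\<kappa>] allI impI)
      fix xs ys :: "bool list" assume len: "length xs = n" "length ys = m"
      let ?b = "enc xs ys"
      interpret mono_run n m K L A c0 e o' ?b
      proof
        fix x assume "x \<in> set ancs"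
        then have "n + m \<le> e x" using e(4) by (simp add: S_def)
        then show "\<not> enc xs ys (e x)" using len by (simp add: enc_def)
      qed
      have val: "(c0 j \<noteq> odd (length (filter (\<lambda>k. A j k \<and> mv k) [0..<B]))) = f xs ! j" if j: "j < m" for j
      proof -
        let ?Q = "\<lambda>l. a j l \<and> (\<forall>i\<in>set l. xs ! i)"
        have "filter (\<lambda>k. A j k \<and> mv k) [0..<B] = filter (\<lambda>k. ?Q (monomials n ! k)) [0..<B]"
        proof (rule filter_cong[OF refl])
          fix k assume "k \<in> set [0..<B]"
          then have "monomials n ! k \<in> set (monomials n)" by (simp add: B_def)
          then have "set (monomials n ! k) \<subseteq> {..<n}" using set_monomials by blast
          then have "?b (e (In i)) = xs ! i" if "i \<in> set (monomials n ! k)" for i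
            using that e(2)[of i] len by (auto simp: enc_def)
          then show "(A j k \<and> mv k) = ?Q (monomials n ! k)" using j by (simp add: A_def mv_def)
        qed
        moreover have "length (filter (\<lambda>k. ?Q (monomials n ! k)) [0..<B]) = length (filter ?Q (map ((!) (monomials n)) [0..<B]))"
          by (simp add: filter_map o_def)
        moreover have "map ((!) (monomials n)) [0..<B] = monomials n"
          unfolding B_def by (rule map_nth)
        ultimately have 1: "length (filter (\<lambda>k. A j k \<and> mv k) [0..<B]) = length (filter ?Q (monomials n))" by (simp only:)
        have "map ((!) xs) [0..<n] = xs" using map_nth[of xs] len by simp
        then have "f xs ! j = odd (length (filter ?Q (subseqs [0..<n])))" using a[of "(!) xs" j] by simp
        then show ?thesis unfolding 1 monomials_split c0_def by auto
      qed
      have final: "(\<lambda>q. ?b q \<noteq> (\<exists>j<m. q = e (Out j) \<and> (c0 j \<noteq> odd (length (filter (\<lambda>k. A j k \<and> mv k) [0..<B]))))) =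
         enc xs (map2 (\<noteq>) ys (f xs))"
      proof
        fix q
        have flen: "length (f xs) = m" using assms(3) len by simp
        have "(\<exists>j<m. q = e (Out j) \<and> (c0 j \<noteq> odd (length (filter (\<lambda>k. A j k \<and> mv k) [0..<B])))) \<longleftrightarrow>
            (n \<le> q \<and> q < n + m \<and> f xs ! (q - n))"
        proof
          assume "\<exists>j<m. q = e (Out j) \<and> (c0 j \<noteq> odd (length (filter (\<lambda>k. A j k \<and> mv k) [0..<B])))"
          then obtain j where "j < m" "q = e (Out j)" "f xs ! j" using val by blast
          then show "n \<le> q \<and> q < n + m \<and> f xs ! (q - n)" using e(3)[of j] by simp
        next
          assume q: "n \<le> q \<and> q < n + m \<and> f xs ! (q - n)"
          then have "q - n < m" "q = e (Out (q - n))" using e(3)[of "q - n"] by auto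
          then show "\<exists>j<m. q = e (Out j) \<and> (c0 j \<noteq> odd (length (filter (\<lambda>k. A j k \<and> mv k) [0..<B])))"
            using val[of "q - n"] q by blast
        qed
        then show "(?b q \<noteq> (\<exists>j<m. q = e (Out j) \<and> (c0 j \<noteq> odd (length (filter (\<lambda>k. A j k \<and> mv k) [0..<B]))))) =
            enc xs (map2 (\<noteq>) ys (f xs)) q"
          using len flen by (auto simp: enc_def)
      qed
      have "sends o' (map snd prog) ?b (enc xs (map2 (\<noteq>) ys (f xs)))"
        using sends_prog unfolding final .
      then have run: "run o' (map snd prog) (ket ?b) = (\<lambda>b. ?\<kappa> * ket (enc xs (map2 (\<noteq>) ys (f xs))) b)"
        unfolding sends_def psends_def .
      show "exec o' C (ket ?b) = (\<lambda>b. ?\<kappa> * ket (enc xs (map2 (\<noteq>) ys (f xs))) b)"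
        unfolding C_def exec_layers[OF sched_prog D] by (rule run)
    qed
  qed
  have Bi: "int B = 2 * int half - 1" using B_half by linarith
  have hi: "2 ^ (n - 1) = int half" by (simp add: half_def)
  have Tdep: "T_depth C = L"
    unfolding C_def T_depth_layers[OF D] using T_depth_prog[OF L(2)] .
  have anc: "int (card S) \<le> 2 ^ (n - 1) * (3 * int n - 2) - 3 * int n + int m + 1"
  proof -
    have "int (card S) + 3 * int n + int B \<le> 3 * (int n * int half) + int m"
    proof -
      have "int (card S + 3 * n + B) \<le> int (3 * (n * half) + m)"
        unfolding of_nat_le_iff S_def by (rule ancilla_total)
      then show ?thesis by simp
    qed
    then show ?thesis unfolding Bi hi by (simp add: algebra_simps)
  qed
  have Tc: "T_count C \<le> 2 ^ (n + 1) * (n - 2) + 4"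
  proof -
    have "T_count C + 4 * B \<le> 4 * (n * half)"
      unfolding C_def T_count_layers[OF D] by (rule T_total)
    moreover have "n * half = (n - 2) * half + 2 * half"
    proof -
      have "n - 2 + 2 = n" using assms(1) by simp
      then show ?thesis using add_mult_distrib[of "n - 2" 2 half] by (simp only:)
    qed
    moreover have "2 ^ (n + 1) * (n - 2) = 4 * ((n - 2) * half)"
      using pow_half by simp
    ultimately show ?thesis using B_half by linarith
  qed
  have KB: "2 * K + 2 * B \<le> B * K"
  proof (cases "n = 2")
    case True
    then show ?thesis using B_eq by (simp add: K_def)
  next
    case False
    then have "K = B" by (simp add: K_def B_eq)
    moreover have "4 \<le> B"
    proof -
      have "(2::nat) ^ 3 \<le> 2 ^ n" using False assms(1) by (intro power_increasing) auto
      then show ?thesis by (simp add: B_eq)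
    qed
    then have "4 * B \<le> B * B" by (rule mult_le_mono1)
    ultimately show ?thesis by simp
  qed
  have Cc: "int (CNOT_count C) \<le> 2 ^ (n - 1) * (11 * int n + 2 * int m - 18) - 4 * int n - int m + 9"
  proof -
    have "int (CNOT_count C + 4 * n + 7 * B) \<le> int (9 * (n * half) + B * m)"
      unfolding of_nat_le_iff C_def CNOT_count_layers[OF D] by (rule CNOT_total[OF KB])
    then have "int (CNOT_count C) + 4 * int n + 7 * int B \<le> 9 * (int n * int half) + int B * int m"
      by simp
    \<comment> \<open>The bound exceeds the estimate by \<open>2 * (n - 2) * half + 2\<close>, which
      is where \<open>n \<ge> 2\<close> enters.\<close>
    moreover have "2 * int half \<le> int n * int half"
      using assms(1) by (intro mult_right_mono) auto
    ultimately show ?thesis unfolding Bi hi by (simp add: algebra_simps)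
  qed
  have Cd: "int (CNOT_depth C) \<le> 2 ^ n + 2 * int n + 9 * \<lceil>log 2 (real n)\<rceil> - 3"
  proof -
    have 1: "CNOT_depth C \<le> (if n = 2 then 0 else 2) + 5 * L + K + 3"
      unfolding C_def CNOT_depth_layers[OF D] by (rule CNOT_depth_prog)
    show ?thesis
    proof (cases "n = 2")
      case True
      \<comment> \<open>Here \<open>L = 1\<close>, and both the estimate and the bound equal
        14.\<close>
      then show ?thesis using 1 L(3,4) by (simp add: K_def)
    next
      case False
      have "int K = 2 ^ n - 1"
        using False by (simp add: K_def of_nat_diff)
      then show ?thesis using 1 L(3,4) False assms(1) by simp
    qed
  qed
  have Td: "T_depth C = nat \<lceil>log 2 (real n)\<rceil>"
    using Tdep unfolding L_def .
  show ?thesis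
    by (rule exI[of _ C], rule exI[of _ "card S"], rule conjI[OF wf conjI[OF impl conjI[OF Td conjI[OF anc conjI[OF Tc conjI[OF Cc Cd]]]]]])
qed

end
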